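(* Let $d\ge 1$ be an integer, let $0<\alpha<d$, and let $V>0$. For $l>0$ let $B_l^{+}$ and $B_l^{-}$ be two balls in $\mathbb{R}^d$, each of Lebesgue measure $V/2$, with $\operatorname{dist}(B_l^{+},B_l^{-})=l$. Then the maximum (supremum) of the second eigenvalue $\lambda_2(\Omega)$ of $\mathcal{R}_{\alpha,\Omega}$ among all measurable sets $\Omega\subset\mathbb{R}^d$ of measure $V$ is approached by the union of these two identical balls as their mutual distance goes to infinity, i.e. $$\sup\{\lambda_2(\Omega):\ \Omega\subset\mathbb{R}^d \text{ measurable},\ |\Omega|=V\}=\lim_{l\to\infty}\lambda_2(B_l^{+}\cup B_l^{-}).$$
   Context: $|\cdot|$ denotes Lebesgue measure on $\mathbb{R}^d$. For a measurable set $\Omega\subset\mathbb{R}^d$ of finite Lebesgue measure and $0<\alpha<d$, the Riesz potential operator $\mathcal{R}_{\alpha,\Omega}$ on $L^2(\Omega)$ is $$(\mathcal{R}_{\alpha,\Omega}f)(x)=\int_{\Omega}c_{\alpha,d}|x-y|^{\alpha-d}f(y)\,dy,\qquad f\in L^2(\Omega),$$ where $c_{\alpha,d}=2^{\alpha-d}\pi^{-d/2}\,\Gamma(\alpha/2)/\Gamma((d-\alpha)/2)>0$. It is a compact, self-adjoint, nonnegative operator on $L^2(\Omega)$. Its eigenvalues are enumerated in descending order, $\lambda_1(\Omega)\ge\lambda_2(\Omega)\ge\dots$, each repeated according to its multiplicity. *)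

theory Defs
  imports "HOL-Analysis.Analysis"
begin

definition riesz_const :: "nat \<Rightarrow> real \<Rightarrow> real" where
  "riesz_const d \<alpha> = 2 powr (\<alpha> - real d) * pi powr (- (real d / 2)) *
     (Gamma (\<alpha> / 2) / Gamma ((real d - \<alpha>) / 2))"

text \<open>On the diagonal the kernel takes the value \<open>0 powr (\<alpha> - d) = 0\<close>; this concerns a null set
  of \<open>y\<close> only.\<close>

definition riesz_potential ::
    "real \<Rightarrow> 'a::euclidean_space set \<Rightarrow> ('a \<Rightarrow> real) \<Rightarrow> 'a \<Rightarrow> real" where
  "riesz_potential \<alpha> \<Omega> f x =
     (LINT y|lebesgue_on \<Omega>. riesz_const DIM('a) \<alpha> * norm (x - y) powr (\<alpha> - real DIM('a)) * f y)"

text \<open>Elements of \<open>L\<^sup>2(\<Omega>)\<close> are represented by functions, of which only the restriction to \<open>\<Omega>\<close>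
  matters. Almost everywhere equal functions are not identified at the level of this set, so the
  linear algebra below is carried out modulo almost everywhere equality on \<open>\<Omega>\<close>.\<close>

definition L2_fun :: "'a::euclidean_space set \<Rightarrow> ('a \<Rightarrow> real) set" where
  "L2_fun \<Omega> = {f. f \<in> borel_measurable (lebesgue_on \<Omega>) \<and> integrable (lebesgue_on \<Omega>) (\<lambda>x. (f x)\<^sup>2)}"

definition riesz_eigenspace ::
    "real \<Rightarrow> 'a::euclidean_space set \<Rightarrow> real \<Rightarrow> ('a \<Rightarrow> real) set" where
  "riesz_eigenspace \<alpha> \<Omega> \<mu> =
     {f \<in> L2_fun \<Omega>. AE x in lebesgue_on \<Omega>. riesz_potential \<alpha> \<Omega> f x = \<mu> * f x}"

text \<open>\<open>has_dim_ae \<Omega> E n\<close>: the image of the linear space \<open>E\<close> in \<open>L\<^sup>2(\<Omega>)\<close> has a basis with \<open>n\<close>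
  elements.\<close>

definition has_dim_ae :: "'a::euclidean_space set \<Rightarrow> ('a \<Rightarrow> real) set \<Rightarrow> nat \<Rightarrow> bool" where
  "has_dim_ae \<Omega> E n \<longleftrightarrow>
     (\<exists>b :: nat \<Rightarrow> 'a \<Rightarrow> real.
        (\<forall>i<n. b i \<in> E) \<and>
        (\<forall>c :: nat \<Rightarrow> real. (AE x in lebesgue_on \<Omega>. (\<Sum>i<n. c i * b i x) = 0) \<longrightarrow> (\<forall>i<n. c i = 0)) \<and>
        (\<forall>f\<in>E. \<exists>c :: nat \<Rightarrow> real. AE x in lebesgue_on \<Omega>. f x = (\<Sum>i<n. c i * b i x)))"

text \<open>The usual convention for compact nonnegative operators: every \<open>\<mu> > 0\<close> occurs in the sequence
  as often as its multiplicity says (not at all if it is not an eigenvalue), and if there are only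
  finitely many positive eigenvalues, the sequence continues with zeros. These conditions
  determine the sequence.\<close>

definition riesz_eigenvalue_enumeration ::
    "real \<Rightarrow> 'a::euclidean_space set \<Rightarrow> (nat \<Rightarrow> real) \<Rightarrow> bool" where
  "riesz_eigenvalue_enumeration \<alpha> \<Omega> lam \<longleftrightarrow>
     decseq lam \<and> (\<forall>k. 0 \<le> lam k) \<and>
     (\<forall>\<mu>>0. finite {k. lam k = \<mu>} \<and>
            has_dim_ae \<Omega> (riesz_eigenspace \<alpha> \<Omega> \<mu>) (card {k. lam k = \<mu>}))"

text \<open>\<open>riesz_eigenvalue \<alpha> \<Omega> k\<close> is \<open>\<lambda>\<^sub>k(\<Omega>)\<close> for \<open>k \<ge> 1\<close>, while the enumerating sequence is indexed
  from zero.\<close>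

definition riesz_eigenvalue :: "real \<Rightarrow> 'a::euclidean_space set \<Rightarrow> nat \<Rightarrow> real" where
  "riesz_eigenvalue \<alpha> \<Omega> k = (SOME lam. riesz_eigenvalue_enumeration \<alpha> \<Omega> lam) (k - 1)"

end

theory Submission
  imports Defs "HOL-Complex_Analysis.Great_Picard"
begin

text \<open>Let \<open>\<Lambda>\<close> be the supremum of the Rayleigh quotient over nonnegative functions supported in a
  ball of measure \<open>V / 2\<close>. Of two orthogonal eigenfunctions for the first two eigenvalues at least
  one changes sign, since the kernel is positive. Its positive or its negative part lives on a set
  of measure at most \<open>V / 2\<close> and has Rayleigh quotient at least its eigenvalue; by rearrangement this
  quotient is at most \<open>\<Lambda>\<close>, so \<open>\<lambda>\<^sub>2(\<Omega>) \<le> \<Lambda>\<close>. The rearrangement inequality is obtained for Lipschitz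
  functions from polarization: a competitor of minimal second moment is radially decreasing.
  Conversely, translates of a nearly optimal function to two balls at distance \<open>l\<close> span a plane on
  which the Rayleigh quotient is at least \<open>\<Lambda> - \<epsilon> - C l\<^sup>\<alpha>\<^sup>-\<^sup>d\<close>, so \<open>\<lambda>\<^sub>2\<close> of the two balls tends to \<open>\<Lambda>\<close>.\<close>

section \<open>Compact symmetric operators\<close>

text \<open>All operators act on one space, L2 of the whole of R^d: \<Omega> is replaced by a Borel
  set \<open>W\<close> equal to it up to a null set, and the kernel is cut off to \<open>W\<close>
  in both variables. Eigenvectors for \<mu> \<noteq> 0 vanish off \<open>W\<close>, so the positive
  spectrum is that on \<Omega>. The second eigenvalue is at least c > 0 exactly if there are two
  orthogonal eigenvectors with eigenvalues at least c; both halves of the proof work with such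
  pairs. Polarization is used because one reflection involves only the values at four points, x, y
  and their mirror images, so its effect on the energy is an inequality between numbers, and because
  it keeps Lipschitz constants, so that Arzela-Ascoli yields the minimizer. The price is a passage
  from Lipschitz to measurable functions: a step function on compact sets is approached from above
  by Lipschitz cones, whose supports are larger than its own, so some measure must be left to spare.
  Energies are \<open>ennreal\<close>-valued, which keeps integrability questions out of the
  rearrangement part. Compactness of the operators comes from bounded Lipschitz kernels, which
  approximate the singular kernel in L1.\<close>

locale compact_symmetric =
  fixes T :: "'v::real_inner \<Rightarrow> 'v"
  assumes bounded_linear: "bounded_linear T"
    and symmetric: "T x \<bullet> y = x \<bullet> T y"
    and compact: "(\<And>n::nat. norm (X n) \<le> 1) \<Longrightarrow> \<exists>l r. strict_mono r \<and> (\<lambda>n. T (X (r n))) \<longlonglongrightarrow> l"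
begin

lemmas add = linear_add[OF bounded_linear.linear[OF bounded_linear]]
lemmas diff = linear_diff[OF bounded_linear.linear[OF bounded_linear]]
lemmas scale = linear_scale[OF bounded_linear.linear[OF bounded_linear]]
lemmas zero = linear_0[OF bounded_linear.linear[OF bounded_linear]]

text \<open>The zero vector is included, so each \<open>eigen \<mu>\<close> describes a linear
  subspace.\<close>

definition eigen :: "real \<Rightarrow> 'v \<Rightarrow> bool" where
  "eigen \<mu> x \<longleftrightarrow> T x = \<mu> *\<^sub>R x"

lemma eigen_orthogonal:
  assumes "eigen \<mu> x" "eigen \<nu> y" "\<mu> \<noteq> \<nu>"
  shows "x \<bullet> y = 0"
proof -
  have "\<mu> * (x \<bullet> y) = \<nu> * (x \<bullet> y)"
    using symmetric[of x y] assms by (simp add: eigen_def)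
  then show ?thesis using assms by simp
qed

text \<open>The quadratic form \<open>\<mu> x \<bullet> x - T x \<bullet> x\<close> is nonnegative on the complement of \<open>S\<close>; evaluating
  it at \<open>x - s y\<close> with \<open>y = \<mu> x - T x\<close> shows that maximizing sequences are almost eigenvectors.\<close>

lemma maximizing_eigenvector:
  assumes S: "\<And>e. e \<in> S \<Longrightarrow> \<exists>\<mu>. eigen \<mu> e"
    and f: "\<And>e. e \<in> S \<Longrightarrow> f \<bullet> e = 0" "f \<noteq> 0" "T f \<bullet> f \<ge> c * (f \<bullet> f)" "0 < c"
  obtains e \<mu> where "norm e = 1" "eigen \<mu> e" "\<mu> \<ge> c" "\<And>x. x \<in> S \<Longrightarrow> e \<bullet> x = 0"
proof -
  define M where "M = {x. \<forall>e\<in>S. x \<bullet> e = 0}"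
  have M_T: "T x \<in> M" if "x \<in> M" for x
    unfolding M_def
  proof (intro CollectI ballI)
    fix e assume e: "e \<in> S"
    then obtain \<nu> where "T e = \<nu> *\<^sub>R e" using S unfolding eigen_def by blast
    then show "T x \<bullet> e = 0" using that e by (simp add: symmetric M_def)
  qed
  have M_lin: "a *\<^sub>R x + b *\<^sub>R y \<in> M" if "x \<in> M" "y \<in> M" for a b x y
    using that by (auto simp: M_def inner_add_left)
  have M_lin': "a *\<^sub>R x - b *\<^sub>R y \<in> M" if "x \<in> M" "y \<in> M" for a b x y
    using that by (auto simp: M_def inner_diff_left)
  have M_scale: "a *\<^sub>R x \<in> M" if "x \<in> M" for a x
    using that by (auto simp: M_def)
  obtain K where K: "\<And>x. norm (T x) \<le> norm x * K" "K > 0"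
    using bounded_linear.pos_bounded[OF bounded_linear] by blast
  define Q where "Q = {T x \<bullet> x | x. x \<in> M \<and> norm x = 1}"
  have Q_bound: "q \<le> K" if q: "q \<in> Q" for q
  proof -
    obtain x where x: "q = T x \<bullet> x" "norm x = 1" using q unfolding Q_def by blast
    have "q \<le> norm (T x) * norm x" unfolding x(1) by (rule norm_cauchy_schwarz)
    also have "\<dots> \<le> K" using K(1)[of x] x by simp
    finally show ?thesis .
  qed
  have bdd: "bdd_above Q" using Q_bound by (auto simp: bdd_above_def)
  define f1 where "f1 = (1 / norm f) *\<^sub>R f"
  have f1: "norm f1 = 1" "f1 \<in> M" using f M_scale by (auto simp: f1_def M_def)
  have "T f1 \<bullet> f1 = (T f \<bullet> f) / (norm f)^2"
    by (simp add: f1_def scale power2_eq_square)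
  also have "\<dots> \<ge> c" using f by (simp add: pos_le_divide_eq power2_norm_eq_inner)
  finally have Qc: "T f1 \<bullet> f1 \<in> Q" "T f1 \<bullet> f1 \<ge> c" using f1 by (auto simp: Q_def)
  define \<mu> where "\<mu> = Sup Q"
  have \<mu>c: "\<mu> \<ge> c" unfolding \<mu>_def using Qc bdd cSup_upper2 by blast
  then have \<mu>0: "\<mu> > 0" using f by linarith
  have \<mu>_up: "T x \<bullet> x \<le> \<mu> * (x \<bullet> x)" if "x \<in> M" for x
  proof (cases "x = 0")
    case False
    have "T ((1 / norm x) *\<^sub>R x) \<bullet> ((1 / norm x) *\<^sub>R x) \<in> Q"
      using False M_scale[OF that] by (auto simp: Q_def intro!: exI[of _ "(1 / norm x) *\<^sub>R x"])
    then have "T ((1 / norm x) *\<^sub>R x) \<bullet> ((1 / norm x) *\<^sub>R x) \<le> \<mu>"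
      unfolding \<mu>_def using bdd cSup_upper by blast
    then have "(T x \<bullet> x) / (norm x)^2 \<le> \<mu>" by (simp add: scale power2_eq_square)
    then show ?thesis using False by (simp add: pos_divide_le_eq power2_norm_eq_inner)
  qed (simp add: zero)
  define L where "L = \<mu> + K"
  have L0: "L > 0" using \<mu>0 K by (simp add: L_def)
  have key: "norm (\<mu> *\<^sub>R x - T x)^2 \<le> L * (\<mu> * (x \<bullet> x) - T x \<bullet> x)" if x: "x \<in> M" for x
  proof -
    define y where "y = \<mu> *\<^sub>R x - T x"
    \<comment> \<open>\<open>L\<close> bounds the quadratic form of \<mu> - T on unit vectors, and s
      = 1 / L minimizes - 2 * s + s^2 * L, the factor of y \<bullet> y once that bound is
      inserted.\<close>
    define s where "s = 1 / L"
    have yM: "y \<in> M" unfolding y_def using M_lin'[OF x M_T[OF x], of \<mu> 1] by simp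
    have "x - s *\<^sub>R y \<in> M" using M_lin'[OF x yM, of 1 s] by simp
    from \<mu>_up[OF this]
    have "0 \<le> \<mu> * (x \<bullet> x) - T x \<bullet> x - 2 * s * (\<mu> * (x \<bullet> y) - T x \<bullet> y) + s^2 * (\<mu> * (y \<bullet> y) - T y \<bullet> y)"
      using symmetric[of x y]
      by (simp add: diff scale inner_diff_left inner_diff_right algebra_simps power2_eq_square inner_commute)
    also have "\<mu> * (x \<bullet> y) - T x \<bullet> y = y \<bullet> y" by (simp add: y_def inner_diff_left)
    finally have 1: "0 \<le> \<mu> * (x \<bullet> x) - T x \<bullet> x - 2 * s * (y \<bullet> y) + s^2 * (\<mu> * (y \<bullet> y) - T y \<bullet> y)" .
    have "- (T y \<bullet> y) \<le> norm (T y) * norm y" using norm_cauchy_schwarz[of "- T y" y] by simp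
    also have "\<dots> \<le> K * (y \<bullet> y)"
      using mult_right_mono[OF K(1)[of y], of "norm y"]
      by (simp add: power2_norm_eq_inner[symmetric] power2_eq_square mult_ac)
    finally have "\<mu> * (y \<bullet> y) - T y \<bullet> y \<le> L * (y \<bullet> y)" by (simp add: L_def algebra_simps)
    then have "s^2 * (\<mu> * (y \<bullet> y) - T y \<bullet> y) \<le> s^2 * (L * (y \<bullet> y))" by (intro mult_left_mono) auto
    also have "\<dots> = s * (y \<bullet> y)" using L0 by (simp add: s_def power2_eq_square)
    finally have "s * (y \<bullet> y) \<le> \<mu> * (x \<bullet> x) - T x \<bullet> x" using 1 by simp
    then have "y \<bullet> y \<le> L * (\<mu> * (x \<bullet> x) - T x \<bullet> x)"
      using L0 by (simp add: s_def field_simps)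
    then show ?thesis by (simp add: y_def power2_norm_eq_inner)
  qed
  have "\<exists>x. x \<in> M \<and> norm x = 1 \<and> T x \<bullet> x > \<mu> - 1 / real (Suc n)" for n
  proof -
    have "\<mu> - 1 / real (Suc n) < Sup Q" by (simp add: \<mu>_def)
    then obtain q where "q \<in> Q" "\<mu> - 1 / real (Suc n) < q"
      using less_cSup_iff[of Q] bdd Qc by auto
    then show ?thesis unfolding Q_def by auto
  qed
  then obtain x where x: "\<And>n. x n \<in> M" "\<And>n. norm (x n) = 1"
      "\<And>n::nat. T (x n) \<bullet> x n > \<mu> - 1 / real (Suc n)" by metis
  have res: "norm (\<mu> *\<^sub>R x n - T (x n)) \<le> sqrt (L * (1 / real (Suc n)))" for n
  proof (rule real_le_rsqrt)
    have "\<mu> * (x n \<bullet> x n) - T (x n) \<bullet> x n \<le> 1 / real (Suc n)"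
      using x(2,3)[of n] by (simp add: power2_norm_eq_inner[symmetric])
    with L0 have "L * (\<mu> * (x n \<bullet> x n) - T (x n) \<bullet> x n) \<le> L * (1 / real (Suc n))"
      by (intro mult_left_mono) auto
    with key[OF x(1), of n] show "(norm (\<mu> *\<^sub>R x n - T (x n)))\<^sup>2 \<le> L * (1 / real (Suc n))"
      by linarith
  qed
  have "(\<lambda>n. sqrt (L * (1 / real (Suc n)))) \<longlonglongrightarrow> 0"
    using tendsto_real_sqrt[OF tendsto_mult_right_zero[OF LIMSEQ_inverse_real_of_nat, of L]]
    by (simp add: inverse_eq_divide)
  then have lim0: "(\<lambda>n. \<mu> *\<^sub>R x n - T (x n)) \<longlonglongrightarrow> 0"
    by (rule Lim_null_comparison[rotated]) (use res in simp)
  obtain l r where r: "strict_mono r" "(\<lambda>n. T (x (r n))) \<longlonglongrightarrow> l"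
    using compact[of x] x(2) by auto
  \<comment> \<open>As \<mu> > 0, a vector is recovered from its residual and its image under
    \<open>T\<close>. The images converge along \<open>r\<close> and the residuals tend to zero, so
    the vectors themselves converge.\<close>
  have "(\<lambda>n. (1/\<mu>) *\<^sub>R ((\<mu> *\<^sub>R x (r n) - T (x (r n))) + T (x (r n)))) \<longlonglongrightarrow> (1/\<mu>) *\<^sub>R (0 + l)"
    using LIMSEQ_subseq_LIMSEQ[OF lim0 r(1)]
    by (intro tendsto_scaleR[OF tendsto_const] tendsto_add[OF _ r(2)]) (simp add: o_def)
  then have lim: "(\<lambda>n. x (r n)) \<longlonglongrightarrow> (1/\<mu>) *\<^sub>R l" using \<mu>0 by simp
  define e where "e = (1/\<mu>) *\<^sub>R l"
  have "(\<lambda>n. T (x (r n))) \<longlonglongrightarrow> T e"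
    unfolding e_def by (intro bounded_linear.tendsto[OF bounded_linear] lim)
  then have "T e = l" using r LIMSEQ_unique by blast
  then have "eigen \<mu> e" using \<mu>0 by (simp add: eigen_def e_def)
  moreover have "(\<lambda>n. norm (x (r n))) \<longlonglongrightarrow> norm e" unfolding e_def by (intro tendsto_norm lim)
  then have "norm e = 1" using x(2) LIMSEQ_unique[OF _ tendsto_const] by simp
  moreover have "e \<bullet> s = 0" if "s \<in> S" for s
  proof -
    have "(\<lambda>n. x (r n) \<bullet> s) \<longlonglongrightarrow> e \<bullet> s" unfolding e_def by (intro tendsto_inner lim tendsto_const)
    moreover have "x (r n) \<bullet> s = 0" for n using x(1) that by (auto simp: M_def)
    ultimately show ?thesis using LIMSEQ_unique[OF _ tendsto_const] by simp
  qed
  ultimately show ?thesis using that \<mu>c by blast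
qed

text \<open>The lower half of the min-max principle for the second eigenvalue. A plane always
  contains a nonzero vector orthogonal to the first eigenvector, and this vector shows that the
  maximum over the orthogonal complement is still at least \<open>c\<close>.\<close>

lemma two_eigenvectors:
  assumes fg: "\<And>a b. a \<noteq> 0 \<or> b \<noteq> 0 \<Longrightarrow> a *\<^sub>R f + b *\<^sub>R g \<noteq> 0"
    and Q: "\<And>a b. T (a *\<^sub>R f + b *\<^sub>R g) \<bullet> (a *\<^sub>R f + b *\<^sub>R g) \<ge> c * ((a *\<^sub>R f + b *\<^sub>R g) \<bullet> (a *\<^sub>R f + b *\<^sub>R g))"
    and "0 < c"
  obtains e1 e2 \<mu>1 \<mu>2 where "norm e1 = 1" "norm e2 = 1" "e1 \<bullet> e2 = 0" "eigen \<mu>1 e1" "eigen \<mu>2 e2"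
    "\<mu>1 \<ge> c" "\<mu>2 \<ge> c"
proof -
  obtain e1 \<mu>1 where e1: "norm e1 = 1" "eigen \<mu>1 e1" "\<mu>1 \<ge> c"
    using maximizing_eigenvector[of "{}" f c] fg[of 1 0] Q[of 1 0] \<open>0 < c\<close> by auto
  \<comment> \<open>The coefficients of a vector in the span of \<open>f\<close> and
    \<open>g\<close> orthogonal to \<open>e1\<close>: \<open>f\<close> itself if possible, otherwise
    (g \<bullet> e1) f - (f \<bullet> e1) g.\<close>
  define a where "a = (if f \<bullet> e1 = 0 then 1 else g \<bullet> e1)"
  define b where "b = (if f \<bullet> e1 = 0 then 0 else - (f \<bullet> e1))"
  have "a \<noteq> 0 \<or> b \<noteq> 0" "(a *\<^sub>R f + b *\<^sub>R g) \<bullet> e1 = 0"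
    by (auto simp: a_def b_def inner_add_left)
  then obtain e2 \<mu>2 where "norm e2 = 1" "eigen \<mu>2 e2" "\<mu>2 \<ge> c" "e2 \<bullet> e1 = 0"
    using maximizing_eigenvector[of "{e1}" "a *\<^sub>R f + b *\<^sub>R g" c] fg[of a b] Q[of a b] \<open>0 < c\<close> e1 by auto
  with e1 that show ?thesis by (simp add: inner_commute)
qed

text \<open>The images of two orthonormal eigenvectors are at distance sqrt (\<mu>^2 + \<nu>^2)
  \<ge> \<epsilon>, so the images of an infinite family would have no Cauchy subsequence.\<close>

lemma finite_orthonormal_eigenvectors:
  assumes "0 < \<epsilon>" and B: "\<And>e. e \<in> B \<Longrightarrow> norm e = 1 \<and> (\<exists>\<mu>\<ge>\<epsilon>. eigen \<mu> e)"
    and orth: "\<And>e f. e \<in> B \<Longrightarrow> f \<in> B \<Longrightarrow> e \<noteq> f \<Longrightarrow> e \<bullet> f = 0"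
  shows "finite B"
proof (rule ccontr)
  assume "infinite B"
  then obtain x :: "nat \<Rightarrow> 'v" where x: "inj x" "range x \<subseteq> B"
    by (meson infinite_countable_subset)
  obtain l r where r: "strict_mono r" "(\<lambda>n. T (x (r n))) \<longlonglongrightarrow> l"
    using compact[of x] B x by (auto simp: image_subset_iff)
  then have "Cauchy (\<lambda>n. T (x (r n)))" using LIMSEQ_imp_Cauchy by blast
  then obtain N where "\<And>m n. m \<ge> N \<Longrightarrow> n \<ge> N \<Longrightarrow> norm (T (x (r m)) - T (x (r n))) < \<epsilon>"
    using \<open>0 < \<epsilon>\<close> unfolding Cauchy_iff by blast
  then have less: "norm (T (x (r N)) - T (x (r (Suc N)))) < \<epsilon>" by simp
  let ?e = "x (r N)" and ?f = "x (r (Suc N))"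
  have "r N \<noteq> r (Suc N)" using r(1) strict_mono_eq by fastforce
  then have "?e \<noteq> ?f" using x(1) by (auto dest: injD)
  moreover have mem: "?e \<in> B" "?f \<in> B" using x(2) by auto
  ultimately have 0: "?e \<bullet> ?f = 0" using orth by blast
  obtain \<mu> \<nu> where mn: "\<mu> \<ge> \<epsilon>" "\<nu> \<ge> \<epsilon>" "T ?e = \<mu> *\<^sub>R ?e" "T ?f = \<nu> *\<^sub>R ?f"
    using B mem unfolding eigen_def by metis
  have "norm (T ?e - T ?f)^2 = \<mu>^2 + \<nu>^2"
    using 0 B[OF mem(1)] B[OF mem(2)] unfolding mn power2_norm_eq_inner
    by (simp add: inner_diff_left inner_diff_right inner_commute power2_eq_square norm_eq_1)
  moreover have "\<mu>^2 \<ge> \<epsilon>^2" using mn \<open>0 < \<epsilon>\<close> by (intro power_mono) auto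
  moreover have "norm (T ?e - T ?f)^2 < \<epsilon>^2" using less by (intro power_strict_mono) auto
  ultimately show False using zero_le_power2[of \<nu>] by linarith
qed

definition spectrum_above :: "real \<Rightarrow> real set" where
  "spectrum_above t = {\<mu>. \<mu> \<ge> t \<and> (\<exists>x. x \<noteq> 0 \<and> eigen \<mu> x)}"

lemma finite_spectrum_above:
  assumes "0 < t"
  shows "finite (spectrum_above t)"
proof -
  have "\<exists>x. norm x = 1 \<and> eigen \<mu> x" if "\<mu> \<in> spectrum_above t" for \<mu>
  proof -
    obtain x where "x \<noteq> 0" "eigen \<mu> x" using \<open>\<mu> \<in> spectrum_above t\<close> spectrum_above_def by auto
    then show ?thesis by (intro exI[of _ "(1 / norm x) *\<^sub>R x"]) (simp add: eigen_def scale)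
  qed
  then obtain e where e: "\<And>\<mu>. \<mu> \<in> spectrum_above t \<Longrightarrow> norm (e \<mu>) = 1 \<and> eigen \<mu> (e \<mu>)" by metis
  have orth: "e \<mu> \<bullet> e \<nu> = 0" if "\<mu> \<in> spectrum_above t" "\<nu> \<in> spectrum_above t" "\<mu> \<noteq> \<nu>" for \<mu> \<nu>
    using e that eigen_orthogonal by blast
  have "finite (e ` spectrum_above t)"
  proof (rule finite_orthonormal_eigenvectors[OF assms])
    show "norm x = 1 \<and> (\<exists>\<mu>\<ge>t. eigen \<mu> x)" if "x \<in> e ` spectrum_above t" for x
      using that e by (auto simp: spectrum_above_def)
  qed (use orth in auto)
  moreover have "inj_on e (spectrum_above t)"
    using orth e by (intro inj_onI) (metis inner_eq_zero_iff norm_zero zero_neq_one)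
  ultimately show ?thesis using finite_imageD by blast
qed

text \<open>A maximal orthonormal set of eigenvectors is finite by compactness. It spans:
  subtracting from an eigenvector its projection leaves an eigenvector orthogonal to
  \<open>B\<close>, which after normalization would enlarge \<open>B\<close>.\<close>

lemma eigenspace_basis:
  assumes "0 < \<mu>"
  obtains B where "finite B" "\<And>e. e \<in> B \<Longrightarrow> norm e = 1 \<and> eigen \<mu> e"
    "\<And>e f. e \<in> B \<Longrightarrow> f \<in> B \<Longrightarrow> e \<noteq> f \<Longrightarrow> e \<bullet> f = 0"
    "\<And>x. eigen \<mu> x \<Longrightarrow> x = (\<Sum>e\<in>B. (x \<bullet> e) *\<^sub>R e)"
proof -
  define \<A> where "\<A> = {B. (\<forall>e\<in>B. norm e = 1 \<and> eigen \<mu> e) \<and> (\<forall>e\<in>B. \<forall>f\<in>B. e \<noteq> f \<longrightarrow> e \<bullet> f = 0)}"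
  have "\<exists>M\<in>\<A>. \<forall>X\<in>\<A>. M \<subseteq> X \<longrightarrow> X = M"
  proof (rule subset_Zorn_nonempty)
    show "\<A> \<noteq> {}" by (auto simp: \<A>_def)
    show "\<Union>\<C> \<in> \<A>" if C: "\<C> \<noteq> {}" "subset.chain \<A> \<C>" for \<C>
    proof -
      have sub: "\<C> \<subseteq> \<A>" using C by (simp add: subset_chain_def)
      have "e \<bullet> f = 0" if h: "X \<in> \<C>" "Y \<in> \<C>" "e \<in> X" "f \<in> Y" "e \<noteq> f" for e f X Y
      proof -
        have "X \<subseteq> Y \<or> Y \<subseteq> X" using C h by (auto simp: subset_chain_def)
        then obtain Z where "Z \<in> \<C>" "e \<in> Z" "f \<in> Z" using h by blast
        then show ?thesis using h(5) sub unfolding \<A>_def by blast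
      qed
      then show ?thesis using sub by (auto simp: \<A>_def)
    qed
  qed
  then obtain B where B: "B \<in> \<A>" "\<And>X. X \<in> \<A> \<Longrightarrow> B \<subseteq> X \<Longrightarrow> X = B" by metis
  have nB: "norm e = 1 \<and> eigen \<mu> e" if "e \<in> B" for e using B that by (auto simp: \<A>_def)
  have oB: "e \<bullet> f = 0" if "e \<in> B" "f \<in> B" "e \<noteq> f" for e f using B that by (auto simp: \<A>_def)
  have fin: "finite B"
    by (rule finite_orthonormal_eigenvectors[OF assms]) (use nB oB in auto)
  have "x = (\<Sum>e\<in>B. (x \<bullet> e) *\<^sub>R e)" if x: "eigen \<mu> x" for x
  proof (rule ccontr)
    define y where "y = x - (\<Sum>e\<in>B. (x \<bullet> e) *\<^sub>R e)"
    assume "x \<noteq> (\<Sum>e\<in>B. (x \<bullet> e) *\<^sub>R e)"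
    then have y0: "y \<noteq> 0" by (simp add: y_def)
    have "T (\<Sum>e\<in>B. (x \<bullet> e) *\<^sub>R e) = \<mu> *\<^sub>R (\<Sum>e\<in>B. (x \<bullet> e) *\<^sub>R e)"
      unfolding linear_sum[OF bounded_linear.linear[OF bounded_linear]] scaleR_sum_right
      by (intro sum.cong) (use nB in \<open>auto simp: scale eigen_def\<close>)
    then have ey: "eigen \<mu> y" using x by (simp add: y_def eigen_def diff scaleR_diff_right)
    have yB: "y \<bullet> e = 0" if "e \<in> B" for e
    proof -
      have "(\<Sum>f\<in>B. (x \<bullet> f) *\<^sub>R f) \<bullet> e = (\<Sum>f\<in>B. if f = e then x \<bullet> e else 0)"
        unfolding inner_sum_left using oB[OF _ that] nB[OF that]
        by (intro sum.cong) (auto simp: norm_eq_1)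
      then show ?thesis using fin that by (simp add: y_def inner_diff_left)
    qed
    define z where "z = (1 / norm y) *\<^sub>R y"
    have "insert z B \<in> \<A>"
      using nB oB yB ey y0
      by (auto simp: \<A>_def z_def eigen_def scale inner_commute)
    then have "z \<in> B" using B(2) by blast
    then have "y \<bullet> z = 0" using yB by blast
    then show False using y0 by (simp add: z_def)
  qed
  then show ?thesis using that fin nB oB by blast
qed

end

text \<open>\<open>N t\<close> counts, with multiplicities \<open>m\<close>, the points that are at least \<open>t\<close>; the \<open>k\<close>-th value
  of the enumeration is the largest \<open>t\<close> with \<open>N t \<ge> k + 1\<close>.\<close>

lemma descending_enumeration_exists:
  fixes m :: "real \<Rightarrow> nat"
  assumes fin: "\<And>t. 0 < t \<Longrightarrow> finite {\<mu>. t \<le> \<mu> \<and> m \<mu> \<noteq> 0}"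
  shows "\<exists>lam :: nat \<Rightarrow> real. decseq lam \<and> (\<forall>k. 0 \<le> lam k) \<and>
    (\<forall>\<mu>>0. finite {k. lam k = \<mu>} \<and> card {k. lam k = \<mu>} = m \<mu>)"
proof -
  define S where "S t = {\<mu>. t \<le> \<mu> \<and> m \<mu> \<noteq> 0}" for t
  define N where "N t = sum m (S t)" for t
  have finS: "finite (S t)" if "0 < t" for t using fin[OF that] by (simp add: S_def)
  have S_mono: "S t \<subseteq> S s" if "s \<le> t" for s t using that by (auto simp: S_def)
  have N_mono: "N t \<le> N s" if "s \<le> t" "0 < s" for s t
    unfolding N_def using S_mono finS that by (intro sum_mono2) auto
  \<comment> \<open>The inserted 0 keeps the set nonempty and is the value of the sequence once the
    positive eigenvalues are exhausted.\<close>
  define A where "A k = insert 0 {t. 0 < t \<and> Suc k \<le> N t}" for k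
  define lam where "lam k = Sup (A k)" for k
  have "\<exists>C. \<forall>t>C. S t = {}"
  proof (intro exI allI impI)
    fix t assume t: "Max (insert 1 (S 1)) < t"
    then have "1 < t" "\<forall>x\<in>S 1. x < t" using finS[of 1] by auto
    moreover have "S t \<subseteq> S 1" using \<open>1 < t\<close> by (intro S_mono) simp
    ultimately show "S t = {}" by (force simp: S_def)
  qed
  then obtain C where "\<forall>t>C. S t = {}" by blast
  then have C: "N t = 0" if "t > C" for t using that by (simp add: N_def)
  have bdd: "bdd_above (A k)" for k
  proof (rule bdd_aboveI)
    show "x \<le> max C 0" if "x \<in> A k" for x
      using that C[of x] by (cases "C < x") (auto simp: A_def)
  qed
  have ge: "t \<le> lam k \<longleftrightarrow> Suc k \<le> N t" if t: "0 < t" for t k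
  proof
    assume "Suc k \<le> N t"
    then have "t \<in> A k" using t by (simp add: A_def)
    then show "t \<le> lam k" unfolding lam_def using bdd by (rule cSup_upper)
  next
    assume le: "t \<le> lam k"
    \<comment> \<open>Only finitely many points lie above t / 2, so none lies in a short interval
      just below \<open>t\<close>. Hence \<open>N\<close> is continuous from the left and the
      supremum defining \<open>lam k\<close> is attained.\<close>
    have "\<exists>s. 0 < s \<and> s < t \<and> S s = S t"
    proof -
      define s where "s = (Max (insert (t/2) (S (t/2) - S t)) + t) / 2"
      have fin': "finite (insert (t/2) (S (t/2) - S t))" using finS[of "t/2"] t by simp
      have "Max (insert (t/2) (S (t/2) - S t)) < t"
        using fin' t by (subst Max_less_iff) (auto simp: S_def)
      moreover have "t/2 \<le> Max (insert (t/2) (S (t/2) - S t))" using fin' by (intro Max_ge) auto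
      ultimately have s: "t/2 < s" "s < t" "Max (insert (t/2) (S (t/2) - S t)) < s"
        using t by (auto simp: s_def)
      have "x \<in> S t" if "x \<in> S s" for x
      proof (rule ccontr)
        assume "x \<notin> S t"
        then have "x \<in> S (t/2) - S t" using that s by (auto simp: S_def)
        then have "x \<le> Max (insert (t/2) (S (t/2) - S t))" using fin' by (intro Max_ge) auto
        then show False using that s by (auto simp: S_def)
      qed
      then have "S s = S t" using S_mono[of s t] s by auto
      then show ?thesis using s t by (intro exI[of _ s]) auto
    qed
    then obtain s where s: "0 < s" "s < t" "S s = S t" by blast
    then have "s < Sup (A k)" using le by (simp add: lam_def)
    then obtain u where "u \<in> A k" "s < u" using less_cSup_iff[OF _ bdd, of k s] by (auto simp: A_def)
    then have "Suc k \<le> N u" using s by (auto simp: A_def)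
    also have "\<dots> \<le> N s" using N_mono[of s u] s \<open>s < u\<close> by simp
    finally show "Suc k \<le> N t" using s by (simp add: N_def)
  qed
  have nonneg: "0 \<le> lam k" for k
    unfolding lam_def using bdd by (intro cSup_upper) (auto simp: A_def)
  have "decseq lam"
    unfolding decseq_def lam_def
    by (intro allI impI cSup_subset_mono bdd) (auto simp: A_def)
  moreover have "finite {k. lam k = \<mu>} \<and> card {k. lam k = \<mu>} = m \<mu>" if \<mu>: "0 < \<mu>" for \<mu>
  proof -
    \<comment> \<open>By finiteness again, a threshold slightly above \<mu> loses the point \<mu>
      and nothing else.\<close>
    have "\<exists>t>\<mu>. S t = S \<mu> - {\<mu>}"
    proof -
      have f: "finite (insert (\<mu>+1) (S \<mu> - {\<mu>}))" using finS[OF \<mu>] by simp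
      have "\<mu> < Min (insert (\<mu>+1) (S \<mu> - {\<mu>}))"
        using f by (subst Min_gr_iff) (auto simp: S_def)
      moreover have "Min (insert (\<mu>+1) (S \<mu> - {\<mu>})) \<le> x" if "x \<in> S \<mu> - {\<mu>}" for x
        using f that by (intro Min_le) auto
      ultimately show ?thesis
        by (intro exI[of _ "Min (insert (\<mu>+1) (S \<mu> - {\<mu>}))"]) (auto simp: S_def)
    qed
    then obtain t where t: "t > \<mu>" "S t = S \<mu> - {\<mu>}" by blast
    have S_betw: "S s = S t" if "\<mu> < s" "s \<le> t" for s
      using S_mono[of s t] t that by (auto simp: S_def)
    have gt: "\<mu> < lam k \<longleftrightarrow> t \<le> lam k" for k
    proof
      assume "\<mu> < lam k"
      show "t \<le> lam k"
      proof (rule ccontr)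
        assume "\<not> t \<le> lam k"
        then have "N (lam k) = N t" using S_betw[of "lam k"] \<open>\<mu> < lam k\<close> by (simp add: N_def)
        then show False using ge[of "lam k" k] ge[of t k] \<mu> t \<open>\<mu> < lam k\<close> \<open>\<not> t \<le> lam k\<close> by simp
      qed
    qed (use t in simp)
    \<comment> \<open>The value \<mu> is taken at the indices from \<open>N t\<close> to
      \<open>N \<mu> - 1\<close>, which are \<open>m \<mu>\<close> many.\<close>
    have eq: "{k. lam k = \<mu>} = {..<N \<mu>} - {..<N t}"
    proof -
      have "lam k = \<mu> \<longleftrightarrow> \<mu> \<le> lam k \<and> \<not> \<mu> < lam k" for k by auto
      then show ?thesis using gt ge[OF \<mu>] ge[of t] \<mu> t by auto
    qed
    have N: "N \<mu> = N t + m \<mu>"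
    proof (cases "m \<mu> = 0")
      case True
      then have "S \<mu> - {\<mu>} = S \<mu>" by (auto simp: S_def)
      then show ?thesis using True t by (simp add: N_def)
    next
      case False
      then have "\<mu> \<in> S \<mu>" by (simp add: S_def)
      then show ?thesis using sum.remove[OF finS[OF \<mu>], of \<mu> m] t by (simp add: N_def)
    qed
    show ?thesis unfolding eq using N by (simp add: card_Diff_subset)
  qed
  ultimately show ?thesis using nonneg by blast
qed

section \<open>The space of square integrable functions\<close>

text \<open>Borel functions rather than Lebesgue measurable ones, so that Fubini's theorem applies
  on products of \<open>lborel\<close>.\<close>

definition sq_int :: "('a::euclidean_space \<Rightarrow> real) \<Rightarrow> bool" where
  "sq_int f \<longleftrightarrow> f \<in> borel_measurable borel \<and> integrable lborel (\<lambda>x. (f x)\<^sup>2)"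

lemma sq_int_measurable [measurable_dest]: "sq_int f \<Longrightarrow> f \<in> borel_measurable borel"
  by (simp add: sq_int_def)

lemma sq_int_mult_integrable:
  assumes "sq_int f" "sq_int g"
  shows "integrable lborel (\<lambda>x. f x * g x)"
proof (rule Bochner_Integration.integrable_bound)
  show "integrable lborel (\<lambda>x. (f x)\<^sup>2 + (g x)\<^sup>2)" using assms by (simp add: sq_int_def)
  show "(\<lambda>x. f x * g x) \<in> borel_measurable lborel" using assms by measurable
  have "\<bar>f x * g x\<bar> \<le> (f x)\<^sup>2 + (g x)\<^sup>2" for x
  proof -
    have "2 * \<bar>f x\<bar> * \<bar>g x\<bar> \<le> \<bar>f x\<bar>\<^sup>2 + \<bar>g x\<bar>\<^sup>2" by (rule sum_squares_bound)
    then show ?thesis using abs_ge_zero[of "f x * g x"] unfolding abs_mult power2_abs by linarith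
  qed
  then show "AE x in lborel. norm (f x * g x) \<le> norm ((f x)\<^sup>2 + (g x)\<^sup>2)"
    by simp
qed

lemma sq_int_scale: "sq_int f \<Longrightarrow> sq_int (\<lambda>x. c * f x)"
  unfolding sq_int_def by (auto simp: power_mult_distrib)

lemma sq_int_zero: "sq_int (\<lambda>x. 0)"
  by (simp add: sq_int_def)

lemma sq_int_add:
  assumes "sq_int f" "sq_int g"
  shows "sq_int (\<lambda>x. f x + g x)"
proof -
  have "integrable lborel (\<lambda>x. (f x)\<^sup>2 + (g x)\<^sup>2 + 2 * (f x * g x))"
    using assms sq_int_mult_integrable[OF assms] by (simp add: sq_int_def)
  moreover have "(\<lambda>x. f x + g x) \<in> borel_measurable borel" using assms by measurable
  ultimately show ?thesis by (simp add: sq_int_def power2_sum mult.assoc)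
qed

lemma sq_int_minus: "sq_int f \<Longrightarrow> sq_int (\<lambda>x. - f x)"
  using sq_int_scale[of f "-1"] by simp

lemma sq_int_diff: "sq_int f \<Longrightarrow> sq_int g \<Longrightarrow> sq_int (\<lambda>x. f x - g x)"
  using sq_int_add[OF _ sq_int_minus, of f g] by simp

text \<open>Reflexive exactly on the square integrable functions; the partial quotient therefore
  selects these functions and identifies almost equal ones in one go.\<close>

definition Lsq_rel :: "('a::euclidean_space \<Rightarrow> real) \<Rightarrow> ('a \<Rightarrow> real) \<Rightarrow> bool" where
  "Lsq_rel f g \<longleftrightarrow> sq_int f \<and> sq_int g \<and> (AE x in lborel. f x = g x)"

quotient_type (overloaded) 'a Lsq = "'a::euclidean_space \<Rightarrow> real" / partial: Lsq_rel
proof (rule part_equivpI)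
  show "\<exists>x. Lsq_rel x x" by (auto simp: Lsq_rel_def intro: sq_int_zero)
  show "symp Lsq_rel" by (auto simp: symp_def Lsq_rel_def)
  show "transp Lsq_rel" by (auto simp: transp_def Lsq_rel_def)
qed

instantiation Lsq :: (euclidean_space) real_inner
begin

lift_definition zero_Lsq :: "'a Lsq" is "\<lambda>x. 0"
  by (simp add: Lsq_rel_def sq_int_zero)

lift_definition plus_Lsq :: "'a Lsq \<Rightarrow> 'a Lsq \<Rightarrow> 'a Lsq" is "\<lambda>f g x. f x + g x"
  unfolding Lsq_rel_def by (auto intro: sq_int_add)

lift_definition uminus_Lsq :: "'a Lsq \<Rightarrow> 'a Lsq" is "\<lambda>f x. - f x"
  unfolding Lsq_rel_def by (auto intro: sq_int_minus)

lift_definition minus_Lsq :: "'a Lsq \<Rightarrow> 'a Lsq \<Rightarrow> 'a Lsq" is "\<lambda>f g x. f x - g x"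
  unfolding Lsq_rel_def by (auto intro: sq_int_diff)

lift_definition scaleR_Lsq :: "real \<Rightarrow> 'a Lsq \<Rightarrow> 'a Lsq" is "\<lambda>c f x. c * f x"
  unfolding Lsq_rel_def by (auto intro: sq_int_scale)

lift_definition inner_Lsq :: "'a Lsq \<Rightarrow> 'a Lsq \<Rightarrow> real" is "\<lambda>f g. LINT x|lborel. f x * g x"
  unfolding Lsq_rel_def by (intro integral_cong_AE) auto

definition norm_Lsq :: "'a Lsq \<Rightarrow> real" where
  "norm_Lsq x = sqrt (x \<bullet> x)"

definition sgn_Lsq :: "'a Lsq \<Rightarrow> 'a Lsq" where
  "sgn_Lsq x = inverse (norm x) *\<^sub>R x"

definition dist_Lsq :: "'a Lsq \<Rightarrow> 'a Lsq \<Rightarrow> real" where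
  "dist_Lsq x y = norm (x - y)"

definition uniformity_Lsq :: "('a Lsq \<times> 'a Lsq) filter" where
  "uniformity_Lsq = (INF e\<in>{0<..}. principal {(x, y). dist x y < e})"

definition open_Lsq :: "'a Lsq set \<Rightarrow> bool" where
  "open_Lsq U = (\<forall>x\<in>U. \<forall>\<^sub>F (x', y) in uniformity. x' = x \<longrightarrow> y \<in> U)"

instance
proof
  fix x y z :: "'a Lsq" and a b :: real
  show "x + y + z = x + (y + z)" "x + y = y + x" "0 + x = x" "- x + x = 0" "x - y = x + - y"
    by (transfer; auto simp: Lsq_rel_def ac_simps intro!: sq_int_add sq_int_zero sq_int_minus sq_int_diff)+
  show "a *\<^sub>R (x + y) = a *\<^sub>R x + a *\<^sub>R y" "(a + b) *\<^sub>R x = a *\<^sub>R x + b *\<^sub>R x" "a *\<^sub>R b *\<^sub>R x = (a * b) *\<^sub>R x" "1 *\<^sub>R x = x"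
    by (transfer; auto simp: Lsq_rel_def algebra_simps intro!: sq_int_add sq_int_scale)+
  show "dist x y = norm (x - y)" by (simp add: dist_Lsq_def)
  show "sgn x = inverse (norm x) *\<^sub>R x" by (simp add: sgn_Lsq_def)
  show "uniformity = (INF e\<in>{0<..}. principal {(x, y::'a Lsq). dist x y < e})"
    by (simp add: uniformity_Lsq_def)
  show "open U = (\<forall>x\<in>U. \<forall>\<^sub>F (x', y) in uniformity. x' = x \<longrightarrow> y \<in> U)" for U :: "'a Lsq set"
    by (simp add: open_Lsq_def)
  show "x \<bullet> y = y \<bullet> x" by transfer (simp add: mult.commute)
  show "(x + y) \<bullet> z = x \<bullet> z + y \<bullet> z"
    by transfer (simp add: Lsq_rel_def sq_int_mult_integrable distrib_right)
  show "a *\<^sub>R x \<bullet> y = a * (x \<bullet> y)"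
    by transfer (simp add: mult.assoc)
  show "0 \<le> x \<bullet> x" by transfer simp
  show "x \<bullet> x = 0 \<longleftrightarrow> x = 0"
  proof transfer
    fix f :: "'a \<Rightarrow> real" assume "Lsq_rel f f"
    then have f: "sq_int f" by (simp add: Lsq_rel_def)
    have "(LINT x|lborel. f x * f x) = 0 \<longleftrightarrow> (AE x in lborel. f x * f x = 0)"
      by (rule integral_nonneg_eq_0_iff_AE) (auto intro: sq_int_mult_integrable f)
    then show "(LINT x|lborel. f x * f x) = 0 \<longleftrightarrow> Lsq_rel f (\<lambda>x. 0)"
      using f by (simp add: Lsq_rel_def sq_int_zero)
  qed
  show "norm x = sqrt (x \<bullet> x)" by (simp add: norm_Lsq_def)
qed

end

lemma rep_sq_int: "sq_int (rep_Lsq x)"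
  using Quotient_rel_rep[OF Quotient_Lsq] Quotient_rep_reflp[OF Quotient_Lsq] unfolding Lsq_rel_def by blast

lemma rep_abs_AE: "sq_int f \<Longrightarrow> AE x in lborel. rep_Lsq (abs_Lsq f) x = f x"
  using Quotient_rep_abs[OF Quotient_Lsq, of f] unfolding Lsq_rel_def by blast

lemma abs_rep [simp]: "abs_Lsq (rep_Lsq x) = x"
  by (rule Quotient_abs_rep[OF Quotient_Lsq])

lemma abs_eq_iff: "sq_int f \<Longrightarrow> sq_int g \<Longrightarrow> abs_Lsq f = abs_Lsq g \<longleftrightarrow> (AE x in lborel. f x = g x)"
  using Quotient_rel[OF Quotient_Lsq, of f g] unfolding Lsq_rel_def by auto

lemma abs_add: "sq_int f \<Longrightarrow> sq_int g \<Longrightarrow> abs_Lsq f + abs_Lsq g = abs_Lsq (\<lambda>x. f x + g x)"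
  by (rule plus_Lsq.abs_eq) (auto simp: Lsq_rel_def)

lemma abs_diff: "sq_int f \<Longrightarrow> sq_int g \<Longrightarrow> abs_Lsq f - abs_Lsq g = abs_Lsq (\<lambda>x. f x - g x)"
  by (rule minus_Lsq.abs_eq) (auto simp: Lsq_rel_def)

lemma abs_scale: "sq_int f \<Longrightarrow> c *\<^sub>R abs_Lsq f = abs_Lsq (\<lambda>x. c * f x)"
  by (rule scaleR_Lsq.abs_eq) (auto simp: Lsq_rel_def)

lemma abs_inner: "sq_int f \<Longrightarrow> sq_int g \<Longrightarrow> abs_Lsq f \<bullet> abs_Lsq g = (LINT x|lborel. f x * g x)"
  by (rule inner_Lsq.abs_eq) (auto simp: Lsq_rel_def)

lemma norm_abs: "sq_int f \<Longrightarrow> (norm (abs_Lsq f))\<^sup>2 = (LINT x|lborel. (f x)\<^sup>2)"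
  unfolding power2_norm_eq_inner by (simp add: abs_inner power2_eq_square)

lemma abs_Lsq_sum:
  "(\<And>i. i \<in> I \<Longrightarrow> sq_int (f i)) \<Longrightarrow>
    sq_int (\<lambda>x. \<Sum>i\<in>I. f i x) \<and> (\<Sum>i\<in>I. abs_Lsq (f i)) = abs_Lsq (\<lambda>x. \<Sum>i\<in>I. f i x)"
proof (induction I rule: infinite_finite_induct)
  case (insert i I)
  then show ?case by (simp add: sq_int_add abs_add)
qed (auto simp: sq_int_zero zero_Lsq.abs_eq)

lemma nn_norm_abs: "sq_int f \<Longrightarrow> (\<integral>\<^sup>+x. ennreal ((f x)\<^sup>2) \<partial>lborel) = ennreal ((norm (abs_Lsq f))\<^sup>2)"
  by (simp add: norm_abs nn_integral_eq_integral sq_int_def)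

lemma sq_int_iff_nn:
  "sq_int f \<longleftrightarrow> f \<in> borel_measurable borel \<and> (\<integral>\<^sup>+x. ennreal ((f x)\<^sup>2) \<partial>lborel) < \<infinity>"
  by (auto simp: sq_int_def integrable_iff_bounded)

lemma nn_norm_le: 
  assumes "f \<in> borel_measurable borel" "(\<integral>\<^sup>+x. ennreal ((f x)\<^sup>2) \<partial>lborel) \<le> ennreal (c\<^sup>2)" "0 \<le> c"
  shows "sq_int f" "norm (abs_Lsq f) \<le> c"
proof -
  show f: "sq_int f" using assms le_less_trans[OF assms(2)] by (auto simp: sq_int_iff_nn)
  have "ennreal ((norm (abs_Lsq f))\<^sup>2) \<le> ennreal (c\<^sup>2)" using assms nn_norm_abs[OF f] by simp
  then show "norm (abs_Lsq f) \<le> c" using assms(3) by (simp add: power2_le_iff_abs_le)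
qed

section \<open>Completeness of L2 (Riesz-Fischer)\<close>

lemma subseq_fast_Cauchy:
  fixes X :: "nat \<Rightarrow> 'v::metric_space"
  assumes "Cauchy X"
  obtains r where "strict_mono r" "\<And>n. dist (X (r n)) (X (r (Suc n))) < (1/2)^n"
proof -
  have "\<exists>N. \<forall>m\<ge>N. \<forall>k\<ge>N. dist (X m) (X k) < (1/2)^n" for n
    using assms unfolding Cauchy_def by (meson half_gt_zero_iff zero_less_one zero_less_power)
  then obtain N where N: "\<And>n m k. m \<ge> N n \<Longrightarrow> k \<ge> N n \<Longrightarrow> dist (X m) (X k) < (1/2)^n" by metis
  define r where "r = rec_nat (N 0) (\<lambda>n p. max (Suc p) (N (Suc n)))"
  have r: "r 0 = N 0" "r (Suc n) = max (Suc (r n)) (N (Suc n))" for n by (simp_all add: r_def)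
  have "strict_mono r" unfolding strict_mono_Suc_iff by (simp add: r less_max_iff_disj)
  moreover have "r n \<ge> N n" for n by (cases n) (simp_all add: r)
  then have "dist (X (r n)) (X (r (Suc n))) < (1/2)^n" for n
    by (intro N) (simp_all add: r le_max_iff_disj le_SucI)
  ultimately show ?thesis using that by blast
qed

text \<open>The squared increments still have a finite integral after multiplication by 2^n and
  summation. Where that sum is a finite number C, the n-th increment is at most sqrt C * (1 / sqrt
  2)^n, and the increments are summable.\<close>

lemma AE_convergent_of_fast_Cauchy:
  fixes f :: "nat \<Rightarrow> 'a::euclidean_space \<Rightarrow> real"
  assumes [measurable]: "\<And>n. f n \<in> borel_measurable borel"
    and f: "\<And>n. (\<integral>\<^sup>+x. ennreal ((f n x - f (Suc n) x)\<^sup>2) \<partial>lborel) \<le> ennreal ((1/4)^n)"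
  shows "AE x in lborel. convergent (\<lambda>n. f n x)"
proof -
  have "(\<integral>\<^sup>+x. (\<Sum>n. ennreal (2^n * (f n x - f (Suc n) x)\<^sup>2)) \<partial>lborel)
      = (\<Sum>n. \<integral>\<^sup>+x. ennreal (2^n * (f n x - f (Suc n) x)\<^sup>2) \<partial>lborel)"
    by (rule nn_integral_suminf) measurable
  also have "\<dots> \<le> (\<Sum>n. ennreal ((1/2)^n))"
  proof (intro suminf_le)
    fix n
    have "(\<integral>\<^sup>+x. ennreal (2^n * (f n x - f (Suc n) x)\<^sup>2) \<partial>lborel)
       = ennreal (2^n) * (\<integral>\<^sup>+x. ennreal ((f n x - f (Suc n) x)\<^sup>2) \<partial>lborel)"
      by (subst nn_integral_cmult[symmetric]) (auto simp: ennreal_mult)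
    also have "\<dots> \<le> ennreal (2^n) * ennreal ((1/4)^n)" by (intro mult_left_mono f) simp
    also have "\<dots> = ennreal ((1/2)^n)"
      by (subst ennreal_mult[symmetric]) (auto simp: power_mult_distrib[symmetric])
    finally show "(\<integral>\<^sup>+x. ennreal (2^n * (f n x - f (Suc n) x)\<^sup>2) \<partial>lborel) \<le> ennreal ((1/2)^n)" .
  qed auto
  also have "\<dots> = ennreal (\<Sum>n. (1/2)^n)" by (rule suminf_ennreal2) auto
  finally have "(\<integral>\<^sup>+x. (\<Sum>n. ennreal (2^n * (f n x - f (Suc n) x)\<^sup>2)) \<partial>lborel) \<noteq> \<infinity>"
    by (auto simp: top_unique)
  moreover have "(\<lambda>x. \<Sum>n. ennreal (2^n * (f n x - f (Suc n) x)\<^sup>2)) \<in> borel_measurable lborel"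
    by measurable
  ultimately have "AE x in lborel. (\<Sum>n. ennreal (2^n * (f n x - f (Suc n) x)\<^sup>2)) \<noteq> \<infinity>"
    using nn_integral_PInf_AE by blast
  then show ?thesis
  proof eventually_elim
    case (elim x)
    define C where "C = enn2real (\<Sum>n. ennreal (2^n * (f n x - f (Suc n) x)\<^sup>2))"
    have C: "2^n * (f n x - f (Suc n) x)\<^sup>2 \<le> C" for n
    proof -
      have "ennreal (2^n * (f n x - f (Suc n) x)\<^sup>2) \<le> (\<Sum>n. ennreal (2^n * (f n x - f (Suc n) x)\<^sup>2))"
        by (rule order_trans[OF _ sum_le_suminf[where I = "{n}"]]) simp_all
      also have "\<dots> = ennreal C" using elim by (simp add: C_def less_top)
      finally show ?thesis by (simp add: C_def)
    qed
    have "norm (f (Suc n) x - f n x) \<le> sqrt C * (sqrt (1/2))^n" for n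
    proof -
      have "(f (Suc n) x - f n x)\<^sup>2 \<le> C * (1/2)^n"
        using C[of n] by (simp add: power_one_over field_simps power2_commute)
      then have "\<bar>f (Suc n) x - f n x\<bar> \<le> sqrt (C * (1/2)^n)"
        using real_le_rsqrt[of "\<bar>f (Suc n) x - f n x\<bar>"] by simp
      then show ?thesis by (simp add: real_sqrt_mult real_sqrt_power)
    qed
    note bound = this
    have "norm (sqrt (1/2)) < 1" unfolding real_norm_def by (simp add: real_sqrt_divide)
    then have "summable (\<lambda>n. sqrt C * (sqrt (1/2))^n)"
      by (rule summable_mult[OF summable_geometric])
    then have "summable (\<lambda>n. f (Suc n) x - f n x)"
      using bound by (rule summable_comparison_test'[where N = 0])
    then have "convergent (\<lambda>n. \<Sum>i<n. f (Suc i) x - f i x)" by (simp add: summable_iff_convergent)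
    from convergent_add[OF this convergent_const, of "f 0 x"]
    show "convergent (\<lambda>n. f n x)" using sum_lessThan_telescope[of "\<lambda>i. f i x"] by simp
  qed
qed

text \<open>Completeness is what makes closed totally bounded sets compact in
  \<open>compact_operator_of_approximation\<close>.\<close>

instance Lsq :: (euclidean_space) complete_space
proof
  fix X :: "nat \<Rightarrow> 'a Lsq" assume X: "Cauchy X"
  obtain r where r: "strict_mono r" "\<And>n. dist (X (r n)) (X (r (Suc n))) < (1/2)^n"
    using subseq_fast_Cauchy[OF X] by blast
  define f where "f n = rep_Lsq (X (r n))" for n
  have sf: "sq_int (f n)" for n by (simp add: f_def rep_sq_int)
  have [measurable]: "f n \<in> borel_measurable borel" for n using sf by measurable
  have absf: "abs_Lsq (f n) = X (r n)" for n by (simp add: f_def)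
  have nnd: "(\<integral>\<^sup>+x. ennreal ((f m x - f n x)\<^sup>2) \<partial>lborel) = ennreal ((dist (X (r m)) (X (r n)))\<^sup>2)" for m n
    using nn_norm_abs[OF sq_int_diff[OF sf sf], of m n] by (simp add: abs_diff[symmetric] sf absf dist_norm)
  have "AE x in lborel. convergent (\<lambda>n. f n x)"
  proof (rule AE_convergent_of_fast_Cauchy)
    fix n
    have "(dist (X (r n)) (X (r (Suc n))))\<^sup>2 \<le> ((1/2)^n)\<^sup>2" using r(2)[of n] by (intro power_mono) auto
    also have "\<dots> = (1/4)^n" by (simp add: power2_eq_square power_mult_distrib[symmetric])
    finally show "(\<integral>\<^sup>+x. ennreal ((f n x - f (Suc n) x)\<^sup>2) \<partial>lborel) \<le> ennreal ((1/4)^n)"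
      by (simp add: nnd)
  qed measurable
  define g where "g x = lim (\<lambda>n. f n x)" for x
  have [measurable]: "g \<in> borel_measurable borel" unfolding g_def by measurable
  have conv: "AE x in lborel. (\<lambda>n. f n x) \<longlonglongrightarrow> g x"
    using \<open>AE x in lborel. convergent (\<lambda>n. f n x)\<close>
    by eventually_elim (simp add: g_def convergent_LIMSEQ_iff)
  \<comment> \<open>Fatou's lemma in \<open>m\<close> with \<open>n\<close> fixed turns the Cauchy
    estimate into a bound for the distance from the pointwise limit.\<close>
  have fatou: "(\<integral>\<^sup>+x. ennreal ((g x - f n x)\<^sup>2) \<partial>lborel) \<le> ennreal (\<epsilon>\<^sup>2)"
    if "\<And>m. m \<ge> n \<Longrightarrow> dist (X (r m)) (X (r n)) \<le> \<epsilon>" "0 < \<epsilon>" for n \<epsilon>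
  proof -
    have "(\<integral>\<^sup>+x. ennreal ((g x - f n x)\<^sup>2) \<partial>lborel)
        = (\<integral>\<^sup>+x. liminf (\<lambda>m. ennreal ((f m x - f n x)\<^sup>2)) \<partial>lborel)"
    proof (rule nn_integral_cong_AE)
      show "AE x in lborel. ennreal ((g x - f n x)\<^sup>2) = liminf (\<lambda>m. ennreal ((f m x - f n x)\<^sup>2))"
        using conv
      proof eventually_elim
        case (elim x)
        then have "(\<lambda>m. ennreal ((f m x - f n x)\<^sup>2)) \<longlonglongrightarrow> ennreal ((g x - f n x)\<^sup>2)"
          by (intro tendsto_intros)
        then show ?case by (rule lim_imp_Liminf[symmetric, rotated]) simp
      qed
    qed
    also have "\<dots> \<le> liminf (\<lambda>m. \<integral>\<^sup>+x. ennreal ((f m x - f n x)\<^sup>2) \<partial>lborel)"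
      by (rule nn_integral_liminf) measurable
    also have "\<dots> \<le> liminf (\<lambda>m. ennreal (\<epsilon>\<^sup>2))"
    proof (rule Liminf_mono)
      show "\<forall>\<^sub>F m in sequentially. (\<integral>\<^sup>+x. ennreal ((f m x - f n x)\<^sup>2) \<partial>lborel) \<le> ennreal (\<epsilon>\<^sup>2)"
        using eventually_ge_at_top[of n]
      proof eventually_elim
        case (elim m)
        have "(dist (X (r m)) (X (r n)))\<^sup>2 \<le> \<epsilon>\<^sup>2" using that elim by (intro power_mono) auto
        then show ?case unfolding nnd by (rule ennreal_leI)
      qed
    qed
    also have "\<dots> = ennreal (\<epsilon>\<^sup>2)" by (simp add: Liminf_const)
    finally show ?thesis .
  qed
  have ex: "\<exists>N. \<forall>n\<ge>N. sq_int (\<lambda>x. g x - f n x) \<and> norm (abs_Lsq (\<lambda>x. g x - f n x)) \<le> \<epsilon>"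
    if "0 < \<epsilon>" for \<epsilon>
  proof -
    have "Cauchy (X \<circ> r)" using Cauchy_subseq_Cauchy[OF X r(1)] .
    then obtain N where N: "\<And>m n. m \<ge> N \<Longrightarrow> n \<ge> N \<Longrightarrow> dist (X (r m)) (X (r n)) < \<epsilon>"
      using \<open>0 < \<epsilon>\<close> unfolding Cauchy_def o_def by metis
    show ?thesis
    proof (intro exI[of _ N] allI impI)
      fix n assume "N \<le> n"
      then have "(\<integral>\<^sup>+x. ennreal ((g x - f n x)\<^sup>2) \<partial>lborel) \<le> ennreal (\<epsilon>\<^sup>2)"
        by (intro fatou that less_imp_le[OF N]) auto
      then show "sq_int (\<lambda>x. g x - f n x) \<and> norm (abs_Lsq (\<lambda>x. g x - f n x)) \<le> \<epsilon>"
        using that by (intro conjI nn_norm_le) auto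
    qed
  qed
  obtain N where "sq_int (\<lambda>x. g x - f N x)" using ex[of 1] by auto
  from sq_int_add[OF this sf[of N]] have sg: "sq_int g" by simp
  have "(X \<circ> r) \<longlonglongrightarrow> abs_Lsq g"
  proof (rule metric_LIMSEQ_I)
    fix \<epsilon> :: real assume \<epsilon>: "0 < \<epsilon>"
    obtain N where N: "\<And>n. n \<ge> N \<Longrightarrow> norm (abs_Lsq (\<lambda>x. g x - f n x)) \<le> \<epsilon>/2"
      using ex[of "\<epsilon>/2"] \<epsilon> by auto
    have "dist ((X \<circ> r) n) (abs_Lsq g) < \<epsilon>" if "n \<ge> N" for n
    proof -
      have "dist (X (r n)) (abs_Lsq g) = norm (abs_Lsq (\<lambda>x. g x - f n x))"
        by (simp add: dist_norm norm_minus_commute abs_diff[symmetric] sg sf absf)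
      then show ?thesis using N[OF that] \<epsilon> by simp
    qed
    then show "\<exists>no. \<forall>n\<ge>no. dist ((X \<circ> r) n) (abs_Lsq g) < \<epsilon>" by blast
  qed
  then have "X \<longlonglongrightarrow> abs_Lsq g" using Cauchy_converges_subseq[OF X r(1)] by (simp add: o_def)
  then show "convergent X" unfolding convergent_def by blast
qed

section \<open>Schur test and potential operators\<close>

lemma nn_integral_lborel_reflect:
  fixes F :: "'a::euclidean_space \<Rightarrow> ennreal"
  assumes [measurable]: "F \<in> borel_measurable borel"
  shows "(\<integral>\<^sup>+y. F (x - y) \<partial>lborel) = (\<integral>\<^sup>+z. F z \<partial>lborel)"
proof -
  have "(lborel :: 'a measure) = distr lborel borel (\<lambda>y. x + (-1) *\<^sub>R y)"
    using lborel_affine[of "-1" x] by (simp add: density_1 one_ennreal_def[symmetric])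
  then have "(\<integral>\<^sup>+z. F z \<partial>lborel) = (\<integral>\<^sup>+z. F z \<partial>distr lborel borel (\<lambda>y. x + (-1) *\<^sub>R y))" by simp
  also have "\<dots> = (\<integral>\<^sup>+y. F (x - y) \<partial>lborel)" by (subst nn_integral_distr) auto
  finally show ?thesis by simp
qed

lemma nn_integral_lborel_translate:
  fixes F :: "'a::euclidean_space \<Rightarrow> ennreal"
  assumes [measurable]: "F \<in> borel_measurable borel"
  shows "(\<integral>\<^sup>+y. F (y - x) \<partial>lborel) = (\<integral>\<^sup>+z. F z \<partial>lborel)"
proof -
  have "(\<integral>\<^sup>+z. F z \<partial>lborel) = (\<integral>\<^sup>+z. F z \<partial>distr lborel borel ((+) (- x)))"
    by (simp add: lborel_distr_plus)
  also have "\<dots> = (\<integral>\<^sup>+y. F (y - x) \<partial>lborel)" by (subst nn_integral_distr) auto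
  finally show ?thesis by simp
qed

lemma ennreal_square_finite:
  fixes x :: ennreal
  assumes "x\<^sup>2 \<noteq> \<infinity>"
  shows "x < \<infinity>"
  using assms by (cases x) (auto simp: power2_eq_square)

text \<open>Since \<open>q\<close> is even, the bound on rows is a bound on columns as well, and one
  constant serves both sides of Schur's test.\<close>

definition schur_bound :: "('a::euclidean_space \<Rightarrow> real) \<Rightarrow> 'a set \<Rightarrow> real \<Rightarrow> bool" where
  "schur_bound q W C \<longleftrightarrow> q \<in> borel_measurable borel \<and> (\<forall>z. q (- z) = q z) \<and> W \<in> sets borel \<and> 0 \<le> C \<and>
     (\<forall>x. (\<integral>\<^sup>+y. ennreal \<bar>q (x - y)\<bar> * indicator W y \<partial>lborel) \<le> ennreal C)"

lemma schur_boundD: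
  assumes "schur_bound q W C"
  shows "q \<in> borel_measurable borel" "W \<in> sets borel" "0 \<le> C" "q (x - y) = q (y - x)"
    "(\<integral>\<^sup>+y. ennreal \<bar>q (x - y)\<bar> * indicator W y \<partial>lborel) \<le> ennreal C"
  using assms by (auto simp: schur_bound_def) (metis minus_diff_eq)

text \<open>Write \<bar>q\<bar> as the product of two square roots and apply Cauchy-Schwarz: the row
  bound gives one factor \<open>C\<close>. After exchanging the integrations the column bound gives
  the other.\<close>

lemma schur_test:
  fixes F :: "'a::euclidean_space \<Rightarrow> ennreal"
  assumes S: "schur_bound q W C" and [measurable]: "F \<in> borel_measurable borel"
  shows "(\<integral>\<^sup>+x. indicator W x * (\<integral>\<^sup>+y. ennreal \<bar>q (x - y)\<bar> * indicator W y * F y \<partial>lborel)\<^sup>2 \<partial>lborel)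
    \<le> ennreal (C\<^sup>2) * (\<integral>\<^sup>+y. (F y)\<^sup>2 \<partial>lborel)"
proof -
  note [measurable] = schur_boundD(1,2)[OF S]
  have inner: "(\<integral>\<^sup>+y. ennreal \<bar>q (x - y)\<bar> * indicator W y * F y \<partial>lborel)\<^sup>2
      \<le> ennreal C * (\<integral>\<^sup>+y. ennreal \<bar>q (x - y)\<bar> * indicator W y * (F y)\<^sup>2 \<partial>lborel)" for x
  proof -
    define s where "s y = ennreal (sqrt \<bar>q (x - y)\<bar>) * indicator W y" for y
    have [measurable]: "s \<in> borel_measurable borel" unfolding s_def by measurable
    have s2: "(s y)\<^sup>2 = ennreal \<bar>q (x - y)\<bar> * indicator W y" for y
      by (simp add: s_def power_mult_distrib ennreal_power indicator_def)
    have "(\<integral>\<^sup>+y. s y * (s y * F y) \<partial>lborel)\<^sup>2 \<le> (\<integral>\<^sup>+y. (s y)\<^sup>2 \<partial>lborel) * (\<integral>\<^sup>+y. (s y * F y)\<^sup>2 \<partial>lborel)"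
      by (rule Cauchy_Schwarz_nn_integral) measurable
    also have "\<dots> \<le> ennreal C * (\<integral>\<^sup>+y. (s y * F y)\<^sup>2 \<partial>lborel)"
      unfolding s2 by (intro mult_right_mono schur_boundD(5)[OF S]) auto
    finally show ?thesis
      by (simp add: power_mult_distrib s2 mult.assoc[symmetric] power2_eq_square[of "s _", symmetric])
  qed
  have "(\<integral>\<^sup>+x. indicator W x * (\<integral>\<^sup>+y. ennreal \<bar>q (x - y)\<bar> * indicator W y * F y \<partial>lborel)\<^sup>2 \<partial>lborel)
    \<le> (\<integral>\<^sup>+x. indicator W x * (ennreal C * (\<integral>\<^sup>+y. ennreal \<bar>q (x - y)\<bar> * indicator W y * (F y)\<^sup>2 \<partial>lborel)) \<partial>lborel)"
    by (intro nn_integral_mono mult_left_mono inner) auto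
  also have "\<dots> = (\<integral>\<^sup>+x. ennreal C * (\<integral>\<^sup>+y. indicator W x * (ennreal \<bar>q (x - y)\<bar> * indicator W y * (F y)\<^sup>2) \<partial>lborel) \<partial>lborel)"
    by (subst nn_integral_cmult) (auto simp: mult_ac)
  also have "\<dots> = ennreal C * (\<integral>\<^sup>+x. (\<integral>\<^sup>+y. indicator W x * (ennreal \<bar>q (x - y)\<bar> * indicator W y * (F y)\<^sup>2) \<partial>lborel) \<partial>lborel)"
    by (rule nn_integral_cmult) measurable
  also have "(\<integral>\<^sup>+x. (\<integral>\<^sup>+y. indicator W x * (ennreal \<bar>q (x - y)\<bar> * indicator W y * (F y)\<^sup>2) \<partial>lborel) \<partial>lborel)
      = (\<integral>\<^sup>+y. (\<integral>\<^sup>+x. indicator W x * (ennreal \<bar>q (x - y)\<bar> * indicator W y * (F y)\<^sup>2) \<partial>lborel) \<partial>lborel)"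
    by (rule lborel_pair.Fubini') measurable
  also have "\<dots> = (\<integral>\<^sup>+y. (indicator W y * (F y)\<^sup>2) * (\<integral>\<^sup>+x. ennreal \<bar>q (y - x)\<bar> * indicator W x \<partial>lborel) \<partial>lborel)"
    by (subst nn_integral_cmult[symmetric]) (auto simp: mult_ac schur_boundD(4)[OF S] intro!: nn_integral_cong)
  also have "\<dots> \<le> (\<integral>\<^sup>+y. (1 * (F y)\<^sup>2) * ennreal C \<partial>lborel)"
    by (intro nn_integral_mono mult_mono schur_boundD(5)[OF S]) (auto split: split_indicator)
  also have "\<dots> = ennreal C * (\<integral>\<^sup>+y. (F y)\<^sup>2 \<partial>lborel)"
    by (subst nn_integral_cmult[symmetric]) (auto simp: mult_ac)
  finally show ?thesis
    using schur_boundD(3)[OF S] by (simp add: power2_eq_square ennreal_mult mult.assoc mult_left_mono)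
qed

text \<open>The cutoff in both variables extends the operator on L2 of \<open>W\<close> to a
  symmetric operator on L2 of the whole space that only sees \<open>W\<close>.\<close>

definition pot :: "('a::euclidean_space \<Rightarrow> real) \<Rightarrow> 'a set \<Rightarrow> ('a \<Rightarrow> real) \<Rightarrow> 'a \<Rightarrow> real" where
  "pot q W f x = indicator W x * (LINT y|lborel. q (x - y) * (indicator W y * f y))"

text \<open>Schur's test for the absolute values bounds a square integral of the inner integral,
  which is therefore finite at almost every point of \<open>W\<close>.\<close>

lemma pot_integrable:
  assumes S: "schur_bound q W C" and f: "sq_int f"
  shows "AE x in lborel. x \<in> W \<longrightarrow> integrable lborel (\<lambda>y. q (x - y) * (indicator W y * f y))"
proof -
  note [measurable] = schur_boundD(1,2)[OF S]
  have [measurable]: "f \<in> borel_measurable borel" using f by measurable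
  have "(\<integral>\<^sup>+x. indicator W x * (\<integral>\<^sup>+y. ennreal \<bar>q (x - y)\<bar> * indicator W y * ennreal \<bar>f y\<bar> \<partial>lborel)\<^sup>2 \<partial>lborel)
     \<le> ennreal (C\<^sup>2) * (\<integral>\<^sup>+y. (ennreal \<bar>f y\<bar>)\<^sup>2 \<partial>lborel)"
    by (rule schur_test[OF S]) measurable
  also have "\<dots> < \<infinity>" using f
    by (simp add: ennreal_power sq_int_iff_nn ennreal_mult_less_top)
  finally have fin: "(\<integral>\<^sup>+x. indicator W x * (\<integral>\<^sup>+y. ennreal \<bar>q (x - y)\<bar> * indicator W y * ennreal \<bar>f y\<bar> \<partial>lborel)\<^sup>2 \<partial>lborel) \<noteq> \<infinity>"
    by simp
  have "AE x in lborel. indicator W x * (\<integral>\<^sup>+y. ennreal \<bar>q (x - y)\<bar> * indicator W y * ennreal \<bar>f y\<bar> \<partial>lborel)\<^sup>2 \<noteq> \<infinity>"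
    by (rule nn_integral_PInf_AE[OF _ fin]) measurable
  then show ?thesis
  proof eventually_elim
    case (elim x)
    show ?case
    proof
      assume "x \<in> W"
      with elim have "(\<integral>\<^sup>+y. ennreal \<bar>q (x - y)\<bar> * indicator W y * ennreal \<bar>f y\<bar> \<partial>lborel) < \<infinity>"
        by (intro ennreal_square_finite) simp
      moreover have "ennreal \<bar>q (x - y)\<bar> * indicator W y * ennreal \<bar>f y\<bar> = ennreal (norm (q (x - y) * (indicator W y * f y)))" for y
        by (auto split: split_indicator simp: abs_mult ennreal_mult)
      ultimately show "integrable lborel (\<lambda>y. q (x - y) * (indicator W y * f y))"
        unfolding integrable_iff_bounded by simp
    qed
  qed
qed

lemma pot_sq_int:
  assumes S: "schur_bound q W C" and f: "sq_int f"
  shows "sq_int (pot q W f)" "norm (abs_Lsq (pot q W f)) \<le> C * norm (abs_Lsq f)"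
proof -
  note [measurable] = schur_boundD(1,2)[OF S]
  have [measurable]: "f \<in> borel_measurable borel" using f by measurable
  have m: "pot q W f \<in> borel_measurable borel" unfolding pot_def by measurable
  have "(\<integral>\<^sup>+x. ennreal ((pot q W f x)\<^sup>2) \<partial>lborel)
    \<le> (\<integral>\<^sup>+x. indicator W x * (\<integral>\<^sup>+y. ennreal \<bar>q (x - y)\<bar> * indicator W y * ennreal \<bar>f y\<bar> \<partial>lborel)\<^sup>2 \<partial>lborel)"
  proof (rule nn_integral_mono)
    fix x
    \<comment> \<open>At points where the integrand is not integrable the integral on the left is 0
      by convention, so the estimate holds for every \<open>x\<close>.\<close>
    have "ennreal \<bar>LINT y|lborel. q (x - y) * (indicator W y * f y)\<bar>
        \<le> (\<integral>\<^sup>+y. ennreal (norm (q (x - y) * (indicator W y * f y))) \<partial>lborel)"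
      using integral_norm_bound_ennreal[of lborel "\<lambda>y. q (x - y) * (indicator W y * f y)"]
      by (cases "integrable lborel (\<lambda>y. q (x - y) * (indicator W y * f y))") (auto simp: not_integrable_integral_eq)
    also have "\<dots> = (\<integral>\<^sup>+y. ennreal \<bar>q (x - y)\<bar> * indicator W y * ennreal \<bar>f y\<bar> \<partial>lborel)"
      by (intro nn_integral_cong) (auto split: split_indicator simp: abs_mult ennreal_mult)
    finally have "(ennreal \<bar>LINT y|lborel. q (x - y) * (indicator W y * f y)\<bar>)\<^sup>2
       \<le> (\<integral>\<^sup>+y. ennreal \<bar>q (x - y)\<bar> * indicator W y * ennreal \<bar>f y\<bar> \<partial>lborel)\<^sup>2"
      by (rule power_mono) simp
    then show "ennreal ((pot q W f x)\<^sup>2) \<le> indicator W x * (\<integral>\<^sup>+y. ennreal \<bar>q (x - y)\<bar> * indicator W y * ennreal \<bar>f y\<bar> \<partial>lborel)\<^sup>2"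
      by (auto simp: pot_def ennreal_power split: split_indicator)
  qed
  also have "\<dots> \<le> ennreal (C\<^sup>2) * (\<integral>\<^sup>+y. (ennreal \<bar>f y\<bar>)\<^sup>2 \<partial>lborel)"
    by (rule schur_test[OF S]) measurable
  also have "\<dots> = ennreal ((C * norm (abs_Lsq f))\<^sup>2)"
    using nn_norm_abs[OF f] by (simp add: ennreal_power ennreal_mult power_mult_distrib)
  finally show "sq_int (pot q W f)" "norm (abs_Lsq (pot q W f)) \<le> C * norm (abs_Lsq f)"
    using nn_norm_le[OF m] schur_boundD(3)[OF S] by auto
qed

lemma pot_cong:
  assumes "AE x in lborel. x \<in> W \<longrightarrow> f x = g x"
    and [measurable]: "q \<in> borel_measurable borel" "W \<in> sets borel" "f \<in> borel_measurable borel" "g \<in> borel_measurable borel"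
  shows "pot q W f x = pot q W g x"
  unfolding pot_def
  by (intro arg_cong2[where f = "(*)"] integral_cong_AE refl) (use assms(1) in \<open>auto split: split_indicator\<close>)

definition pot_op :: "('a::euclidean_space \<Rightarrow> real) \<Rightarrow> 'a set \<Rightarrow> 'a Lsq \<Rightarrow> 'a Lsq" where
  "pot_op q W X = abs_Lsq (pot q W (rep_Lsq X))"

lemma pot_op_abs:
  assumes S: "schur_bound q W C" and f: "sq_int f"
  shows "pot_op q W (abs_Lsq f) = abs_Lsq (pot q W f)"
proof -
  have "pot q W (rep_Lsq (abs_Lsq f)) = pot q W f"
    by (intro ext pot_cong) (use rep_abs_AE[OF f] schur_boundD[OF S] f rep_sq_int in \<open>auto simp: sq_int_def\<close>)
  then show ?thesis by (simp add: pot_op_def)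
qed

lemma pot_op_norm: "schur_bound q W C \<Longrightarrow> norm (pot_op q W X) \<le> C * norm X"
  using pot_sq_int(2)[OF _ rep_sq_int, of q W C X] by (simp add: pot_op_def)

lemma pot_op_bounded_linear:
  assumes S: "schur_bound q W C"
  shows "bounded_linear (pot_op q W)"
proof (rule bounded_linear_intro)
  fix X Y :: "'a Lsq" and r :: real
  have s: "sq_int (pot q W (rep_Lsq X))" for X by (rule pot_sq_int(1)[OF S rep_sq_int])
  have "AE x in lborel. pot q W (\<lambda>x. rep_Lsq X x + rep_Lsq Y x) x = pot q W (rep_Lsq X) x + pot q W (rep_Lsq Y) x"
    using pot_integrable[OF S rep_sq_int[of X]] pot_integrable[OF S rep_sq_int[of Y]]
  proof eventually_elim
    case (elim x)
    show ?case
    proof (cases "x \<in> W")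
      case True
      with elim show ?thesis
        using Bochner_Integration.integral_add[of lborel "\<lambda>y. q (x - y) * (indicator W y * rep_Lsq X y)"
            "\<lambda>y. q (x - y) * (indicator W y * rep_Lsq Y y)"]
        by (simp add: pot_def distrib_left)
    qed (simp add: pot_def)
  qed
  then have "abs_Lsq (pot q W (\<lambda>x. rep_Lsq X x + rep_Lsq Y x)) = pot_op q W X + pot_op q W Y"
    unfolding pot_op_def abs_add[OF s s]
    by (subst abs_eq_iff) (auto intro!: pot_sq_int(1)[OF S] sq_int_add rep_sq_int)
  then show "pot_op q W (X + Y) = pot_op q W X + pot_op q W Y"
    using pot_op_abs[OF S sq_int_add[OF rep_sq_int rep_sq_int, of X Y]]
    by (simp add: abs_add[OF rep_sq_int rep_sq_int, symmetric])
  have "pot q W (\<lambda>x. r * rep_Lsq X x) = (\<lambda>x. r * pot q W (rep_Lsq X) x)"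
    by (auto simp: pot_def fun_eq_iff mult.left_commute[of _ r])
  then show "pot_op q W (r *\<^sub>R X) = r *\<^sub>R pot_op q W X"
    using pot_op_abs[OF S sq_int_scale[OF rep_sq_int[of X], of r]]
    by (simp add: abs_scale[OF rep_sq_int, symmetric] pot_op_def abs_scale[OF s])
  show "norm (pot_op q W X) \<le> norm X * C" using pot_op_norm[OF S, of X] by (simp add: mult.commute)
qed

text \<open>Justifies Fubini in \<open>pot_symmetric\<close>: by Cauchy-Schwarz the double integral
  of the absolute value is controlled by the norm of \<open>g\<close> and the Schur bound applied to
  \<open>f\<close>.\<close>

lemma pot_pair_integrable:
  assumes S: "schur_bound q W C" and f: "sq_int f" and g: "sq_int g"
  shows "integrable (lborel \<Otimes>\<^sub>M lborel) (\<lambda>(x, y). indicator W x * g x * (q (x - y) * (indicator W y * f y)))"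
    (is "integrable _ ?H")
proof (rule integrableI_bounded)
  note [measurable] = schur_boundD(1,2)[OF S]
  have [measurable]: "f \<in> borel_measurable borel" "g \<in> borel_measurable borel" using f g by (simp_all add: sq_int_def)
  show "?H \<in> borel_measurable (lborel \<Otimes>\<^sub>M lborel)" by measurable
  define G where "G x = (\<integral>\<^sup>+y. ennreal \<bar>q (x - y)\<bar> * indicator W y * ennreal \<bar>f y\<bar> \<partial>lborel)" for x
  have [measurable]: "G \<in> borel_measurable borel" unfolding G_def by measurable
  have "(\<integral>\<^sup>+p. ennreal (norm (?H p)) \<partial>(lborel \<Otimes>\<^sub>M lborel))
      = (\<integral>\<^sup>+x. (\<integral>\<^sup>+y. ennreal (norm (?H (x, y))) \<partial>lborel) \<partial>lborel)"
    by (rule lborel.nn_integral_fst[symmetric]) measurable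
  also have "\<dots> = (\<integral>\<^sup>+x. (\<integral>\<^sup>+y. (indicator W x * ennreal \<bar>g x\<bar>) * (ennreal \<bar>q (x - y)\<bar> * indicator W y * ennreal \<bar>f y\<bar>) \<partial>lborel) \<partial>lborel)"
    by (intro nn_integral_cong) (auto split: split_indicator simp: abs_mult ennreal_mult mult_ac)
  also have "\<dots> = (\<integral>\<^sup>+x. ennreal \<bar>g x\<bar> * (indicator W x * G x) \<partial>lborel)"
    by (subst nn_integral_cmult) (auto simp: G_def mult_ac)
  finally have eq: "(\<integral>\<^sup>+p. ennreal (norm (?H p)) \<partial>(lborel \<Otimes>\<^sub>M lborel)) = (\<integral>\<^sup>+x. ennreal \<bar>g x\<bar> * (indicator W x * G x) \<partial>lborel)" .
  have "(\<integral>\<^sup>+x. ennreal \<bar>g x\<bar> * (indicator W x * G x) \<partial>lborel)\<^sup>2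
      \<le> (\<integral>\<^sup>+x. (ennreal \<bar>g x\<bar>)\<^sup>2 \<partial>lborel) * (\<integral>\<^sup>+x. (indicator W x * G x)\<^sup>2 \<partial>lborel)"
    by (rule Cauchy_Schwarz_nn_integral) measurable
  also have "\<dots> < \<infinity>"
  proof -
    have "(\<integral>\<^sup>+x. (indicator W x * G x)\<^sup>2 \<partial>lborel) = (\<integral>\<^sup>+x. indicator W x * (G x)\<^sup>2 \<partial>lborel)"
      by (intro nn_integral_cong) (auto split: split_indicator)
    also have "\<dots> \<le> ennreal (C\<^sup>2) * (\<integral>\<^sup>+y. (ennreal \<bar>f y\<bar>)\<^sup>2 \<partial>lborel)"
      unfolding G_def by (rule schur_test[OF S]) measurable
    also have "\<dots> < \<infinity>" using f
      by (simp add: ennreal_power sq_int_iff_nn ennreal_mult_less_top)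
    finally show ?thesis using g
      by (simp add: ennreal_power sq_int_iff_nn ennreal_mult_less_top)
  qed
  finally show "(\<integral>\<^sup>+p. ennreal (norm (?H p)) \<partial>(lborel \<Otimes>\<^sub>M lborel)) < \<infinity>"
    unfolding eq by (intro ennreal_square_finite) simp
qed

lemma pot_symmetric:
  assumes S: "schur_bound q W C" and f: "sq_int f" and g: "sq_int g"
  shows "(LINT x|lborel. pot q W f x * g x) = (LINT x|lborel. f x * pot q W g x)"
proof -
  have "(LINT x|lborel. pot q W f x * g x)
      = (LINT x|lborel. LINT y|lborel. indicator W x * g x * (q (x - y) * (indicator W y * f y)))"
    by (simp only: pot_def integral_mult_right_zero) (simp add: mult_ac)
  also have "\<dots> = (LINT y|lborel. LINT x|lborel. indicator W x * g x * (q (x - y) * (indicator W y * f y)))"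
    by (rule lborel_pair.Fubini_integral[symmetric]) (rule pot_pair_integrable[OF S f g])
  also have "\<dots> = (LINT y|lborel. LINT x|lborel. (indicator W y * f y) * (q (y - x) * (indicator W x * g x)))"
    by (intro Bochner_Integration.integral_cong) (auto simp: mult_ac schur_boundD(4)[OF S])
  also have "\<dots> = (LINT y|lborel. f y * pot q W g y)"
    by (simp only: pot_def integral_mult_right_zero) (simp add: mult_ac)
  finally show ?thesis .
qed

lemma pot_op_symmetric:
  assumes S: "schur_bound q W C"
  shows "pot_op q W X \<bullet> Y = X \<bullet> pot_op q W Y"
proof -
  have "abs_Lsq (pot q W (rep_Lsq X)) \<bullet> abs_Lsq (rep_Lsq Y) = abs_Lsq (rep_Lsq X) \<bullet> abs_Lsq (pot q W (rep_Lsq Y))"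
    by (simp only: abs_inner pot_sq_int(1)[OF S] rep_sq_int pot_symmetric[OF S rep_sq_int rep_sq_int])
  then show ?thesis by (simp add: pot_op_def)
qed

section \<open>Compactness\<close>

text \<open>The image of the unit ball stays within \<epsilon> of a compact set for every
  \<epsilon>, hence is totally bounded, and its closure is compact in a complete space.\<close>

lemma compact_operator_of_approximation:
  fixes T :: "'v::real_normed_vector \<Rightarrow> 'w::complete_space"
  assumes approx: "\<And>\<epsilon>. 0 < \<epsilon> \<Longrightarrow> \<exists>Q. compact Q \<and> (\<forall>x. norm x \<le> 1 \<longrightarrow> (\<exists>q\<in>Q. dist (T x) q \<le> \<epsilon>))"
    and X: "\<And>n::nat. norm (X n) \<le> 1"
  shows "\<exists>l r. strict_mono r \<and> (\<lambda>n. T (X (r n))) \<longlonglongrightarrow> l"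
proof -
  define S where "S = closure (T ` cball 0 1)"
  have "compact S"
    unfolding compact_eq_totally_bounded
  proof (intro conjI allI impI)
    show "complete S" by (simp add: S_def complete_eq_closed)
    fix \<epsilon> :: real assume \<epsilon>: "0 < \<epsilon>"
    obtain Q where Q: "compact Q" "\<And>x. norm x \<le> 1 \<Longrightarrow> \<exists>q\<in>Q. dist (T x) q \<le> \<epsilon>/4"
      using approx[of "\<epsilon>/4"] \<epsilon> by auto
    obtain F where F: "finite F" "Q \<subseteq> (\<Union>x\<in>F. ball x (\<epsilon>/4))"
      using Q(1) \<epsilon> unfolding compact_eq_totally_bounded by (meson divide_pos_pos zero_less_numeral)
    have "T ` cball 0 1 \<subseteq> (\<Union>x\<in>F. cball x (\<epsilon>/2))"
    proof
      fix y assume "y \<in> T ` cball 0 1"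
      then obtain x where x: "y = T x" "norm x \<le> 1" by auto
      then obtain q where q: "q \<in> Q" "dist y q \<le> \<epsilon>/4" using Q(2) by blast
      then obtain z where z: "z \<in> F" "dist z q < \<epsilon>/4" using F by auto
      have "dist z y \<le> \<epsilon>/2" using q z dist_triangle3[of z y q] by (simp add: dist_commute)
      then show "y \<in> (\<Union>x\<in>F. cball x (\<epsilon>/2))" using z by auto
    qed
    then have "S \<subseteq> (\<Union>x\<in>F. cball x (\<epsilon>/2))"
      unfolding S_def by (intro closure_minimal) (auto intro: F(1))
    also have "\<dots> \<subseteq> (\<Union>x\<in>F. ball x \<epsilon>)" using \<epsilon> by force
    finally show "\<exists>F. finite F \<and> S \<subseteq> (\<Union>x\<in>F. ball x \<epsilon>)" using F by blast
  qed
  moreover have "T (X n) \<in> S" for n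
    unfolding S_def using X by (intro closure_subset[THEN subsetD]) auto
  ultimately show ?thesis
    unfolding compact_def o_def by meson
qed

text \<open>The compact sets needed for the approximation: finite rank approximants of the unit ball
  have coefficients with a common bound.\<close>

lemma compact_bounded_combinations:
  fixes v :: "nat \<Rightarrow> 'v::real_normed_vector"
  shows "compact {\<Sum>j<n. c j *\<^sub>R v j | c. \<forall>j<n. \<bar>c j\<bar> \<le> B}"
proof (induction n)
  case 0
  then show ?case by simp
next
  case (Suc n)
  have "{\<Sum>j<Suc n. c j *\<^sub>R v j | c. \<forall>j<Suc n. \<bar>c j\<bar> \<le> B}
    = {x + y | x y. x \<in> {\<Sum>j<n. c j *\<^sub>R v j | c. \<forall>j<n. \<bar>c j\<bar> \<le> B} \<and> y \<in> (\<lambda>t. t *\<^sub>R v n) ` {-B..B}}"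
    (is "?L = ?R")
  proof
    show "?L \<subseteq> ?R"
    proof
      fix z assume "z \<in> ?L"
      then obtain c where c: "z = (\<Sum>j<Suc n. c j *\<^sub>R v j)" "\<forall>j<Suc n. \<bar>c j\<bar> \<le> B" by blast
      have "c n *\<^sub>R v n \<in> (\<lambda>t. t *\<^sub>R v n) ` {-B..B}" using c(2) by (intro imageI) (auto simp: abs_le_iff)
      moreover have "(\<Sum>j<n. c j *\<^sub>R v j) \<in> {\<Sum>j<n. c j *\<^sub>R v j | c. \<forall>j<n. \<bar>c j\<bar> \<le> B}" using c(2) by auto
      moreover have "z = (\<Sum>j<n. c j *\<^sub>R v j) + c n *\<^sub>R v n" using c(1) by simp
      ultimately show "z \<in> ?R" by blast
    qed
    show "?R \<subseteq> ?L"
    proof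
      fix z assume "z \<in> ?R"
      then obtain c t where c: "z = (\<Sum>j<n. c j *\<^sub>R v j) + t *\<^sub>R v n" "\<forall>j<n. \<bar>c j\<bar> \<le> B" "\<bar>t\<bar> \<le> B"
        by (auto simp: abs_le_iff)
      have "z = (\<Sum>j<Suc n. (c(n := t)) j *\<^sub>R v j)" using c(1) by simp
      moreover have "\<forall>j<Suc n. \<bar>(c(n := t)) j\<bar> \<le> B" using c by (auto simp: less_Suc_eq)
      ultimately show "z \<in> ?L" by blast
    qed
  qed
  moreover have "compact ((\<lambda>t. t *\<^sub>R v n) ` {-B..B})"
    by (intro compact_continuous_image continuous_intros) auto
  ultimately show ?case using compact_sums[OF Suc.IH] by (simp only:)
qed

lemma sq_int_indicator:
  assumes "W \<in> sets borel" "emeasure lborel W < \<infinity>"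
  shows "sq_int (indicator W)" "norm (abs_Lsq (indicator W)) = sqrt (measure lborel W)"
proof -
  have eq: "(indicator W x :: real)\<^sup>2 = indicator W x" for x by (simp add: indicator_def)
  show s: "sq_int (indicator W)" using assms unfolding sq_int_def eq by simp
  have "(norm (abs_Lsq (indicator W)))\<^sup>2 = measure lborel W" unfolding norm_abs[OF s] eq using assms by simp
  then show "norm (abs_Lsq (indicator W)) = sqrt (measure lborel W)" by (metis norm_ge_zero real_sqrt_abs2 real_sqrt_unique)
qed

lemma sq_int_abs: 
  assumes "sq_int f"
  shows "sq_int (\<lambda>x. \<bar>f x\<bar>)" "norm (abs_Lsq (\<lambda>x. \<bar>f x\<bar>)) = norm (abs_Lsq f)"
proof -
  show s: "sq_int (\<lambda>x. \<bar>f x\<bar>)" using assms by (auto simp: sq_int_def)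
  have "(norm (abs_Lsq (\<lambda>x. \<bar>f x\<bar>)))\<^sup>2 = (norm (abs_Lsq f))\<^sup>2"
    unfolding norm_abs[OF s] norm_abs[OF assms] by simp
  then show "norm (abs_Lsq (\<lambda>x. \<bar>f x\<bar>)) = norm (abs_Lsq f)" by (simp add: power2_eq_iff_nonneg)
qed

lemma L1_bound:
  assumes "W \<in> sets borel" "emeasure lborel W < \<infinity>" and f: "sq_int f"
  shows "integrable lborel (\<lambda>y. indicator W y * f y)"
    "(LINT y|lborel. indicator W y * \<bar>f y\<bar>) \<le> sqrt (measure lborel W) * norm (abs_Lsq f)"
proof -
  note s = sq_int_indicator[OF assms(1,2)]
  show "integrable lborel (\<lambda>y. indicator W y * f y)" by (rule sq_int_mult_integrable[OF s(1) f])
  have "(LINT y|lborel. indicator W y * \<bar>f y\<bar>) = abs_Lsq (indicator W) \<bullet> abs_Lsq (\<lambda>x. \<bar>f x\<bar>)"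
    by (rule abs_inner[symmetric, OF s(1) sq_int_abs(1)[OF f]])
  also have "\<dots> \<le> norm (abs_Lsq (indicator W)) * norm (abs_Lsq (\<lambda>x. \<bar>f x\<bar>))" by (rule norm_cauchy_schwarz)
  finally show "(LINT y|lborel. indicator W y * \<bar>f y\<bar>) \<le> sqrt (measure lborel W) * norm (abs_Lsq f)"
    by (simp add: s sq_int_abs(2)[OF f])
qed

text \<open>\<open>W\<close> may be unbounded. Outside a large ball it has little measure, and
  inside that ball finitely many small cells suffice.\<close>

lemma finite_measure_tail_small:
  fixes W :: "'a::euclidean_space set"
  assumes W: "W \<in> sets borel" "emeasure lborel W < \<infinity>" and "0 < \<eta>"
  obtains R where "emeasure lborel (W - cball 0 R) \<le> ennreal \<eta>"
proof -
  have "(\<lambda>n::nat. measure lborel (W - cball 0 (real n))) \<longlonglongrightarrow> measure lborel (\<Inter>n::nat. W - cball 0 (real n))"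
  proof (rule Lim_measure_decseq)
    show "range (\<lambda>n. W - cball 0 (real n)) \<subseteq> sets lborel" using W by auto
    show "decseq (\<lambda>n. W - cball 0 (real n))" by (auto simp: decseq_def)
    show "emeasure lborel (W - cball 0 (real n)) \<noteq> \<infinity>" for n
    proof -
      have "emeasure lborel (W - cball 0 (real n)) \<le> emeasure lborel W" using W by (intro emeasure_mono) auto
      then show ?thesis using W by (auto simp: top_unique)
    qed
  qed
  moreover have "(\<Inter>n::nat. W - cball 0 (real n)) = {}"
  proof -
    have "\<exists>n. x \<in> cball 0 (real n)" for x :: 'a using real_arch_simple[of "norm x"] by auto
    then show ?thesis by auto
  qed
  ultimately have "(\<lambda>n::nat. measure lborel (W - cball 0 (real n))) \<longlonglongrightarrow> 0"
    by (simp only: measure_empty)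
  from order_tendstoD(2)[OF this \<open>0 < \<eta>\<close>]
  obtain n :: nat where n: "measure lborel (W - cball 0 (real n)) < \<eta>"
    by (auto simp: eventually_sequentially)
  have "emeasure lborel (W - cball 0 (real n)) < \<infinity>"
    using emeasure_mono[of "W - cball 0 (real n)" W lborel] W by (auto intro: le_less_trans)
  then show ?thesis using n
    by (intro that[of "real n"]) (simp add: emeasure_eq_ennreal_measure ennreal_leI)
qed

text \<open>The differences are disjoint, so at most one summand survives, the one for the first set
  that contains \<open>x\<close>.\<close>

lemma sum_indicator_disjointed:
  fixes A :: "nat \<Rightarrow> 'a set"
  shows "(\<Sum>j<n. g j * indicator (A j - (\<Union>i<j. A i)) x) = (0::real) \<and> x \<notin> (\<Union>j<n. A j)
    \<or> (\<exists>j<n. x \<in> A j \<and> (\<Sum>j<n. g j * indicator (A j - (\<Union>i<j. A i)) x) = g j)"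
proof (cases "\<exists>j<n. x \<in> A j")
  case True
  define j where "j = (LEAST j. x \<in> A j)"
  obtain j0 where j0: "j0 < n" "x \<in> A j0" using True by blast
  have j: "x \<in> A j" "\<And>i. i < j \<Longrightarrow> x \<notin> A i"
    unfolding j_def using LeastI[of "\<lambda>j. x \<in> A j", OF j0(2)] not_less_Least by blast+
  have "j \<le> j0" unfolding j_def using j0(2) by (rule Least_le)
  then have "j < n" using j0 by simp
  have "indicator (A i - (\<Union>l<i. A l)) x = (if i = j then 1 else 0 :: real)" for i
  proof -
    have "x \<in> A i - (\<Union>l<i. A l) \<longleftrightarrow> i = j"
      using j by (cases i j rule: linorder_cases) fastforce+
    then show ?thesis by (simp only: indicator_def of_bool_def)
  qed
  then have "(\<Sum>i<n. g i * indicator (A i - (\<Union>l<i. A l)) x) = (\<Sum>i<n. if i = j then g i else 0)"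
    by (intro sum.cong) auto
  also have "\<dots> = g j" using \<open>j < n\<close> by simp
  finally show ?thesis using j(1) \<open>j < n\<close> by blast
next
  case False
  then have "(\<Sum>j<n. g j * indicator (A j - (\<Union>i<j. A i)) x) = (0::real)"
    by (intro sum.neutral) (simp add: indicator_def)
  then show ?thesis using False by blast
qed

text \<open>For a bounded Lipschitz kernel the potentials of all functions in the unit ball share a
  bound and a Lipschitz constant, as the L1 norm of such a function on \<open>W\<close> is at most
  sqrt m. Replacing a potential on each small cell by its value at the centre gives a combination of
  finitely many fixed indicators.\<close>

lemma lipschitz_pot_op_approx:
  fixes q :: "'a::euclidean_space \<Rightarrow> real"
  assumes S: "schur_bound q W C0" and W: "emeasure lborel W < \<infinity>"
    and bnd: "\<And>z. \<bar>q z\<bar> \<le> C" and lip: "\<And>x y. \<bar>q x - q y\<bar> \<le> L * norm (x - y)" and "0 < \<epsilon>"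
  shows "\<exists>Q. compact Q \<and> (\<forall>X. norm X \<le> 1 \<longrightarrow> (\<exists>v\<in>Q. dist (pot_op q W X) v \<le> \<epsilon>))"
proof -
  note [measurable] = schur_boundD(1,2)[OF S]
  have C0: "0 \<le> C" using bnd[of 0] by linarith
  have L0: "0 \<le> L"
  proof -
    obtain b :: 'a where "b \<in> Basis" using nonempty_Basis by blast
    then have "0 \<le> L * 1" using lip[of b 0] by (auto intro: order_trans[OF abs_ge_zero])
    then show ?thesis by simp
  qed
  define m where "m = measure lborel W"
  have m0: "0 \<le> m" by (simp add: m_def)
  have em: "emeasure lborel W = ennreal m" using W by (simp add: m_def emeasure_eq_ennreal_measure)
  \<comment> \<open>The cell size \<delta> and the tail measure \<eta> are chosen so that each of
    the two squared errors is at most \<epsilon>^2 / 2; the summand 1 in the denominators avoids a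
    division by zero.\<close>
  define \<delta> where "\<delta> = \<epsilon> / (2 * (L * m + 1))"
  have Lm: "0 < L * m + 1" using L0 m0 by (simp add: add_nonneg_pos)
  have \<delta>0: "0 < \<delta>" using Lm \<open>0 < \<epsilon>\<close> by (simp add: \<delta>_def)
  have \<delta>: "L * \<delta> * m \<le> \<epsilon> / 2"
  proof -
    have "L * \<delta> * m = (\<epsilon> / 2) * (L * m / (L * m + 1))" by (simp add: \<delta>_def)
    also have "\<dots> \<le> (\<epsilon> / 2) * 1" using Lm \<open>0 < \<epsilon>\<close> by (intro mult_left_mono) auto
    finally show ?thesis by simp
  qed
  define \<eta> where "\<eta> = \<epsilon>\<^sup>2 / (2 * (C\<^sup>2 * m + 1))"
  have Cm: "0 < C\<^sup>2 * m + 1" using m0 by (simp add: add_nonneg_pos)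
  have \<eta>0: "0 < \<eta>" using Cm \<open>0 < \<epsilon>\<close> by (simp add: \<eta>_def)
  have \<eta>: "C\<^sup>2 * m * \<eta> \<le> \<epsilon>\<^sup>2 / 2"
  proof -
    have "C\<^sup>2 * m * \<eta> = (\<epsilon>\<^sup>2 / 2) * (C\<^sup>2 * m / (C\<^sup>2 * m + 1))" by (simp add: \<eta>_def)
    also have "\<dots> \<le> (\<epsilon>\<^sup>2 / 2) * 1" using Cm \<open>0 < \<epsilon>\<close> by (intro mult_left_mono) auto
    finally show ?thesis by simp
  qed
  obtain R where R: "emeasure lborel (W - cball 0 R) \<le> ennreal \<eta>"
    using finite_measure_tail_small[OF schur_boundD(2)[OF S] W \<eta>0] .
  have [measurable]: "W - cball 0 R \<in> sets borel" by (intro sets.Diff schur_boundD(2)[OF S] borel_closed) simp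
  obtain F where F: "finite F" "cball 0 R \<subseteq> (\<Union>x\<in>F. ball (x::'a) \<delta>)"
    using compact_cball[of "0::'a" R] \<delta>0 unfolding compact_eq_totally_bounded by blast
  obtain p :: "nat \<Rightarrow> 'a" and n where p: "F = p ` {..<n}"
    using finite_imp_nat_seg_image_inj_on[OF F(1)] by (auto simp: lessThan_def)
  have cover: "cball 0 R \<subseteq> (\<Union>j<n. ball (p j) \<delta>)"
    using F(2) unfolding p by blast
  define P where "P j = ball (p j) \<delta> - (\<Union>i<j. ball (p i) \<delta>)" for j
  define v where "v j = abs_Lsq (indicator (W \<inter> P j))" for j
  have [measurable]: "P j \<in> sets borel" for j unfolding P_def by (intro sets.Diff sets.finite_UN) auto
  have sP: "sq_int (indicator (W \<inter> P j))" for j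
  proof (rule sq_int_indicator)
    have "emeasure lborel (W \<inter> P j) \<le> emeasure lborel W" by (intro emeasure_mono) auto
    then show "emeasure lborel (W \<inter> P j) < \<infinity>" using W by (auto intro: le_less_trans)
  qed measurable
  define Q where "Q = {\<Sum>j<n. c j *\<^sub>R v j | c. \<forall>j<n. \<bar>c j\<bar> \<le> C * sqrt m}"
  have "\<exists>u\<in>Q. dist (pot_op q W X) u \<le> \<epsilon>" if X: "norm X \<le> 1" for X
  proof -
    define f where "f = rep_Lsq X"
    have f: "sq_int f" by (simp add: f_def rep_sq_int)
    have [measurable]: "f \<in> borel_measurable borel" using f by measurable
    define A where "A = (LINT y|lborel. indicator W y * \<bar>f y\<bar>)"
    have A: "0 \<le> A" "A \<le> sqrt m"
    proof -
      show "0 \<le> A" by (simp add: A_def)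
      have "A \<le> sqrt m * norm X" using L1_bound(2)[OF schur_boundD(2)[OF S] W f] by (simp add: A_def m_def f_def)
      also have "\<dots> \<le> sqrt m * 1" using X m0 by (intro mult_left_mono) auto
      finally show "A \<le> sqrt m" by simp
    qed
    have iA: "integrable lborel (\<lambda>y. indicator W y * \<bar>f y\<bar>)"
      using L1_bound(1)[OF schur_boundD(2)[OF S] W sq_int_abs(1)[OF f]] .
    have if0: "integrable lborel (\<lambda>y. indicator W y * f y)"
      using L1_bound(1)[OF schur_boundD(2)[OF S] W f] .
    define G where "G x = (LINT y|lborel. q (x - y) * (indicator W y * f y))" for x
    have iG: "integrable lborel (\<lambda>y. q (x - y) * (indicator W y * f y))" for x
    proof (rule Bochner_Integration.integrable_bound)
      show "integrable lborel (\<lambda>y. C * (indicator W y * \<bar>f y\<bar>))" using iA by simp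
      show "AE y in lborel. norm (q (x - y) * (indicator W y * f y)) \<le> norm (C * (indicator W y * \<bar>f y\<bar>))"
        using bnd C0 by (auto simp: abs_mult intro!: mult_right_mono split: split_indicator)
      show "(\<lambda>y. q (x - y) * (indicator W y * f y)) \<in> borel_measurable lborel" by measurable
    qed
    have G1: "\<bar>G x\<bar> \<le> C * sqrt m" for x
    proof -
      have "\<bar>G x\<bar> \<le> (LINT y|lborel. norm (q (x - y) * (indicator W y * f y)))"
        unfolding G_def real_norm_def[symmetric, of "integral\<^sup>L _ _"] by (rule integral_norm_bound)
      also have "\<dots> \<le> (LINT y|lborel. C * (indicator W y * \<bar>f y\<bar>))"
      proof (rule integral_mono)
        show "integrable lborel (\<lambda>y. norm (q (x - y) * (indicator W y * f y)))" by (rule integrable_norm[OF iG])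
      qed (use bnd C0 iA in \<open>auto simp: abs_mult intro!: mult_right_mono\<close>)
      also have "\<dots> = C * A" by (simp add: A_def)
      also have "\<dots> \<le> C * sqrt m" using A C0 by (intro mult_left_mono)
      finally show ?thesis .
    qed
    have G2: "\<bar>G x - G x'\<bar> \<le> L * norm (x - x') * sqrt m" for x x'
    proof -
      have "G x - G x' = (LINT y|lborel. q (x - y) * (indicator W y * f y) - q (x' - y) * (indicator W y * f y))"
        unfolding G_def using iG by simp
      also have "\<bar>\<dots>\<bar> \<le> (LINT y|lborel. norm (q (x - y) * (indicator W y * f y) - q (x' - y) * (indicator W y * f y)))"
        unfolding real_norm_def[symmetric, of "integral\<^sup>L _ _"] by (rule integral_norm_bound)
      also have "\<dots> \<le> (LINT y|lborel. (L * norm (x - x')) * (indicator W y * \<bar>f y\<bar>))"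
      proof (rule integral_mono)
        show "integrable lborel (\<lambda>y. norm (q (x - y) * (indicator W y * f y) - q (x' - y) * (indicator W y * f y)))"
          by (intro integrable_norm Bochner_Integration.integrable_diff iG)
        show "integrable lborel (\<lambda>y. (L * norm (x - x')) * (indicator W y * \<bar>f y\<bar>))" using iA by simp
        fix y
        have "\<bar>q (x - y) - q (x' - y)\<bar> \<le> L * norm (x - x')" using lip[of "x - y" "x' - y"] by simp
        then show "norm (q (x - y) * (indicator W y * f y) - q (x' - y) * (indicator W y * f y))
          \<le> (L * norm (x - x')) * (indicator W y * \<bar>f y\<bar>)"
          unfolding left_diff_distrib[symmetric] by (auto simp: abs_mult intro!: mult_right_mono)
      qed
      also have "\<dots> = L * norm (x - x') * A" by (simp add: A_def)
      also have "\<dots> \<le> L * norm (x - x') * sqrt m" using A L0 by (intro mult_left_mono) auto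
      finally show ?thesis .
    qed
    define s where "s x = (\<Sum>j<n. G (p j) * indicator (W \<inter> P j) x)" for x
    have ss: "sq_int s" "(\<Sum>j<n. G (p j) *\<^sub>R v j) = abs_Lsq s"
      using abs_Lsq_sum[of "{..<n}" "\<lambda>j x. G (p j) * indicator (W \<inter> P j) x"] sP
      unfolding s_def by (auto simp: v_def abs_scale sq_int_scale)
    have sp: "sq_int (pot q W f)" by (rule pot_sq_int(1)[OF S f])
    \<comment> \<open>Either \<open>x\<close> escapes all cells, hence lies outside the large ball,
      and the full bound C * sqrt m is paid on the small tail; or the value at the centre of a cell
      is off by at most L * \<delta> * sqrt m.\<close>
    have pw: "(pot q W f x - s x)\<^sup>2 \<le> (L * \<delta>)\<^sup>2 * m * indicator W x + C\<^sup>2 * m * indicator (W - cball 0 R) x" for x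
    proof (cases "x \<in> W")
      case False
      then show ?thesis by (simp add: pot_def s_def)
    next
      case True
      then have s_eq: "s x = (\<Sum>j<n. G (p j) * indicator (ball (p j) \<delta> - (\<Union>i<j. ball (p i) \<delta>)) x)"
        unfolding s_def P_def by (intro sum.cong) (auto split: split_indicator)
      have pq: "pot q W f x = G x" using True by (simp add: pot_def G_def)
      from sum_indicator_disjointed[where A = "\<lambda>j. ball (p j) \<delta>" and g = "\<lambda>j. G (p j)" and n = n and x = x, folded s_eq]
      consider "s x = 0" "x \<notin> cball 0 R" | j where "x \<in> ball (p j) \<delta>" "s x = G (p j)" using cover by blast
      then show ?thesis
      proof cases
        case 1
        have "(G x)\<^sup>2 = \<bar>G x\<bar>\<^sup>2" by simp
        also have "\<dots> \<le> (C * sqrt m)\<^sup>2" using G1 by (intro power_mono) auto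
        also have "\<dots> = C\<^sup>2 * m" using m0 by (simp add: power_mult_distrib)
        finally show ?thesis using 1 True pq m0 by (simp add: add_increasing)
      next
        case 2
        have "\<bar>G x - G (p j)\<bar> \<le> L * norm (x - p j) * sqrt m" by (rule G2)
        also have "\<dots> \<le> L * \<delta> * sqrt m"
          using 2 L0 m0 by (intro mult_right_mono mult_left_mono) (auto simp: dist_norm norm_minus_commute)
        finally have "\<bar>G x - G (p j)\<bar>\<^sup>2 \<le> (L * \<delta> * sqrt m)\<^sup>2" by (intro power_mono) auto
        then have "(G x - G (p j))\<^sup>2 \<le> (L * \<delta>)\<^sup>2 * m" using m0 by (simp add: power_mult_distrib)
        then show ?thesis using 2 True pq m0 by (simp add: add_increasing2)
      qed
    qed
    have "(\<integral>\<^sup>+x. ennreal ((pot q W f x - s x)\<^sup>2) \<partial>lborel)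
        \<le> (\<integral>\<^sup>+x. ennreal ((L * \<delta>)\<^sup>2 * m) * indicator W x + ennreal (C\<^sup>2 * m) * indicator (W - cball 0 R) x \<partial>lborel)"
    proof (rule nn_integral_mono)
      fix x
      have "ennreal ((pot q W f x - s x)\<^sup>2) \<le> ennreal ((L * \<delta>)\<^sup>2 * m * indicator W x + C\<^sup>2 * m * indicator (W - cball 0 R) x)"
        by (rule ennreal_leI[OF pw])
      also have "\<dots> = ennreal ((L * \<delta>)\<^sup>2 * m) * indicator W x + ennreal (C\<^sup>2 * m) * indicator (W - cball 0 R) x"
        using m0 by (subst ennreal_plus) (auto simp: ennreal_mult'' ennreal_indicator)
      finally show "ennreal ((pot q W f x - s x)\<^sup>2)
        \<le> ennreal ((L * \<delta>)\<^sup>2 * m) * indicator W x + ennreal (C\<^sup>2 * m) * indicator (W - cball 0 R) x" .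
    qed
    also have "\<dots> = ennreal ((L * \<delta>)\<^sup>2 * m) * emeasure lborel W + ennreal (C\<^sup>2 * m) * emeasure lborel (W - cball 0 R)"
    proof -
      have "W - cball 0 R \<in> sets lborel" "W \<in> sets lborel" by simp_all
      then show ?thesis by (subst nn_integral_add) (simp_all add: nn_integral_cmult_indicator)
    qed
    also have "\<dots> \<le> ennreal ((L * \<delta>)\<^sup>2 * m) * ennreal m + ennreal (C\<^sup>2 * m) * ennreal \<eta>"
      unfolding em by (intro add_left_mono mult_left_mono R) auto
    also have "\<dots> = ennreal ((L * \<delta>)\<^sup>2 * m * m + C\<^sup>2 * m * \<eta>)"
      using m0 \<eta>0 by (simp add: ennreal_mult[symmetric] ennreal_plus[symmetric] del: ennreal_plus)
    also have "\<dots> \<le> ennreal (\<epsilon>\<^sup>2)"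
    proof (rule ennreal_leI)
      have "(L * \<delta>)\<^sup>2 * m * m = (L * \<delta> * m)\<^sup>2" by (simp add: power2_eq_square)
      also have "\<dots> \<le> (\<epsilon> / 2)\<^sup>2" using \<delta> L0 \<delta>0 m0 by (intro power_mono) auto
      also have "\<dots> \<le> \<epsilon>\<^sup>2 / 2" by (simp add: power2_eq_square)
      finally show "(L * \<delta>)\<^sup>2 * m * m + C\<^sup>2 * m * \<eta> \<le> \<epsilon>\<^sup>2" using \<eta> by simp
    qed
    finally have "norm (abs_Lsq (\<lambda>x. pot q W f x - s x)) \<le> \<epsilon>"
      using sq_int_diff[OF sp ss(1)] \<open>0 < \<epsilon>\<close> by (intro nn_norm_le(2)) auto
    then have "dist (pot_op q W X) (\<Sum>j<n. G (p j) *\<^sub>R v j) \<le> \<epsilon>"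
      by (simp add: dist_norm ss pot_op_def f_def[symmetric] abs_diff[OF sp ss(1)])
    moreover have "(\<Sum>j<n. G (p j) *\<^sub>R v j) \<in> Q" using G1 unfolding Q_def by auto
    ultimately show ?thesis by blast
  qed
  then show ?thesis using compact_bounded_combinations[of v n "C * sqrt m"] unfolding Q_def by blast
qed

section \<open>Kernels with integrable singularity\<close>

text \<open>Schur's test for the difference kernel, with its L1 norm as constant: kernels close in
  L1 give operators close in norm, so compactness passes from Lipschitz kernels to singular
  ones.\<close>

lemma pot_op_diff_norm:
  assumes S1: "schur_bound q1 W C1" and S2: "schur_bound q2 W C2"
    and le: "(\<integral>\<^sup>+z. ennreal \<bar>q1 z - q2 z\<bar> \<partial>lborel) \<le> ennreal \<epsilon>" and "0 \<le> \<epsilon>"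
  shows "norm (pot_op q1 W X - pot_op q2 W X) \<le> \<epsilon> * norm X"
proof -
  note [measurable] = schur_boundD(1,2)[OF S1] schur_boundD(1)[OF S2]
  have S: "schur_bound (\<lambda>z. q1 z - q2 z) W \<epsilon>"
    unfolding schur_bound_def
  proof (intro conjI allI)
    show "q1 (- z) - q2 (- z) = q1 z - q2 z" for z using S1 S2 by (simp add: schur_bound_def)
    fix x
    have "(\<integral>\<^sup>+y. ennreal \<bar>q1 (x - y) - q2 (x - y)\<bar> * indicator W y \<partial>lborel)
        \<le> (\<integral>\<^sup>+y. ennreal \<bar>q1 (x - y) - q2 (x - y)\<bar> \<partial>lborel)"
      by (intro nn_integral_mono) (auto split: split_indicator)
    also have "\<dots> = (\<integral>\<^sup>+z. ennreal \<bar>q1 z - q2 z\<bar> \<partial>lborel)"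
      by (rule nn_integral_lborel_reflect) measurable
    finally show "(\<integral>\<^sup>+y. ennreal \<bar>q1 (x - y) - q2 (x - y)\<bar> * indicator W y \<partial>lborel) \<le> ennreal \<epsilon>"
      using le by simp
  qed (use assms in \<open>auto simp: schur_bound_def\<close>)
  define f where "f = rep_Lsq X"
  have f: "sq_int f" by (simp add: f_def rep_sq_int)
  have "AE x in lborel. pot q1 W f x - pot q2 W f x = pot (\<lambda>z. q1 z - q2 z) W f x"
    using pot_integrable[OF S1 f] pot_integrable[OF S2 f]
  proof eventually_elim
    case (elim x)
    show ?case
    proof (cases "x \<in> W")
      case True
      with elim show ?thesis
        using Bochner_Integration.integral_diff[of lborel "\<lambda>y. q1 (x - y) * (indicator W y * f y)"
            "\<lambda>y. q2 (x - y) * (indicator W y * f y)"]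
        by (simp add: pot_def left_diff_distrib)
    qed (simp add: pot_def)
  qed
  then have "pot_op q1 W X - pot_op q2 W X = pot_op (\<lambda>z. q1 z - q2 z) W X"
    unfolding pot_op_def f_def[symmetric] abs_diff[OF pot_sq_int(1)[OF S1 f] pot_sq_int(1)[OF S2 f]]
    by (subst abs_eq_iff) (auto intro!: sq_int_diff pot_sq_int(1)[OF S] pot_sq_int(1)[OF S1] pot_sq_int(1)[OF S2] f)
  then show ?thesis using pot_op_norm[OF S] by simp
qed

lemma continuous_borel_of_lipschitz:
  fixes g :: "'a::real_normed_vector \<Rightarrow> real"
  assumes "\<And>x y. \<bar>g x - g y\<bar> \<le> L * norm (x - y)"
  shows "continuous_on UNIV g" "g \<in> borel_measurable borel"
proof -
  have "\<bar>g x - g y\<bar> \<le> max L 0 * norm (x - y)" for x y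
    by (rule order_trans[OF assms mult_right_mono]) auto
  then have "(max L 0)-lipschitz_on UNIV g"
    by (intro lipschitz_onI) (auto simp: dist_norm)
  then show "continuous_on UNIV g" by (rule lipschitz_on_continuous_on)
  then show "g \<in> borel_measurable borel" by (rule borel_measurable_continuous_onI)
qed

lemma schur_bound_bounded:
  assumes "q \<in> borel_measurable borel" "W \<in> sets borel" "emeasure lborel W < \<infinity>"
    "\<And>x. q (- x) = q x" "\<And>x. \<bar>q x\<bar> \<le> C"
  shows "schur_bound q W (C * measure lborel W)"
  unfolding schur_bound_def
proof (intro conjI allI)
  have C: "0 \<le> C" using assms(5)[of 0] by linarith
  show "0 \<le> C * measure lborel W" using C by simp
  fix x
  have "(\<integral>\<^sup>+y. ennreal \<bar>q (x - y)\<bar> * indicator W y \<partial>lborel) \<le> (\<integral>\<^sup>+y. ennreal C * indicator W y \<partial>lborel)"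
    using assms by (intro nn_integral_mono mult_right_mono ennreal_leI) auto
  also have "\<dots> = ennreal (C * measure lborel W)"
    using assms C by (subst nn_integral_cmult_indicator) (auto simp: ennreal_mult emeasure_eq_ennreal_measure)
  finally show "(\<integral>\<^sup>+y. ennreal \<bar>q (x - y)\<bar> * indicator W y \<partial>lborel) \<le> ennreal (C * measure lborel W)" .
qed (use assms in auto)

text \<open>The properties of the Riesz kernel on which the argument rests. Positivity and
  monotonicity are asked for positive radii only, because \<open>0 powr\<close> any exponent is 0
  and the singularity is thus replaced by the value 0. In \<open>truncation\<close> the L1 distance
  over the whole space can be small although the kernel need not be integrable: the two kernels need
  to differ only near the singularity.\<close>

locale potential_kernel =
  fixes k :: "'a::euclidean_space \<Rightarrow> real" and h :: "real \<Rightarrow> real"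
  assumes k_eq: "k z = h (norm z)"
    and h_borel [measurable]: "h \<in> borel_measurable borel"
    and h_nonneg: "0 \<le> h r"
    and h_pos: "0 < r \<Longrightarrow> 0 < h r"
    and h_antimono: "0 < r \<Longrightarrow> r \<le> s \<Longrightarrow> h s \<le> h r"
    and h_vanish: "(h \<longlongrightarrow> 0) at_top"
    and truncation: "0 < \<epsilon> \<Longrightarrow> \<exists>k' L C. (\<forall>x y. \<bar>k' x - k' y\<bar> \<le> L * norm (x - y)) \<and> (\<forall>x. \<bar>k' x\<bar> \<le> C) \<and>
      (\<forall>x. k' (- x) = k' x) \<and> (\<integral>\<^sup>+z. ennreal \<bar>k z - k' z\<bar> \<partial>lborel) \<le> ennreal \<epsilon>"
begin

lemma k_borel [measurable]: "k \<in> borel_measurable borel"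
proof -
  have "k = (\<lambda>z. h (norm z))" using k_eq by auto
  then show ?thesis by simp
qed

lemma k_nonneg: "0 \<le> k z"
  by (simp add: k_eq h_nonneg)

lemma k_even: "k (- z) = k z"
  by (simp add: k_eq)

lemma k_commute: "k (x - y) = k (y - x)"
  by (simp add: k_eq norm_minus_commute)

text \<open>The kernel is at most \<bar>k - k'\<bar> + C. The first part contributes at most 1, the
  second at most \<open>C\<close> times the measure of \<open>W\<close>; so the constant depends on
  \<open>W\<close> only through a bound for its measure.\<close>

lemma schur_bound_measure:
  obtains C where "0 \<le> C" "\<And>W. W \<in> sets borel \<Longrightarrow> emeasure lborel W \<le> ennreal m \<Longrightarrow> schur_bound k W C"
proof -
  obtain k' L C where k': "\<And>x y. \<bar>k' x - k' y\<bar> \<le> L * norm (x - y)" "\<And>x. \<bar>k' x\<bar> \<le> C" "\<And>x. k' (- x) = k' x"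
      "(\<integral>\<^sup>+z. ennreal \<bar>k z - k' z\<bar> \<partial>lborel) \<le> ennreal 1"
    using truncation[of 1] by (metis zero_less_one)
  have [measurable]: "k' \<in> borel_measurable borel" using k'(1) by (rule continuous_borel_of_lipschitz)
  have C: "0 \<le> C" using k'(2)[of 0] by linarith
  show thesis
  proof (rule that)
    show "0 \<le> 1 + C * max m 0" using C by simp
    fix W :: "'a set" assume W [measurable]: "W \<in> sets borel" and m: "emeasure lborel W \<le> ennreal m"
    show "schur_bound k W (1 + C * max m 0)"
      unfolding schur_bound_def
    proof (intro conjI allI)
      show "0 \<le> 1 + C * max m 0" using C by simp
      fix x
      have "(\<integral>\<^sup>+y. ennreal \<bar>k (x - y)\<bar> * indicator W y \<partial>lborel)
        \<le> (\<integral>\<^sup>+y. ennreal \<bar>k (x - y) - k' (x - y)\<bar> + ennreal C * indicator W y \<partial>lborel)"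
      proof (rule nn_integral_mono)
        fix y
        have "\<bar>k (x - y)\<bar> \<le> \<bar>k (x - y) - k' (x - y)\<bar> + C" using k'(2)[of "x - y"] by linarith
        then have "ennreal \<bar>k (x - y)\<bar> \<le> ennreal \<bar>k (x - y) - k' (x - y)\<bar> + ennreal C"
          using C by (subst ennreal_plus[symmetric]) (auto intro: ennreal_leI simp del: ennreal_plus)
        then show "ennreal \<bar>k (x - y)\<bar> * indicator W y \<le> ennreal \<bar>k (x - y) - k' (x - y)\<bar> + ennreal C * indicator W y"
          by (auto split: split_indicator)
      qed
      also have "\<dots> = (\<integral>\<^sup>+y. ennreal \<bar>k (x - y) - k' (x - y)\<bar> \<partial>lborel) + ennreal C * emeasure lborel W"
        by (subst nn_integral_add) (simp_all add: nn_integral_cmult_indicator)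
      also have "(\<integral>\<^sup>+y. ennreal \<bar>k (x - y) - k' (x - y)\<bar> \<partial>lborel) = (\<integral>\<^sup>+z. ennreal \<bar>k z - k' z\<bar> \<partial>lborel)"
        by (rule nn_integral_lborel_reflect) measurable
      also have "\<dots> + ennreal C * emeasure lborel W \<le> ennreal 1 + ennreal C * ennreal (max m 0)"
        using m by (intro add_mono k'(4) mult_left_mono) (auto intro: order_trans ennreal_leI)
      also have "\<dots> = ennreal (1 + C * max m 0)"
        using C by (subst ennreal_mult[symmetric]) (auto simp flip: ennreal_plus ennreal_1)
      finally show "(\<integral>\<^sup>+y. ennreal \<bar>k (x - y)\<bar> * indicator W y \<partial>lborel) \<le> ennreal (1 + C * max m 0)" .
    qed (auto simp: k_even)
  qed
qed

lemma schur_bound_exists: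
  assumes "W \<in> sets borel" "emeasure lborel W < \<infinity>"
  obtains C where "schur_bound k W C"
proof -
  have "emeasure lborel W \<le> ennreal (measure lborel W)"
    using assms by (simp add: emeasure_eq_ennreal_measure)
  then show thesis using schur_bound_measure[of "measure lborel W" thesis] assms that by blast
qed

lemma pot_op_compact_symmetric:
  assumes W: "W \<in> sets borel" "emeasure lborel W < \<infinity>"
  shows "compact_symmetric (pot_op k W)"
proof -
  obtain C where S: "schur_bound k W C" using schur_bound_exists[OF W] .
  have approx: "\<exists>Q. compact Q \<and> (\<forall>X. norm X \<le> 1 \<longrightarrow> (\<exists>v\<in>Q. dist (pot_op k W X) v \<le> \<epsilon>))" if \<epsilon>: "0 < \<epsilon>" for \<epsilon>
  proof -
    obtain k' L C' where k': "\<And>x y. \<bar>k' x - k' y\<bar> \<le> L * norm (x - y)" "\<And>x. \<bar>k' x\<bar> \<le> C'" "\<And>x. k' (- x) = k' x"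
        "(\<integral>\<^sup>+z. ennreal \<bar>k z - k' z\<bar> \<partial>lborel) \<le> ennreal (\<epsilon>/2)"
      using truncation[of "\<epsilon>/2"] \<epsilon> by auto
    have "k' \<in> borel_measurable borel" using k'(1) by (rule continuous_borel_of_lipschitz)
    from schur_bound_bounded[OF this W k'(3) k'(2)]
    have S': "schur_bound k' W (C' * measure lborel W)" .
    obtain Q where Q: "compact Q" "\<And>X. norm X \<le> 1 \<Longrightarrow> \<exists>v\<in>Q. dist (pot_op k' W X) v \<le> \<epsilon>/2"
      using lipschitz_pot_op_approx[OF S' W(2) k'(2,1), of "\<epsilon>/2"] \<epsilon> by auto
    have "\<exists>v\<in>Q. dist (pot_op k W X) v \<le> \<epsilon>" if X: "norm X \<le> 1" for X
    proof -
      obtain v where v: "v \<in> Q" "dist (pot_op k' W X) v \<le> \<epsilon>/2" using Q(2)[OF X] by blast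
      have "norm (pot_op k W X - pot_op k' W X) \<le> (\<epsilon>/2) * norm X"
        by (rule pot_op_diff_norm[OF S S' k'(4)]) (use \<epsilon> in simp)
      also have "\<dots> \<le> (\<epsilon>/2) * 1" using X \<epsilon> by (intro mult_left_mono) auto
      finally have "dist (pot_op k W X) (pot_op k' W X) \<le> \<epsilon>/2" by (simp add: dist_norm)
      then have "dist (pot_op k W X) v \<le> \<epsilon>"
        using v dist_triangle[of "pot_op k W X" v "pot_op k' W X"] by simp
      then show ?thesis using v by blast
    qed
    then show ?thesis using Q(1) by blast
  qed
  show ?thesis
  proof (rule compact_symmetric.intro)
    show "bounded_linear (pot_op k W)" by (rule pot_op_bounded_linear[OF S])
    show "pot_op k W x \<bullet> y = x \<bullet> pot_op k W y" for x y by (rule pot_op_symmetric[OF S])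
    show "\<exists>l r. strict_mono r \<and> (\<lambda>n. pot_op k W (X (r n))) \<longlonglongrightarrow> l" if "\<And>n::nat. norm (X n) \<le> 1" for X
      by (rule compact_operator_of_approximation[OF approx that])
  qed
qed

end

text \<open>On the dyadic shell \<open>\<delta> / 2 ^ (j + 1) \<le> norm z < \<delta> / 2 ^ j\<close> the integrand is at most its value
  at the inner radius, and the resulting bounds sum to a geometric series.\<close>

lemma nn_integral_norm_powr_ball:
  assumes \<alpha>: "0 < \<alpha>" "\<alpha> < real DIM('a)" and "0 < \<delta>"
  shows "(\<integral>\<^sup>+z. ennreal (norm (z::'a::euclidean_space) powr (\<alpha> - real DIM('a))) * indicator (ball 0 \<delta>) z \<partial>lborel)
    \<le> ennreal (\<delta> powr \<alpha> * (2 powr (real DIM('a) - \<alpha>) * unit_ball_vol (real DIM('a)) / (1 - 2 powr (- \<alpha>))))"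
proof -
  let ?d = "real DIM('a)"
  define c where "c j = (\<delta> / 2 ^ Suc j) powr (\<alpha> - ?d)" for j
  have "(\<integral>\<^sup>+z. ennreal (norm (z::'a) powr (\<alpha> - ?d)) * indicator (ball 0 \<delta>) z \<partial>lborel)
    \<le> (\<integral>\<^sup>+z. (\<Sum>j. ennreal (c j) * indicator (ball (0::'a) (\<delta> / 2 ^ j)) z) \<partial>lborel)"
  proof (rule nn_integral_mono)
    fix z :: 'a
    show "ennreal (norm z powr (\<alpha> - ?d)) * indicator (ball 0 \<delta>) z \<le> (\<Sum>j. ennreal (c j) * indicator (ball 0 (\<delta> / 2 ^ j)) z)"
    proof (cases "z \<noteq> 0 \<and> norm z < \<delta>")
      case True
      have "\<exists>j::nat. \<delta> / 2 ^ Suc j \<le> norm z"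
      proof -
        obtain n where "\<delta> / norm z < 2 ^ n" using real_arch_pow[of 2 "\<delta> / norm z"] by auto
        then have "\<delta> / 2 ^ Suc n \<le> norm z" using True \<open>0 < \<delta>\<close> by (simp add: field_simps)
        then show ?thesis by blast
      qed
      define j where "j = (LEAST j. \<delta> / 2 ^ Suc j \<le> norm z)"
      have j: "\<delta> / 2 ^ Suc j \<le> norm z" unfolding j_def using \<open>\<exists>j. _\<close> by (rule LeastI_ex)
      have j2: "norm z < \<delta> / 2 ^ j"
      proof (cases j)
        case 0
        then show ?thesis using True by simp
      next
        case (Suc i)
        then have "i < (LEAST j. \<delta> / 2 ^ Suc j \<le> norm z)" by (simp add: j_def)
        then have "\<not> \<delta> / 2 ^ Suc i \<le> norm z" by (rule not_less_Least)
        then show ?thesis using Suc by simp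
      qed
      have "norm z powr (\<alpha> - ?d) \<le> c j"
        unfolding c_def using j \<alpha> \<open>0 < \<delta>\<close> by (intro powr_mono2') auto
      then have "ennreal (norm z powr (\<alpha> - ?d)) * indicator (ball 0 \<delta>) z \<le> ennreal (c j) * indicator (ball 0 (\<delta> / 2 ^ j)) z"
        using j2 True by (auto intro: ennreal_leI)
      also have "\<dots> = (\<Sum>j\<in>{j}. ennreal (c j) * indicator (ball 0 (\<delta> / 2 ^ j)) z)"
        by (simp only: sum.insert finite.emptyI empty_iff not_False_eq_True sum.empty add_0_right)
      also have "\<dots> \<le> (\<Sum>j. ennreal (c j) * indicator (ball 0 (\<delta> / 2 ^ j)) z)"
        by (rule sum_le_suminf) (rule summableI, rule finite.insertI[OF finite.emptyI], rule zero_le)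
      finally show ?thesis .
    qed auto
  qed
  also have "\<dots> = (\<Sum>j. \<integral>\<^sup>+z. ennreal (c j) * indicator (ball (0::'a) (\<delta> / 2 ^ j)) z \<partial>lborel)"
    by (rule nn_integral_suminf) (auto intro!: borel_measurable_times_ennreal borel_measurable_indicator)
  also have "\<dots> = (\<Sum>j. ennreal (\<delta> powr \<alpha> * (2 powr (?d - \<alpha>) * unit_ball_vol ?d) * (2 powr (- \<alpha>)) ^ j))"
  proof (intro suminf_cong)
    fix j
    have "(\<integral>\<^sup>+z. ennreal (c j) * indicator (ball (0::'a) (\<delta> / 2 ^ j)) z \<partial>lborel)
      = ennreal (c j) * ennreal (unit_ball_vol ?d * (\<delta> / 2 ^ j) ^ DIM('a))"
      using \<open>0 < \<delta>\<close> by (simp add: nn_integral_cmult_indicator emeasure_ball)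
    also have "\<dots> = ennreal (c j * (unit_ball_vol ?d * (\<delta> / 2 ^ j) ^ DIM('a)))"
      using \<open>0 < \<delta>\<close> by (subst ennreal_mult) (auto simp: c_def unit_ball_vol_nonneg)
    also have "c j * (unit_ball_vol ?d * (\<delta> / 2 ^ j) ^ DIM('a))
      = \<delta> powr \<alpha> * (2 powr (?d - \<alpha>) * unit_ball_vol ?d) * (2 powr (- \<alpha>)) ^ j"
    proof -
      have p2: "(2::real) ^ i = 2 powr real i" for i by (simp add: powr_realpow)
      have e1: "c j = \<delta> powr (\<alpha> - ?d) * 2 powr (real (Suc j) * (?d - \<alpha>))"
        using \<open>0 < \<delta>\<close> unfolding c_def p2
        by (simp add: powr_mult powr_powr divide_powr_uminus algebra_simps)
      have e2: "(\<delta> / 2 ^ j) ^ DIM('a) = \<delta> powr ?d * 2 powr (- (real j * ?d))"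
        using \<open>0 < \<delta>\<close> unfolding p2
        by (simp add: powr_realpow[symmetric] powr_mult powr_powr divide_powr_uminus)
      have e3: "(2 powr (- \<alpha>)) ^ j = 2 powr (- (real j * \<alpha>))"
        by (simp add: powr_realpow[symmetric] powr_powr mult.commute)
      have "\<delta> powr (\<alpha> - ?d) * \<delta> powr ?d = \<delta> powr \<alpha>" by (simp add: powr_add[symmetric])
      moreover have "2 powr (real (Suc j) * (?d - \<alpha>)) * 2 powr (- (real j * ?d)) = 2 powr (?d - \<alpha>) * 2 powr (- (real j * \<alpha>))"
        by (simp add: powr_add[symmetric] algebra_simps)
      moreover have "c j * (unit_ball_vol ?d * (\<delta> / 2 ^ j) ^ DIM('a)) =
          (\<delta> powr (\<alpha> - ?d) * \<delta> powr ?d) *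
          (2 powr (real (Suc j) * (?d - \<alpha>)) * 2 powr (- (real j * ?d))) * unit_ball_vol ?d"
        unfolding e1 e2 by (simp only: ac_simps)
      ultimately show ?thesis unfolding e3 by (simp only: ac_simps)
    qed
    finally show "(\<integral>\<^sup>+z. ennreal (c j) * indicator (ball (0::'a) (\<delta> / 2 ^ j)) z \<partial>lborel)
      = ennreal (\<delta> powr \<alpha> * (2 powr (?d - \<alpha>) * unit_ball_vol ?d) * (2 powr (- \<alpha>)) ^ j)" .
  qed
  also have "\<dots> = ennreal (\<Sum>j. \<delta> powr \<alpha> * (2 powr (?d - \<alpha>) * unit_ball_vol ?d) * (2 powr (- \<alpha>)) ^ j)"
    using \<alpha> by (intro suminf_ennreal2 summable_mult summable_geometric) (auto simp: unit_ball_vol_nonneg powr_less_one)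
  also have "(\<Sum>j. \<delta> powr \<alpha> * (2 powr (?d - \<alpha>) * unit_ball_vol ?d) * (2 powr (- \<alpha>)) ^ j)
    = \<delta> powr \<alpha> * (2 powr (?d - \<alpha>) * unit_ball_vol ?d) * (1 / (1 - 2 powr (- \<alpha>)))"
    using \<alpha> by (subst suminf_mult) (auto simp: suminf_geometric powr_less_one intro!: summable_geometric)
  finally show ?thesis by simp
qed

section \<open>Riesz kernel and polarization\<close>

lemma riesz_const_pos:
  assumes "0 < \<alpha>" "\<alpha> < real d"
  shows "0 < riesz_const d \<alpha>"
  unfolding riesz_const_def using assms
  by (intro mult_pos_pos divide_pos_pos Gamma_real_pos) (auto simp: powr_gt_zero)

lemma powr_neg_lipschitz:
  fixes a b s \<delta> :: real
  assumes "0 < s" "0 < \<delta>" "\<delta> \<le> a" "\<delta> \<le> b"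
  shows "\<bar>a powr (- s) - b powr (- s)\<bar> \<le> s * \<delta> powr (- s - 1) * \<bar>a - b\<bar>"
proof -
  have *: "\<bar>a powr (- s) - b powr (- s)\<bar> \<le> s * \<delta> powr (- s - 1) * \<bar>a - b\<bar>"
    if "a < b" "\<delta> \<le> a" for a b
  proof -
    have der: "((\<lambda>x. x powr (- s)) has_real_derivative (- s) * x powr (- s - 1)) (at x)" if "a \<le> x" for x
      using that \<open>\<delta> \<le> a\<close> \<open>0 < \<delta>\<close> by (intro has_real_derivative_powr) auto
    obtain z where z: "a < z" "z < b" "b powr (- s) - a powr (- s) = (b - a) * ((- s) * z powr (- s - 1))"
      using MVT2[OF \<open>a < b\<close>, of "\<lambda>x. x powr (- s)" "\<lambda>x. (- s) * x powr (- s - 1)"] der by blast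
    have "\<bar>a powr (- s) - b powr (- s)\<bar> = \<bar>b powr (- s) - a powr (- s)\<bar>" by simp
    also have "\<dots> = s * z powr (- s - 1) * \<bar>a - b\<bar>"
      unfolding z(3) using \<open>0 < s\<close> by (simp add: abs_mult abs_minus_commute)
    also have "\<dots> \<le> s * \<delta> powr (- s - 1) * \<bar>a - b\<bar>"
      using assms z that by (intro mult_right_mono mult_left_mono powr_mono2') auto
    finally show ?thesis .
  qed
  show ?thesis
  proof (cases a b rule: linorder_cases)
    case less
    then show ?thesis using *[of a b] assms by simp
  next
    case greater
    then show ?thesis using *[of b a] assms by (simp add: abs_minus_commute)
  qed simp
qed

text \<open>The truncation replaces norm z by max (norm z) \<delta>. It changes the kernel only in
  the ball of radius \<delta>, where the integral of the kernel is of order \<delta> powr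
  \<alpha>.\<close>

lemma riesz_potential_kernel:
  fixes \<alpha> :: real
  assumes \<alpha>: "0 < \<alpha>" "\<alpha> < real DIM('a)"
  shows "potential_kernel (\<lambda>z::'a::euclidean_space. riesz_const DIM('a) \<alpha> * norm z powr (\<alpha> - real DIM('a)))
    (\<lambda>r. riesz_const DIM('a) \<alpha> * r powr (\<alpha> - real DIM('a)))"
proof
  let ?d = "real DIM('a)"
  define c where "c = riesz_const DIM('a) \<alpha>"
  have c: "0 < c" unfolding c_def using \<alpha> by (rule riesz_const_pos)
  show "0 \<le> riesz_const DIM('a) \<alpha> * r powr (\<alpha> - ?d)" for r using c by (simp add: c_def)
  show "0 < riesz_const DIM('a) \<alpha> * r powr (\<alpha> - ?d)" if "0 < r" for r using c that by (simp add: c_def)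
  show "riesz_const DIM('a) \<alpha> * s powr (\<alpha> - ?d) \<le> riesz_const DIM('a) \<alpha> * r powr (\<alpha> - ?d)"
    if "0 < r" "r \<le> s" for r s using c that \<alpha> by (intro mult_left_mono powr_mono2') (auto simp: c_def)
  have "((\<lambda>r. r powr (\<alpha> - ?d)) \<longlongrightarrow> 0) at_top"
    using \<alpha> by (intro tendsto_neg_powr filterlim_ident) auto
  then show "((\<lambda>r. riesz_const DIM('a) \<alpha> * r powr (\<alpha> - ?d)) \<longlongrightarrow> 0) at_top"
    by (rule tendsto_mult_right_zero)
  fix \<epsilon> :: real assume \<epsilon>: "0 < \<epsilon>"
  define M where "M = 2 powr (?d - \<alpha>) * unit_ball_vol ?d / (1 - 2 powr (- \<alpha>))"
  have "2 powr (- \<alpha>) < 1" using \<alpha> by (simp add: powr_less_one)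
  then have M: "0 \<le> M" unfolding M_def
    by (intro divide_nonneg_nonneg mult_nonneg_nonneg unit_ball_vol_nonneg) auto
  \<comment> \<open>Solves c * \<delta> powr \<alpha> * M \<le> \<epsilon> for \<delta>, with M + 1
    in place of \<open>M\<close> so that the division is legitimate.\<close>
  define e where "e = \<epsilon> / (c * (M + 1))"
  define \<delta> where "\<delta> = e powr (1 / \<alpha>)"
  have pos: "0 < e" unfolding e_def using c M \<epsilon> by (intro divide_pos_pos mult_pos_pos) auto
  have \<delta>: "0 < \<delta>" unfolding \<delta>_def using pos by simp
  have \<delta>\<alpha>: "\<delta> powr \<alpha> = e" unfolding \<delta>_def using pos \<alpha> by (simp add: powr_powr)
  define k' where "k' z = c * max (norm (z::'a)) \<delta> powr (\<alpha> - ?d)" for z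
  define L where "L = c * ((?d - \<alpha>) * \<delta> powr (- (?d - \<alpha>) - 1))"
  have lip: "\<bar>k' x - k' y\<bar> \<le> L * norm (x - y)" for x y
  proof -
    have "\<bar>max (norm x) \<delta> powr (- (?d - \<alpha>)) - max (norm y) \<delta> powr (- (?d - \<alpha>))\<bar>
        \<le> (?d - \<alpha>) * \<delta> powr (- (?d - \<alpha>) - 1) * \<bar>max (norm x) \<delta> - max (norm y) \<delta>\<bar>"
      using \<alpha> \<delta> by (intro powr_neg_lipschitz) auto
    also have "\<dots> \<le> (?d - \<alpha>) * \<delta> powr (- (?d - \<alpha>) - 1) * norm (x - y)"
    proof (rule mult_left_mono)
      have "\<bar>max (norm x) \<delta> - max (norm y) \<delta>\<bar> \<le> \<bar>norm x - norm y\<bar>" by (simp add: max_def)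
      also have "\<dots> \<le> norm (x - y)" by (rule norm_triangle_ineq3)
      finally show "\<bar>max (norm x) \<delta> - max (norm y) \<delta>\<bar> \<le> norm (x - y)" .
    qed (use \<alpha> in simp)
    finally have *: "c * \<bar>max (norm x) \<delta> powr (- (?d - \<alpha>)) - max (norm y) \<delta> powr (- (?d - \<alpha>))\<bar>
      \<le> c * ((?d - \<alpha>) * \<delta> powr (- (?d - \<alpha>) - 1) * norm (x - y))"
      using c by (intro mult_left_mono) auto
    have "\<bar>k' x - k' y\<bar> = c * \<bar>max (norm x) \<delta> powr (- (?d - \<alpha>)) - max (norm y) \<delta> powr (- (?d - \<alpha>))\<bar>"
      using c by (simp add: k'_def right_diff_distrib[symmetric] abs_mult)
    then show ?thesis using * by (simp add: L_def mult.assoc)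
  qed
  have bnd: "\<bar>k' x\<bar> \<le> c * \<delta> powr (\<alpha> - ?d)" for x
  proof -
    have "max (norm x) \<delta> powr (\<alpha> - ?d) \<le> \<delta> powr (\<alpha> - ?d)"
      using \<alpha> \<delta> by (intro powr_mono2') auto
    then show ?thesis using c by (simp add: k'_def abs_mult)
  qed
  have "(\<integral>\<^sup>+z. ennreal \<bar>c * norm z powr (\<alpha> - ?d) - k' z\<bar> \<partial>lborel)
      \<le> (\<integral>\<^sup>+z. ennreal c * (ennreal (norm (z::'a) powr (\<alpha> - ?d)) * indicator (ball 0 \<delta>) z) \<partial>lborel)"
  proof (rule nn_integral_mono_AE)
    \<comment> \<open>At the origin the estimate fails: there the power takes the value 0, while the
      truncated kernel is positive.\<close>
    have "AE z in lborel. z \<noteq> (0::'a)" by (rule AE_lborel_singleton)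
    then show "AE z in lborel. ennreal \<bar>c * norm z powr (\<alpha> - ?d) - k' z\<bar>
      \<le> ennreal c * (ennreal (norm (z::'a) powr (\<alpha> - ?d)) * indicator (ball 0 \<delta>) z)"
    proof eventually_elim
      case (elim z)
      show ?case
      proof (cases "norm z < \<delta>")
        case True
        have "\<delta> powr (\<alpha> - ?d) \<le> norm z powr (\<alpha> - ?d)"
          using \<alpha> True elim by (intro powr_mono2') auto
        then have "c * \<delta> powr (\<alpha> - ?d) \<le> c * norm z powr (\<alpha> - ?d)" using c by simp
        moreover have "0 \<le> c * \<delta> powr (\<alpha> - ?d)" using c by simp
        moreover have "k' z = c * \<delta> powr (\<alpha> - ?d)" using True by (simp add: k'_def max_def)
        ultimately have "\<bar>c * norm z powr (\<alpha> - ?d) - k' z\<bar> \<le> c * norm z powr (\<alpha> - ?d)" by linarith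
        then show ?thesis using True c by (simp add: ennreal_mult[symmetric] ennreal_leI)
      next
        case False
        then have "k' z = c * norm z powr (\<alpha> - ?d)" by (simp add: k'_def max_def)
        then show ?thesis by simp
      qed
    qed
  qed
  also have "\<dots> = ennreal c * (\<integral>\<^sup>+z. ennreal (norm (z::'a) powr (\<alpha> - ?d)) * indicator (ball 0 \<delta>) z \<partial>lborel)"
    by (rule nn_integral_cmult) (auto intro!: borel_measurable_times_ennreal borel_measurable_indicator)
  also have "\<dots> \<le> ennreal c * ennreal (\<delta> powr \<alpha> * M)"
    unfolding M_def by (intro mult_left_mono nn_integral_norm_powr_ball \<alpha> \<delta>) simp
  also have "\<dots> \<le> ennreal \<epsilon>"
  proof -
    have "c * (\<delta> powr \<alpha> * M) = \<epsilon> * (M / (M + 1))" unfolding \<delta>\<alpha> e_def using c by simp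
    also have "\<dots> \<le> \<epsilon> * 1" using \<epsilon> M by (intro mult_left_mono) auto
    finally have "c * (\<delta> powr \<alpha> * M) \<le> \<epsilon>" by simp
    then show ?thesis using c M by (simp add: ennreal_mult[symmetric] ennreal_leI)
  qed
  finally have "(\<integral>\<^sup>+z. ennreal \<bar>c * norm z powr (\<alpha> - ?d) - k' z\<bar> \<partial>lborel) \<le> ennreal \<epsilon>" .
  moreover have "k' (- x) = k' x" for x by (simp add: k'_def)
  ultimately show "\<exists>k' L C. (\<forall>x y. \<bar>k' x - k' y\<bar> \<le> L * norm (x - y)) \<and> (\<forall>x::'a. \<bar>k' x\<bar> \<le> C) \<and> (\<forall>x. k' (- x) = k' x) \<and>
      (\<integral>\<^sup>+z. ennreal \<bar>riesz_const DIM('a) \<alpha> * norm z powr (\<alpha> - ?d) - k' z\<bar> \<partial>lborel) \<le> ennreal \<epsilon>"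
    using lip bnd unfolding c_def by blast
qed (auto)

section \<open>Hyperplane reflections and two-point rearrangement\<close>

locale reflection =
  fixes n :: "'a::euclidean_space" and t :: real
  assumes n0: "n \<noteq> 0"
begin

definition refl :: "'a \<Rightarrow> 'a" where
  "refl x = x - (2 * (x \<bullet> n - t) / (n \<bullet> n)) *\<^sub>R n"

lemma refl_side: "refl x \<bullet> n - t = - (x \<bullet> n - t)"
  using n0 by (simp add: refl_def inner_diff_left)

lemma refl_refl [simp]: "refl (refl x) = x"
proof -
  have "refl (refl x) = refl x + (2 * (x \<bullet> n - t) / (n \<bullet> n)) *\<^sub>R n"
    unfolding refl_def[of "refl x"] refl_side
    by (simp only: mult_minus_right minus_divide_left[symmetric] scaleR_minus_left diff_minus_eq_add)
  then show ?thesis by (simp add: refl_def)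
qed

lemma refl_fixed: "x \<bullet> n = t \<Longrightarrow> refl x = x"
  by (simp add: refl_def)

text \<open>The source of the metric facts below: the sign of the product says whether two points
  lie on the same side and thereby which of the two distances is larger. The choice x = 0 gives the
  change of the norm.\<close>

lemma dist_refl_sq:
  "(norm (x - refl y))\<^sup>2 = (norm (x - y))\<^sup>2 + 4 * (x \<bullet> n - t) * (y \<bullet> n - t) / (n \<bullet> n)"
proof -
  define s where "s = 2 * (y \<bullet> n - t) / (n \<bullet> n)"
  have sn: "s * (n \<bullet> n) = 2 * (y \<bullet> n - t)" using n0 by (simp add: s_def)
  have "x - refl y = (x - y) + s *\<^sub>R n" by (simp add: refl_def s_def)
  then have "(norm (x - refl y))\<^sup>2 = (norm (x - y))\<^sup>2 + 2 * s * (x \<bullet> n - y \<bullet> n) + s * (s * (n \<bullet> n))"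
    by (simp only: power2_norm_eq_inner) (simp add: inner_add_left inner_add_right inner_diff_left inner_diff_right inner_commute algebra_simps)
  also have "\<dots> = (norm (x - y))\<^sup>2 + 2 * s * (x \<bullet> n - t)" unfolding sn by (simp add: algebra_simps)
  finally show ?thesis by (simp add: s_def) (simp add: algebra_simps)
qed

lemma dist_refl_cross:
  shows "(x \<bullet> n - t) * (y \<bullet> n - t) \<le> 0 \<Longrightarrow> norm (x - refl y) \<le> norm (x - y)"
    and "0 \<le> (x \<bullet> n - t) * (y \<bullet> n - t) \<Longrightarrow> norm (x - y) \<le> norm (x - refl y)"
proof -
  have eq: "(norm (x - refl y))\<^sup>2 = (norm (x - y))\<^sup>2 + (x \<bullet> n - t) * (y \<bullet> n - t) * (4 / (n \<bullet> n))"
    unfolding dist_refl_sq times_divide_eq_right by (simp only: ac_simps)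
  have nn: "0 \<le> 4 / (n \<bullet> n)" by simp
  show "norm (x - refl y) \<le> norm (x - y)" if "(x \<bullet> n - t) * (y \<bullet> n - t) \<le> 0"
  proof (rule power2_le_imp_le)
    show "(norm (x - refl y))\<^sup>2 \<le> (norm (x - y))\<^sup>2" using eq mult_nonpos_nonneg[OF that nn] by linarith
  qed simp
  show "norm (x - y) \<le> norm (x - refl y)" if "0 \<le> (x \<bullet> n - t) * (y \<bullet> n - t)"
  proof (rule power2_le_imp_le)
    show "(norm (x - y))\<^sup>2 \<le> (norm (x - refl y))\<^sup>2" using eq mult_nonneg_nonneg[OF that nn] by linarith
  qed simp
qed

lemma dist_refl_refl: "norm (refl x - refl y) = norm (x - y)"
proof -
  have "(norm (refl x - refl y))\<^sup>2 = (norm (x - y))\<^sup>2"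
    using dist_refl_sq[of "refl x" y] dist_refl_sq[of y x] refl_side[of x]
    by (simp add: norm_minus_commute algebra_simps add_divide_distrib[symmetric] diff_divide_distrib[symmetric])
  then show ?thesis by simp
qed

lemma dist_refl_swap: "norm (refl x - y) = norm (x - refl y)"
  using dist_refl_refl[of x "refl y"] by simp

lemma norm_refl_sq: "(norm (refl x))\<^sup>2 = (norm x)\<^sup>2 - 4 * t * (x \<bullet> n - t) / (n \<bullet> n)"
  using dist_refl_sq[of 0 x] by simp

lemma continuous_on_refl: "continuous_on UNIV refl"
  unfolding refl_def using n0 by (intro continuous_intros) auto

lemma refl_borel [measurable]: "refl \<in> borel_measurable borel"
  by (rule borel_measurable_continuous_onI[OF continuous_on_refl])

end

text \<open>Uniqueness of translation invariant measures in the form needed here: compute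
  \<open>\<integral>\<integral> B (T y) F (x + T y) dx dy\<close> in both orders, \<open>B\<close> being the indicator of the unit ball.\<close>

lemma nn_integral_lborel_linear_involution:
  fixes T :: "'a::euclidean_space \<Rightarrow> 'a" and F :: "'a \<Rightarrow> ennreal"
  assumes [measurable]: "T \<in> borel_measurable borel" "F \<in> borel_measurable borel"
    and T: "\<And>x y. T (x - T y) = T x - y" "\<And>x. norm (T x) = norm x"
  shows "(\<integral>\<^sup>+x. F (T x) \<partial>lborel) = (\<integral>\<^sup>+x. F x \<partial>lborel)"
proof -
  define B :: "'a \<Rightarrow> ennreal" where "B = indicator (ball 0 1)"
  have [measurable]: "B \<in> borel_measurable borel" unfolding B_def by (rule borel_measurable_indicator) simp
  define b where "b = (\<integral>\<^sup>+x. B x \<partial>lborel)"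
  have BT: "B (T x) = B x" for x by (simp add: B_def indicator_def T(2))
  have b_eq: "b = emeasure lborel (ball (0::'a) 1)" by (simp add: b_def B_def)
  have "emeasure lborel (ball (0::'a) 1) = ennreal (unit_ball_vol (real DIM('a)) * 1 ^ DIM('a))"
    by (rule emeasure_ball) simp
  then have b: "b \<noteq> 0" "b \<noteq> \<infinity>" unfolding b_eq using unit_ball_vol_pos[of "real DIM('a)"] by (simp_all add: less_imp_neq[THEN not_sym])
  have "b * (\<integral>\<^sup>+x. F x \<partial>lborel) = (\<integral>\<^sup>+y. B (T y) * (\<integral>\<^sup>+x. F x \<partial>lborel) \<partial>lborel)"
    unfolding BT b_def by (rule nn_integral_multc[symmetric]) measurable
  also have "\<dots> = (\<integral>\<^sup>+y. (\<integral>\<^sup>+x. B (T y) * F (x - (- T y)) \<partial>lborel) \<partial>lborel)"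
    by (intro nn_integral_cong, subst nn_integral_cmult) (measurable, simp only: nn_integral_lborel_translate[OF assms(2)])
  also have "\<dots> = (\<integral>\<^sup>+x. (\<integral>\<^sup>+y. B (T y) * F (x - (- T y)) \<partial>lborel) \<partial>lborel)"
    by (rule lborel_pair.Fubini') measurable
  also have "\<dots> = (\<integral>\<^sup>+x. (\<integral>\<^sup>+y. B (T y - x) * F (T y) \<partial>lborel) \<partial>lborel)"
  proof (rule nn_integral_cong)
    \<comment> \<open>Shifting \<open>y\<close> by \<open>T x\<close> turns \<open>T y\<close> into
      \<open>T y - x\<close> and \<open>x + T y\<close> into \<open>T y\<close>, by the linearity
      and involution hypothesis \<open>T(1)\<close>.\<close>
    fix x :: 'a
    have "(\<integral>\<^sup>+y. B (T (y - T x)) * F (x - (- T (y - T x))) \<partial>lborel) = (\<integral>\<^sup>+y. B (T y) * F (x - (- T y)) \<partial>lborel)"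
      by (rule nn_integral_lborel_translate[of "\<lambda>y. B (T y) * F (x - (- T y))"]) measurable
    then show "(\<integral>\<^sup>+y. B (T y) * F (x - (- T y)) \<partial>lborel) = (\<integral>\<^sup>+y. B (T y - x) * F (T y) \<partial>lborel)"
      by (simp add: T(1))
  qed
  also have "\<dots> = (\<integral>\<^sup>+y. (\<integral>\<^sup>+x. B (T y - x) * F (T y) \<partial>lborel) \<partial>lborel)"
    by (rule lborel_pair.Fubini') measurable
  also have "\<dots> = (\<integral>\<^sup>+y. b * F (T y) \<partial>lborel)"
    by (intro nn_integral_cong) (simp add: nn_integral_multc nn_integral_lborel_reflect[of B] b_def)
  also have "\<dots> = b * (\<integral>\<^sup>+y. F (T y) \<partial>lborel)" by (rule nn_integral_cmult) measurable
  finally show ?thesis using b by (simp add: ennreal_mult_cancel_left)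
qed

context reflection
begin

text \<open>A reflection in an affine hyperplane is the one in the parallel hyperplane through the
  origin followed by a translation; each of them preserves the integral.\<close>

lemma nn_integral_refl:
  fixes F :: "'a \<Rightarrow> ennreal"
  assumes [measurable]: "F \<in> borel_measurable borel"
  shows "(\<integral>\<^sup>+x. F (refl x) \<partial>lborel) = (\<integral>\<^sup>+x. F x \<partial>lborel)"
proof -
  interpret T: reflection n 0 using n0 by unfold_locales
  define w where "w = (2 * t / (n \<bullet> n)) *\<^sub>R n"
  have split: "refl x = T.refl x - (- w)" for x
    by (simp add: refl_def T.refl_def w_def right_diff_distrib diff_divide_distrib scaleR_diff_left)
  have lin: "T.refl (x - T.refl y) = T.refl x - y" for x y
  proof -
    have "T.refl (x - T.refl y) = T.refl x - T.refl (T.refl y)"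
      unfolding T.refl_def[of "x - T.refl y"] T.refl_def[of x] T.refl_def[of "T.refl y"]
      by (simp add: inner_diff_left right_diff_distrib diff_divide_distrib scaleR_diff_left)
    then show ?thesis by simp
  qed
  have "norm (T.refl x) = norm x" for x
    using T.norm_refl_sq[of x] by simp
  then have "(\<integral>\<^sup>+x. F (T.refl x - (- w)) \<partial>lborel) = (\<integral>\<^sup>+x. F (x - (- w)) \<partial>lborel)"
    by (intro nn_integral_lborel_linear_involution[where F = "\<lambda>x. F (x - (- w))"] lin) measurable
  then show ?thesis
    unfolding split by (simp only: nn_integral_lborel_translate[OF assms])
qed

text \<open>Folds an integral so that a point and its mirror image appear together; claims about
  polarization then reduce to claims about pairs of values.\<close>

lemma nn_integral_refl_sum:
  fixes F :: "'a \<Rightarrow> ennreal"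
  assumes [measurable]: "F \<in> borel_measurable borel"
  shows "2 * (\<integral>\<^sup>+x. F x \<partial>lborel) = (\<integral>\<^sup>+x. F x + F (refl x) \<partial>lborel)"
  by (simp add: nn_integral_add nn_integral_refl mult_2)

text \<open>In the application \<open>t\<close> is positive, so the half space x \<bullet> n \<le> t
  that receives the larger values is the one containing the origin.\<close>

definition polarize :: "('a \<Rightarrow> real) \<Rightarrow> 'a \<Rightarrow> real" where
  "polarize g x = (if x \<bullet> n \<le> t then max (g x) (g (refl x)) else min (g x) (g (refl x)))"

lemma polarize_cases:
  "(polarize g x = g x \<and> polarize g (refl x) = g (refl x)) \<or>
   (polarize g x = g (refl x) \<and> polarize g (refl x) = g x)"
proof (cases "x \<bullet> n = t")
  case True
  then show ?thesis by (simp add: refl_fixed polarize_def)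
next
  case False
  then have "refl x \<bullet> n \<le> t \<longleftrightarrow> \<not> x \<bullet> n \<le> t" using refl_side[of x] by linarith
  then show ?thesis by (auto simp: polarize_def max_def min_def)
qed

lemma polarize_sum:
  fixes \<phi> :: "real \<Rightarrow> 'b::ab_semigroup_add"
  shows "\<phi> (polarize g x) + \<phi> (polarize g (refl x)) = \<phi> (g x) + \<phi> (g (refl x))"
  using polarize_cases[of g x] by (auto simp: add.commute)

lemma polarize_values:
  "polarize g x = (if x \<bullet> n - t \<le> 0 then max (g x) (g (refl x)) else min (g x) (g (refl x)))"
  "polarize g (refl x) = (if x \<bullet> n - t \<le> 0 then min (g x) (g (refl x)) else max (g x) (g (refl x)))"
proof -
  show 1: "polarize g x = (if x \<bullet> n - t \<le> 0 then max (g x) (g (refl x)) else min (g x) (g (refl x)))"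
    by (simp add: polarize_def)
  show "polarize g (refl x) = (if x \<bullet> n - t \<le> 0 then min (g x) (g (refl x)) else max (g x) (g (refl x)))"
    using polarize_sum[of "\<lambda>s. s" g x] unfolding 1 by (simp add: max_def min_def split: if_splits)
qed

lemma polarize_borel:
  assumes [measurable]: "g \<in> borel_measurable borel"
  shows "polarize g \<in> borel_measurable borel"
  unfolding polarize_def by measurable

text \<open>Equimeasurability. With the square it preserves the L2 norm, with the indicator of
  {0<..} the measure of the support.\<close>

lemma nn_integral_polarize:
  fixes \<phi> :: "real \<Rightarrow> ennreal"
  assumes [measurable]: "g \<in> borel_measurable borel" "\<phi> \<in> borel_measurable borel"
  shows "(\<integral>\<^sup>+x. \<phi> (polarize g x) \<partial>lborel) = (\<integral>\<^sup>+x. \<phi> (g x) \<partial>lborel)"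
proof -
  note [measurable] = polarize_borel[OF assms(1)]
  have "2 * (\<integral>\<^sup>+x. \<phi> (polarize g x) \<partial>lborel) = (\<integral>\<^sup>+x. \<phi> (polarize g x) + \<phi> (polarize g (refl x)) \<partial>lborel)"
    by (rule nn_integral_refl_sum) measurable
  also have "\<dots> = (\<integral>\<^sup>+x. \<phi> (g x) + \<phi> (g (refl x)) \<partial>lborel)"
    by (simp only: polarize_sum)
  also have "\<dots> = 2 * (\<integral>\<^sup>+x. \<phi> (g x) \<partial>lborel)"
    by (rule nn_integral_refl_sum[symmetric]) measurable
  finally show ?thesis by (simp add: ennreal_mult_cancel_left)
qed

text \<open>On the same side, maxima are compared with maxima and minima with minima. On opposite
  sides the maximum at one point meets the minimum at the other; the cross comparisons needed there
  hold because reflecting one of the points brings it closer to the other.\<close>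

lemma polarize_lipschitz:
  assumes "\<And>x y. \<bar>g x - g y\<bar> \<le> L * norm (x - y)" "0 \<le> L"
  shows "\<bar>polarize g x - polarize g y\<bar> \<le> L * norm (x - y)"
proof -
  have 1: "\<bar>g x - g y\<bar> \<le> L * norm (x - y)" by (rule assms)
  have 2: "\<bar>g (refl x) - g (refl y)\<bar> \<le> L * norm (x - y)"
    using assms(1)[of "refl x" "refl y"] by (simp add: dist_refl_refl)
  have cross: "\<bar>g x - g (refl y)\<bar> \<le> L * norm (x - y) \<and> \<bar>g (refl x) - g y\<bar> \<le> L * norm (x - y)"
    if "(x \<bullet> n - t) * (y \<bullet> n - t) \<le> 0"
  proof -
    have "norm (x - refl y) \<le> norm (x - y)" using that by (rule dist_refl_cross)
    then have "L * norm (x - refl y) \<le> L * norm (x - y)" using assms(2) by (rule mult_left_mono)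
    then show ?thesis
      using assms(1)[of x "refl y"] assms(1)[of "refl x" y] by (simp add: dist_refl_swap)
  qed
  show ?thesis
  proof (cases "x \<bullet> n \<le> t \<longleftrightarrow> y \<bullet> n \<le> t")
    case True
    then show ?thesis using 1 2 by (auto simp: polarize_def max_def min_def)
  next
    case False
    then have "(x \<bullet> n - t) * (y \<bullet> n - t) \<le> 0" by (auto simp: mult_le_0_iff)
    from cross[OF this] False 1 2 show ?thesis by (auto simp: polarize_def max_def min_def)
  qed
qed

end

section \<open>The energy under polarization\<close>

definition (in potential_kernel) energy :: "('a \<Rightarrow> real) \<Rightarrow> ennreal" where
  "energy f = (\<integral>\<^sup>+x. (\<integral>\<^sup>+y. ennreal (f x * f y * k (x - y)) \<partial>lborel) \<partial>lborel)"

text \<open>The four products always add up to (A + a) * (B + b). Sorting both pairs moves weight to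
  the products that carry the larger factor \<open>k1\<close>.\<close>

lemma rearrange_two_by_two:
  fixes A a B b k1 k2 :: real
  assumes "k2 \<le> k1"
  shows "(A * B + a * b) * k1 + (A * b + a * B) * k2
    \<le> (max A a * max B b + min A a * min B b) * k1 + (max A a * min B b + min A a * max B b) * k2"
proof -
  have le: "A * B + a * b \<le> max A a * max B b + min A a * min B b"
  proof -
    have "0 \<le> (A - a) * (b - B)" if "A \<ge> a" "b \<ge> B" using that by simp
    moreover have "0 \<le> (a - A) * (B - b)" if "a \<ge> A" "B \<ge> b" using that by simp
    ultimately show ?thesis by (auto simp: max_def min_def algebra_simps)
  qed
  have "A * B + a * b + (A * b + a * B) = (A + a) * (B + b)" by (simp add: algebra_simps)
  also have "\<dots> = (max A a + min A a) * (max B b + min B b)" by (simp add: max_def min_def add.commute)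
  also have "\<dots> = (max A a * max B b + min A a * min B b) + (max A a * min B b + min A a * max B b)"
    by (simp add: algebra_simps)
  finally have tot: "A * b + a * B = (max A a * max B b + min A a * min B b) + (max A a * min B b + min A a * max B b) - (A * B + a * b)"
    by simp
  have "(max A a * max B b + min A a * min B b - (A * B + a * b)) * (k1 - k2) \<ge> 0"
    using le assms by simp
  then show ?thesis unfolding tot by (simp add: algebra_simps)
qed

locale polarized_kernel = potential_kernel k h + reflection n t
  for k :: "'a::euclidean_space \<Rightarrow> real" and h and n :: 'a and t
begin

text \<open>Folding in both variables collects the four combinations of \<open>x\<close>,
  \<open>y\<close> and their mirror images. As the kernel depends on distances only, just two kernel
  values remain.\<close>

lemma energy_symmetrize:
  assumes [measurable]: "f \<in> borel_measurable borel" and f: "\<And>x. 0 \<le> f x"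
  shows "4 * energy f = (\<integral>\<^sup>+x. (\<integral>\<^sup>+y. ennreal ((f x * f y + f (refl x) * f (refl y)) * k (x - y)
      + (f x * f (refl y) + f (refl x) * f y) * k (x - refl y)) \<partial>lborel) \<partial>lborel)"
proof -
  define e where "e x y = ennreal (f x * f y * k (x - y))" for x y
  have [measurable]: "(\<lambda>p. e (fst p) (snd p)) \<in> borel_measurable (borel \<Otimes>\<^sub>M borel)"
    unfolding e_def by measurable
  have e1: "energy f = (\<integral>\<^sup>+x. (\<integral>\<^sup>+y. e x y \<partial>lborel) \<partial>lborel)" by (simp add: energy_def e_def)
  have inner: "2 * (\<integral>\<^sup>+y. e x y \<partial>lborel) = (\<integral>\<^sup>+y. e x y + e x (refl y) \<partial>lborel)" for x
    by (rule nn_integral_refl_sum) (simp add: e_def)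
  have "4 * energy f = 2 * (\<integral>\<^sup>+x. 2 * (\<integral>\<^sup>+y. e x y \<partial>lborel) \<partial>lborel)"
    unfolding e1 by (subst nn_integral_cmult) (auto simp: e_def mult.assoc[symmetric])
  also have "\<dots> = 2 * (\<integral>\<^sup>+x. (\<integral>\<^sup>+y. e x y + e x (refl y) \<partial>lborel) \<partial>lborel)"
    by (simp only: inner)
  also have "\<dots> = (\<integral>\<^sup>+x. (\<integral>\<^sup>+y. e x y + e x (refl y) \<partial>lborel) + (\<integral>\<^sup>+y. e (refl x) y + e (refl x) (refl y) \<partial>lborel) \<partial>lborel)"
    by (rule nn_integral_refl_sum) (simp add: e_def)
  also have "\<dots> = (\<integral>\<^sup>+x. (\<integral>\<^sup>+y. (e x y + e x (refl y)) + (e (refl x) y + e (refl x) (refl y)) \<partial>lborel) \<partial>lborel)"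
    by (intro nn_integral_cong nn_integral_add[symmetric]) (simp_all add: e_def)
  also have "\<dots> = (\<integral>\<^sup>+x. (\<integral>\<^sup>+y. ennreal ((f x * f y + f (refl x) * f (refl y)) * k (x - y)
      + (f x * f (refl y) + f (refl x) * f y) * k (x - refl y)) \<partial>lborel) \<partial>lborel)"
  proof (intro nn_integral_cong)
    fix x y
    have k: "k (refl x - refl y) = k (x - y)" "k (refl x - y) = k (x - refl y)"
      by (simp_all add: k_eq dist_refl_refl dist_refl_swap)
    show "(e x y + e x (refl y)) + (e (refl x) y + e (refl x) (refl y)) = ennreal ((f x * f y + f (refl x) * f (refl y)) * k (x - y)
      + (f x * f (refl y) + f (refl x) * f y) * k (x - refl y))"
      unfolding e_def k using f k_nonneg
      by (simp add: ennreal_plus[symmetric] algebra_simps del: ennreal_plus)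
  qed
  finally show ?thesis .
qed

text \<open>After folding, the integrands compare pointwise: polarization sorts the values at the
  four points, and the larger kernel value belongs to points on the same side.\<close>

lemma energy_polarize:
  assumes [measurable]: "f \<in> borel_measurable borel" and f: "\<And>x. 0 \<le> f x"
  shows "energy f \<le> energy (polarize f)"
proof -
  have f': "0 \<le> polarize f x" for x using f by (simp add: polarize_def max_def min_def)
  have "4 * energy f \<le> 4 * energy (polarize f)"
    unfolding energy_symmetrize[OF assms] energy_symmetrize[OF polarize_borel[OF assms(1)] f']
  proof (rule nn_integral_mono, rule nn_integral_mono_AE)
    fix x
    \<comment> \<open>Monotonicity of \<open>h\<close> is available for positive distances only, so
      coincidences of \<open>y\<close> with \<open>x\<close> or its mirror image are
      excluded.\<close>
    have "AE y in lborel. y \<noteq> x" "AE y in lborel. y \<noteq> refl x" by (rule AE_lborel_singleton)+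
    then show "AE y in lborel. ennreal ((f x * f y + f (refl x) * f (refl y)) * k (x - y)
        + (f x * f (refl y) + f (refl x) * f y) * k (x - refl y))
      \<le> ennreal ((polarize f x * polarize f y + polarize f (refl x) * polarize f (refl y)) * k (x - y)
        + (polarize f x * polarize f (refl y) + polarize f (refl x) * polarize f y) * k (x - refl y))"
    proof eventually_elim
      case (elim y)
      define u v where "u = x \<bullet> n - t" and "v = y \<bullet> n - t"
      have pos: "0 < norm (x - y)" "0 < norm (x - refl y)" using elim by auto
      have k12: "k (x - refl y) \<le> k (x - y)" if "0 \<le> u * v"
        unfolding k_eq using that pos by (intro h_antimono dist_refl_cross) (auto simp: u_def v_def)
      have k21: "k (x - y) \<le> k (x - refl y)" if "u * v \<le> 0"
        unfolding k_eq using that pos by (intro h_antimono dist_refl_cross) (auto simp: u_def v_def)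
      note px = polarize_values[of f x, folded u_def] and py = polarize_values[of f y, folded v_def]
      show ?case
      proof (rule ennreal_leI)
        consider "u \<le> 0" "v \<le> 0" | "\<not> u \<le> 0" "\<not> v \<le> 0" | "u \<le> 0" "\<not> v \<le> 0" | "\<not> u \<le> 0" "v \<le> 0" by blast
        then show "(f x * f y + f (refl x) * f (refl y)) * k (x - y)
            + (f x * f (refl y) + f (refl x) * f y) * k (x - refl y)
          \<le> (polarize f x * polarize f y + polarize f (refl x) * polarize f (refl y)) * k (x - y)
            + (polarize f x * polarize f (refl y) + polarize f (refl x) * polarize f y) * k (x - refl y)"
        proof cases
          case 1
          then have "0 \<le> u * v" by (simp add: mult_nonpos_nonpos)
          from rearrange_two_by_two[OF k12[OF this], of "f x" "f y" "f (refl x)" "f (refl y)"] 1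
          show ?thesis unfolding px py by simp
        next
          case 2
          then have "0 \<le> u * v" by simp
          from rearrange_two_by_two[OF k12[OF this], of "f x" "f y" "f (refl x)" "f (refl y)"] 2
          show ?thesis unfolding px py by (simp add: algebra_simps)
        next
          \<comment> \<open>For points on opposite sides \<open>y\<close> and its mirror image
            exchange roles: now k (x - refl y) is the larger kernel value.\<close>
          case 3
          then have "u * v \<le> 0" by (simp add: mult_nonpos_nonneg)
          from rearrange_two_by_two[OF k21[OF this], of "f x" "f (refl y)" "f (refl x)" "f y"] 3
          show ?thesis unfolding px py by (simp add: algebra_simps max.commute min.commute)
        next
          case 4
          then have "u * v \<le> 0" by (simp add: mult_nonneg_nonpos)
          from rearrange_two_by_two[OF k21[OF this], of "f x" "f (refl y)" "f (refl x)" "f y"] 4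
          show ?thesis unfolding px py by (simp add: algebra_simps max.commute min.commute)
        qed
      qed
    qed
  qed
  then show ?thesis by (simp add: ennreal_mult_le_mult_iff)
qed

end

section \<open>Radially decreasing rearrangement\<close>

text \<open>All three constants are fixed: the class is closed under pointwise limits and
  sequentially compact, and polarization in a hyperplane with \<open>t\<close> positive stays inside
  it.\<close>

definition lip_class :: "real \<Rightarrow> real \<Rightarrow> real \<Rightarrow> ('a::euclidean_space \<Rightarrow> real) \<Rightarrow> bool" where
  "lip_class L B R g \<longleftrightarrow> (\<forall>x y. \<bar>g x - g y\<bar> \<le> L * norm (x - y)) \<and> (\<forall>x. 0 \<le> g x \<and> g x \<le> B) \<and>
     (\<forall>x. R < norm x \<longrightarrow> g x = 0)"

lemma lip_classD:
  assumes "lip_class L B R g"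
  shows "\<bar>g x - g y\<bar> \<le> L * norm (x - y)" "0 \<le> g x" "g x \<le> B" "R < norm x \<Longrightarrow> g x = 0"
  using assms by (auto simp: lip_class_def)

lemma lip_class_continuous:
  fixes g :: "'a::euclidean_space \<Rightarrow> real"
  assumes "lip_class L B R g"
  shows "continuous_on UNIV g" "g \<in> borel_measurable borel"
  by (rule continuous_borel_of_lipschitz[OF lip_classD(1)[OF assms]])+

lemma lip_class_limit:
  assumes g: "\<And>i::nat. lip_class L B R (g i)" and lim: "\<And>x. (\<lambda>i. g i x) \<longlonglongrightarrow> g' x"
  shows "lip_class L B R g'"
  unfolding lip_class_def
proof (intro conjI allI impI)
  fix x y
  have "(\<lambda>i. \<bar>g i x - g i y\<bar>) \<longlonglongrightarrow> \<bar>g' x - g' y\<bar>" by (intro tendsto_intros lim)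
  then show "\<bar>g' x - g' y\<bar> \<le> L * norm (x - y)"
    by (rule LIMSEQ_le_const2) (use lip_classD(1)[OF g] in blast)
  show "0 \<le> g' x" by (rule LIMSEQ_le_const[OF lim]) (use lip_classD(2)[OF g] in blast)
  show "g' x \<le> B" by (rule LIMSEQ_le_const2[OF lim]) (use lip_classD(3)[OF g] in blast)
  assume "R < norm x"
  then have "(\<lambda>i. g i x) = (\<lambda>i. 0)" using lip_classD(4)[OF g] by auto
  then show "g' x = 0" using lim[of x] LIMSEQ_unique[OF _ tendsto_const] by fastforce
qed

text \<open>Arzela-Ascoli on the ball of radius \<open>R\<close>; outside of it all members
  vanish.\<close>

lemma lip_class_subseq:
  fixes g :: "nat \<Rightarrow> 'a::euclidean_space \<Rightarrow> real"
  assumes g: "\<And>i. lip_class L B R (g i)" and "0 \<le> L"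
  obtains r g' where "strict_mono r" "\<And>x. (\<lambda>i. g (r i) x) \<longlonglongrightarrow> g' x"
proof -
  have bnd: "norm (g i x) \<le> B" for i x using lip_classD(2,3)[OF g, of i x] by simp
  have equi: "\<exists>d. 0 < d \<and> (\<forall>i y. y \<in> cball 0 R \<and> norm (x - y) < d \<longrightarrow> norm (g i x - g i y) < e)"
    if "0 < e" for x e
  proof (intro exI[of _ "e / (L + 1)"] conjI allI impI)
    show pos: "0 < e / (L + 1)" using that \<open>0 \<le> L\<close> by simp
    fix i y assume y: "y \<in> cball 0 R \<and> norm (x - y) < e / (L + 1)"
    have "norm (g i x - g i y) \<le> L * norm (x - y)" using lip_classD(1)[OF g] by simp
    also have "\<dots> \<le> L * (e / (L + 1))" using y \<open>0 \<le> L\<close> by (intro mult_left_mono) auto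
    also have "\<dots> < (L + 1) * (e / (L + 1))" using pos by (intro mult_strict_right_mono) auto
    also have "\<dots> = e" using \<open>0 \<le> L\<close> by simp
    finally show "norm (g i x - g i y) < e" .
  qed
  obtain g0 r where r: "strict_mono (r :: nat \<Rightarrow> nat)"
    and conv: "\<And>e. 0 < e \<Longrightarrow> \<exists>N. \<forall>n x. n \<ge> N \<and> x \<in> cball 0 R \<longrightarrow> norm (g (r n) x - g0 x) < e"
    using Arzela_Ascoli[OF compact_cball[of 0 R], of g B] bnd equi by metis
  define g' where "g' x = (if norm x \<le> R then g0 x else 0)" for x
  have "(\<lambda>i. g (r i) x) \<longlonglongrightarrow> g' x" for x
  proof (cases "norm x \<le> R")
    case True
    show ?thesis
    proof (rule LIMSEQ_I)
      fix e :: real assume "0 < e"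
      with conv[of e] True show "\<exists>N. \<forall>n\<ge>N. norm (g (r n) x - g' x) < e" by (auto simp: g'_def)
    qed
  next
    case False
    then have "(\<lambda>i. g (r i) x) = (\<lambda>i. 0)" using lip_classD(4)[OF g] by auto
    then show ?thesis using False by (simp add: g'_def)
  qed
  with r show ?thesis by (rule that)
qed

lemma emeasure_cball_finite: "emeasure lborel (cball (x::'a::euclidean_space) r) < \<infinity>"
  by (rule emeasure_bounded_finite) simp

text \<open>Dominated by a constant on the ball of radius \<open>R\<close>. The integrand may depend
  on the point so that the second moment is covered along with the square.\<close>

lemma lip_class_integral_limit:
  fixes g :: "nat \<Rightarrow> 'a::euclidean_space \<Rightarrow> real" and \<phi> :: "real \<Rightarrow> 'a \<Rightarrow> ennreal"
  assumes g: "\<And>i. lip_class L B R (g i)" and lim: "\<And>x. (\<lambda>i. g i x) \<longlonglongrightarrow> g' x"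
    and [measurable]: "(\<lambda>p. \<phi> (fst p) (snd p)) \<in> borel_measurable (borel \<Otimes>\<^sub>M borel)"
    and cont: "\<And>x s u. (s \<longlongrightarrow> u) sequentially \<Longrightarrow> (\<lambda>i. \<phi> (s i) x) \<longlonglongrightarrow> \<phi> u x"
    and bnd: "\<And>s x. 0 \<le> s \<Longrightarrow> s \<le> B \<Longrightarrow> norm x \<le> R \<Longrightarrow> \<phi> s x \<le> ennreal c" and zero: "\<And>x. \<phi> 0 x = 0"
  shows "(\<lambda>i. \<integral>\<^sup>+x. \<phi> (g i x) x \<partial>lborel) \<longlonglongrightarrow> (\<integral>\<^sup>+x. \<phi> (g' x) x \<partial>lborel)"
proof (rule nn_integral_dominated_convergence[where w = "\<lambda>x. ennreal c * indicator (cball 0 R) x"])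
  have [measurable]: "g i \<in> borel_measurable borel" for i by (rule lip_class_continuous(2)[OF g])
  have [measurable]: "g' \<in> borel_measurable borel"
    by (rule lip_class_continuous(2)[OF lip_class_limit[OF g lim]])
  have pair: "(\<lambda>x. \<phi> (f x) x) \<in> borel_measurable borel" if [measurable]: "f \<in> borel_measurable borel" for f
  proof -
    have "(\<lambda>x. (f x, x)) \<in> borel \<rightarrow>\<^sub>M borel \<Otimes>\<^sub>M borel" by measurable
    from measurable_compose[OF this assms(3)] show ?thesis by simp
  qed
  show "(\<lambda>x. \<phi> (g i x) x) \<in> borel_measurable lborel" for i using pair by simp
  show "(\<lambda>x. \<phi> (g' x) x) \<in> borel_measurable lborel" using pair by simp
  show "(\<lambda>x. ennreal c * indicator (cball (0::'a) R) x) \<in> borel_measurable lborel"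
    by (intro borel_measurable_times_ennreal borel_measurable_indicator) simp_all
  show "AE x in lborel. \<phi> (g j x) x \<le> ennreal c * indicator (cball 0 R) x" for j
  proof (rule AE_I2)
    fix x :: 'a
    show "\<phi> (g j x) x \<le> ennreal c * indicator (cball 0 R) x"
      using bnd[of "g j x" x] lip_classD[OF g, where i1 = j and x = x] zero
      by (cases "norm x \<le> R") auto
  qed
  show "(\<integral>\<^sup>+x. ennreal c * indicator (cball (0::'a) R) x \<partial>lborel) < \<infinity>"
    using emeasure_cball_finite[of "0::'a" R]
    by (subst nn_integral_cmult_indicator) (auto simp: ennreal_mult_less_top)
  show "AE x in lborel. (\<lambda>i. \<phi> (g i x) x) \<longlonglongrightarrow> \<phi> (g' x) x"
    using cont[OF lim] by simp
qed

text \<open>Turns a vanishing integral into information at one prescribed point; this is where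
  continuity of the minimizer pays off.\<close>

lemma continuous_nonneg_integral_zero:
  fixes D :: "'a::euclidean_space \<Rightarrow> real"
  assumes "continuous_on UNIV D" "\<And>x. 0 \<le> D x" "(\<integral>\<^sup>+x. ennreal (D x) \<partial>lborel) = 0"
  shows "D x = 0"
proof (rule ccontr)
  assume "D x \<noteq> 0"
  then have "0 < D x" using assms(2)[of x] by simp
  define U where "U = D -` {0<..}"
  have U: "open U" "x \<in> U" unfolding U_def using assms(1) \<open>0 < D x\<close>
    by (auto simp: continuous_on_open_vimage)
  have [measurable]: "D \<in> borel_measurable borel" using assms(1) by (rule borel_measurable_continuous_onI)
  have "AE x in lborel. ennreal (D x) = 0"
    using assms(3) by (subst (asm) nn_integral_0_iff_AE) auto
  then have "AE x in lborel. x \<notin> U" by eventually_elim (simp add: U_def ennreal_eq_0_iff)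
  then have 0: "emeasure lborel U = 0" using U(1) by (simp add: AE_iff_null_sets null_setsD1)
  obtain e where e: "0 < e" "ball x e \<subseteq> U" using U open_contains_ball by blast
  have "emeasure lborel (ball x e) \<le> emeasure lborel U" using e U(1) by (intro emeasure_mono) auto
  moreover have "emeasure lborel (ball x e) \<noteq> 0"
    using e(1) unit_ball_vol_pos[of "real DIM('a)"]
    by (simp add: emeasure_ball ennreal_eq_0_iff not_le)
  ultimately show False using 0 by simp
qed

context potential_kernel
begin

text \<open>By 2 * f x * f y \<le> (f x)^2 + (f y)^2, and each of the two squares integrates to at
  most \<open>C\<close> times the square integral. It shows that a finite \<Lambda> exists.\<close>

lemma energy_le:
  assumes S: "schur_bound k W C" and [measurable]: "f \<in> borel_measurable borel"
    and f: "\<And>x. 0 \<le> f x" "\<And>x. x \<notin> W \<Longrightarrow> f x = 0"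
  shows "energy f \<le> ennreal C * (\<integral>\<^sup>+x. ennreal ((f x)\<^sup>2) \<partial>lborel)"
proof -
  note [measurable] = schur_boundD(2)[OF S]
  define e where "e x y = indicator W x * ennreal ((f x)\<^sup>2) * (ennreal \<bar>k (x - y)\<bar> * indicator W y)" for x y
  have e_int: "(\<integral>\<^sup>+x. (\<integral>\<^sup>+y. e x y \<partial>lborel) \<partial>lborel) \<le> ennreal C * (\<integral>\<^sup>+x. ennreal ((f x)\<^sup>2) \<partial>lborel)"
  proof -
    have "(\<integral>\<^sup>+x. (\<integral>\<^sup>+y. e x y \<partial>lborel) \<partial>lborel)
      = (\<integral>\<^sup>+x. indicator W x * ennreal ((f x)\<^sup>2) * (\<integral>\<^sup>+y. ennreal \<bar>k (x - y)\<bar> * indicator W y \<partial>lborel) \<partial>lborel)"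
      unfolding e_def by (intro nn_integral_cong nn_integral_cmult) measurable
    also have "\<dots> \<le> (\<integral>\<^sup>+x. 1 * ennreal ((f x)\<^sup>2) * ennreal C \<partial>lborel)"
      by (intro nn_integral_mono mult_mono schur_boundD(5)[OF S]) (auto split: split_indicator)
    also have "\<dots> = ennreal C * (\<integral>\<^sup>+x. ennreal ((f x)\<^sup>2) \<partial>lborel)"
      by (subst nn_integral_cmult[symmetric]) (auto simp: mult.commute)
    finally show ?thesis .
  qed
  have e_sym: "(\<integral>\<^sup>+x. (\<integral>\<^sup>+y. e y x \<partial>lborel) \<partial>lborel) = (\<integral>\<^sup>+x. (\<integral>\<^sup>+y. e x y \<partial>lborel) \<partial>lborel)"
    unfolding e_def by (rule lborel_pair.Fubini') measurable
  have "2 * energy f = (\<integral>\<^sup>+x. (\<integral>\<^sup>+y. 2 * ennreal (f x * f y * k (x - y)) \<partial>lborel) \<partial>lborel)"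
    unfolding energy_def by (simp add: nn_integral_cmult)
  also have "\<dots> \<le> (\<integral>\<^sup>+x. (\<integral>\<^sup>+y. e x y + e y x \<partial>lborel) \<partial>lborel)"
  proof (intro nn_integral_mono)
    fix x y
    show "2 * ennreal (f x * f y * k (x - y)) \<le> e x y + e y x"
    proof (cases "x \<in> W \<and> y \<in> W")
      case True
      have "2 * f x * f y * k (x - y) \<le> ((f x)\<^sup>2 + (f y)\<^sup>2) * k (x - y)"
        by (intro mult_right_mono sum_squares_bound k_nonneg)
      then have "ennreal (2 * (f x * f y * k (x - y))) \<le> ennreal ((f x)\<^sup>2 * k (x - y) + (f y)\<^sup>2 * k (x - y))"
        by (intro ennreal_leI) (simp add: distrib_right mult.assoc)
      then show ?thesis
        using True f(1) k_nonneg by (simp add: e_def ennreal_mult k_commute[of y x] ennreal_plus)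
    qed (use f(2) in auto)
  qed
  also have "\<dots> = (\<integral>\<^sup>+x. (\<integral>\<^sup>+y. e x y \<partial>lborel) + (\<integral>\<^sup>+y. e y x \<partial>lborel) \<partial>lborel)"
    unfolding e_def by (intro nn_integral_cong nn_integral_add) measurable
  also have "\<dots> = (\<integral>\<^sup>+x. (\<integral>\<^sup>+y. e x y \<partial>lborel) \<partial>lborel) + (\<integral>\<^sup>+x. (\<integral>\<^sup>+y. e y x \<partial>lborel) \<partial>lborel)"
    unfolding e_def by (rule nn_integral_add) measurable
  also have "\<dots> \<le> 2 * (ennreal C * (\<integral>\<^sup>+x. ennreal ((f x)\<^sup>2) \<partial>lborel))"
    unfolding e_sym mult_2 by (intro add_mono e_int)
  finally show ?thesis by (simp add: ennreal_mult_le_mult_iff)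
qed

text \<open>Dominated convergence in each variable; the majorant B * B * k on a product of two balls
  is integrable by the Schur bound.\<close>

lemma energy_limit:
  assumes g: "\<And>i. lip_class L B R (g i)" and lim: "\<And>x. (\<lambda>i. g i x) \<longlonglongrightarrow> g' x"
  shows "(\<lambda>i. energy (g i)) \<longlonglongrightarrow> energy g'"
proof -
  obtain C where S: "schur_bound k (cball 0 R) C"
    using schur_bound_exists[of "cball 0 R"] emeasure_cball_finite by auto
  have g': "lip_class L B R g'" by (rule lip_class_limit[OF g lim])
  have [measurable]: "g i \<in> borel_measurable borel" for i by (rule lip_class_continuous(2)[OF g])
  have [measurable]: "g' \<in> borel_measurable borel" by (rule lip_class_continuous(2)[OF g'])
  have B: "0 \<le> B" using lip_classD(2,3)[OF g'] order_trans by blast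
  define w where "w x y = ennreal (B * B) * indicator (cball 0 R) x * (ennreal \<bar>k (x - y)\<bar> * indicator (cball 0 R) y)" for x y :: 'a
  have [measurable]: "cball (0::'a) R \<in> sets borel" by simp
  have w_int: "(\<integral>\<^sup>+y. w x y \<partial>lborel) \<le> ennreal (B * B) * indicator (cball 0 R) x * ennreal C" for x
  proof -
    have "(\<integral>\<^sup>+y. w x y \<partial>lborel) = ennreal (B * B) * indicator (cball 0 R) x * (\<integral>\<^sup>+y. ennreal \<bar>k (x - y)\<bar> * indicator (cball 0 R) y \<partial>lborel)"
      unfolding w_def by (rule nn_integral_cmult) measurable
    also have "\<dots> \<le> ennreal (B * B) * indicator (cball 0 R) x * ennreal C"
      by (intro mult_left_mono schur_boundD(5)[OF S]) simp
    finally show ?thesis .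
  qed
  have le_w: "ennreal (f x * f y * k (x - y)) \<le> w x y" if f: "lip_class L B R f" for f x y
  proof (cases "norm x \<le> R \<and> norm y \<le> R")
    case True
    have "f x * f y * k (x - y) \<le> B * B * k (x - y)"
      using lip_classD(2,3)[OF f] B k_nonneg by (intro mult_right_mono mult_mono) auto
    then show ?thesis
      using True B k_nonneg by (simp add: w_def ennreal_mult[symmetric] ennreal_leI)
  next
    case False
    then have "f x = 0 \<or> f y = 0" using lip_classD(4)[OF f] by force
    then show ?thesis by auto
  qed
  have inner: "(\<lambda>i. \<integral>\<^sup>+y. ennreal (g i x * g i y * k (x - y)) \<partial>lborel) \<longlonglongrightarrow> (\<integral>\<^sup>+y. ennreal (g' x * g' y * k (x - y)) \<partial>lborel)" for x
  proof (rule nn_integral_dominated_convergence[where w = "w x"])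
    show "w x \<in> borel_measurable lborel" unfolding w_def by measurable
    show "AE y in lborel. ennreal (g j x * g j y * k (x - y)) \<le> w x y" for j using le_w[OF g] by simp
    have "ennreal (B * B) * indicator (cball 0 R) x * ennreal C < \<infinity>"
      by (auto simp: ennreal_mult_less_top split: split_indicator)
    then show "(\<integral>\<^sup>+y. w x y \<partial>lborel) < \<infinity>" using w_int[of x] by (rule le_less_trans[rotated])
    show "AE y in lborel. (\<lambda>i. ennreal (g i x * g i y * k (x - y))) \<longlonglongrightarrow> ennreal (g' x * g' y * k (x - y))"
      by (intro AE_I2 tendsto_ennrealI tendsto_mult lim tendsto_const)
  qed measurable
  show ?thesis
    unfolding energy_def
  proof (rule nn_integral_dominated_convergence[where w = "\<lambda>x. ennreal (B * B) * indicator (cball 0 R) x * ennreal C"])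
    show "(\<lambda>x. ennreal (B * B) * indicator (cball (0::'a) R) x * ennreal C) \<in> borel_measurable lborel" by measurable
    show "AE x in lborel. (\<integral>\<^sup>+y. ennreal (g j x * g j y * k (x - y)) \<partial>lborel) \<le> ennreal (B * B) * indicator (cball 0 R) x * ennreal C" for j
      by (intro AE_I2 order_trans[OF nn_integral_mono w_int] le_w g)
    have "(\<integral>\<^sup>+x. ennreal (B * B) * indicator (cball (0::'a) R) x * ennreal C \<partial>lborel) = ennreal (B * B) * emeasure lborel (cball (0::'a) R) * ennreal C"
      by (subst nn_integral_multc) (simp_all add: nn_integral_cmult_indicator)
    also have "\<dots> < \<infinity>" using emeasure_cball_finite[of "0::'a" R] by (simp add: ennreal_mult_less_top)
    finally show "(\<integral>\<^sup>+x. ennreal (B * B) * indicator (cball (0::'a) R) x * ennreal C \<partial>lborel) < \<infinity>" .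
    show "AE x in lborel. (\<lambda>i. \<integral>\<^sup>+y. ennreal (g i x * g i y * k (x - y)) \<partial>lborel) \<longlonglongrightarrow> (\<integral>\<^sup>+y. ennreal (g' x * g' y * k (x - y)) \<partial>lborel)"
      using inner by simp
  qed measurable
qed

end

text \<open>Fatou: where the limit is positive, the functions are eventually positive. Only an
  inequality can be expected, since positive values may tend to zero on a large set.\<close>

lemma emeasure_support_limit:
  fixes g :: "nat \<Rightarrow> 'a::euclidean_space \<Rightarrow> real"
  assumes [measurable]: "\<And>i. g i \<in> borel_measurable borel" "g' \<in> borel_measurable borel"
    and lim: "\<And>x. (\<lambda>i. g i x) \<longlonglongrightarrow> g' x" and m: "\<And>i. emeasure lborel {x. 0 < g i x} \<le> m"
  shows "emeasure lborel {x. 0 < g' x} \<le> m"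
proof -
  have "emeasure lborel {x. 0 < g' x} = (\<integral>\<^sup>+x. indicator {x. 0 < g' x} x \<partial>lborel)"
    by simp
  also have "\<dots> \<le> (\<integral>\<^sup>+x. liminf (\<lambda>i. indicator {x. 0 < g i x} x) \<partial>lborel)"
  proof (rule nn_integral_mono)
    fix x
    show "indicator {x. 0 < g' x} x \<le> liminf (\<lambda>i. indicator {x. 0 < g i x} x :: ennreal)"
    proof (cases "0 < g' x")
      case True
      have "\<forall>\<^sub>F i in sequentially. 0 < g i x" using order_tendstoD(1)[OF lim True] .
      then have "\<forall>\<^sub>F i in sequentially. (1::ennreal) \<le> indicator {x. 0 < g i x} x"
        by eventually_elim simp
      then have "(1::ennreal) \<le> liminf (\<lambda>i. indicator {x. 0 < g i x} x)" by (rule Liminf_bounded)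
      then show ?thesis using True by simp
    qed simp
  qed
  also have "\<dots> \<le> liminf (\<lambda>i. \<integral>\<^sup>+x. indicator {x. 0 < g i x} x \<partial>lborel)"
    by (rule nn_integral_liminf) measurable
  also have "\<dots> \<le> limsup (\<lambda>i. \<integral>\<^sup>+x. indicator {x. 0 < g i x} x \<partial>lborel)" by (rule Liminf_le_Limsup) simp
  also have "\<dots> \<le> m" using m by (intro Limsup_bounded always_eventually) simp
  finally show ?thesis .
qed

lemma ennreal_add_le_self:
  fixes a d :: ennreal
  assumes "a + d \<le> a" "a < \<infinity>"
  shows "d = 0"
  using assms by (cases a; cases d) (auto simp flip: ennreal_plus simp: top_unique)

context potential_kernel
begin

text \<open>Among the Lipschitz functions that compete with \<open>f\<close> choose one, \<open>g\<close>, with minimal second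
  moment. A reflection moving mass of \<open>g\<close> towards the origin would decrease the second moment, so
  \<open>g\<close> is radially decreasing.\<close>

theorem lipschitz_rearrangement:
  assumes f: "lip_class L B R f" and L: "0 \<le> L"
  obtains g r where "g \<in> borel_measurable borel" "\<And>x. 0 \<le> g x" "\<And>x. r < norm x \<Longrightarrow> g x = 0"
    "emeasure lborel (cball (0::'a) r) \<le> emeasure lborel {x. 0 < f x}"
    "(\<integral>\<^sup>+x. ennreal ((g x)\<^sup>2) \<partial>lborel) = (\<integral>\<^sup>+x. ennreal ((f x)\<^sup>2) \<partial>lborel)"
    "energy f \<le> energy g"
proof -
  define R' where "R' = max R 0"
  \<comment> \<open>Every condition survives both pointwise limits and the polarizations used below.
    The support enters by an inequality because of the limits, the energy because of the
    polarizations.\<close>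
  define A where "A = {g. lip_class L B R g \<and> (\<integral>\<^sup>+x. ennreal ((g x)\<^sup>2) \<partial>lborel) = (\<integral>\<^sup>+x. ennreal ((f x)\<^sup>2) \<partial>lborel)
    \<and> emeasure lborel {x. 0 < g x} \<le> emeasure lborel {x. 0 < f x} \<and> energy f \<le> energy g}"
  define J where "J g = (\<integral>\<^sup>+x. ennreal (g x * (norm x)\<^sup>2) \<partial>lborel)" for g :: "'a \<Rightarrow> real"
  have B: "0 \<le> B" using lip_classD(2,3)[OF f] order_trans by blast
  have fA: "f \<in> A" using f by (simp add: A_def)
  have "J ` A \<noteq> {}" using fA by blast
  from Inf_as_limit[OF this] obtain u where u: "\<And>i::nat. u i \<in> J ` A" "u \<longlonglongrightarrow> Inf (J ` A)"
    by auto
  define G where "G i = (SOME g. g \<in> A \<and> u i = J g)" for i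
  have "G i \<in> A \<and> u i = J (G i)" for i
  proof -
    have "\<exists>g. g \<in> A \<and> u i = J g" using u(1)[of i] by blast
    from someI_ex[OF this] show ?thesis by (simp only: G_def)
  qed
  then have G: "\<And>i. G i \<in> A" "\<And>i. u i = J (G i)" by blast+
  have GL: "lip_class L B R (G i)" for i using G(1) by (simp add: A_def)
  obtain r g where r: "strict_mono r" and lim: "\<And>x. (\<lambda>i. G (r i) x) \<longlonglongrightarrow> g x"
    using lip_class_subseq[of L B R G, OF GL L] by blast
  define H where "H i = G (r i)" for i
  have GrL: "lip_class L B R (H i)" for i unfolding H_def by (rule GL)
  have HA: "H i \<in> A" for i unfolding H_def by (rule G(1))
  have lim: "(\<lambda>i. H i x) \<longlonglongrightarrow> g x" for x unfolding H_def by (rule lim)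
  have gL: "lip_class L B R g" by (rule lip_class_limit[OF GrL lim])
  have gB [measurable]: "g \<in> borel_measurable borel" by (rule lip_class_continuous(2)[OF gL])
  have sq: "(\<integral>\<^sup>+x. ennreal ((g x)\<^sup>2) \<partial>lborel) = (\<integral>\<^sup>+x. ennreal ((f x)\<^sup>2) \<partial>lborel)"
  proof -
    have "(\<lambda>i. \<integral>\<^sup>+x. ennreal ((H i x)\<^sup>2) \<partial>lborel) \<longlonglongrightarrow> (\<integral>\<^sup>+x. ennreal ((g x)\<^sup>2) \<partial>lborel)"
      by (rule lip_class_integral_limit[OF GrL lim, where \<phi> = "\<lambda>s x. ennreal (s\<^sup>2)" and c = "B\<^sup>2"])
         (auto intro!: tendsto_ennrealI tendsto_power ennreal_leI power_mono)
    moreover have "(\<integral>\<^sup>+x. ennreal ((H i x)\<^sup>2) \<partial>lborel) = (\<integral>\<^sup>+x. ennreal ((f x)\<^sup>2) \<partial>lborel)" for i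
      using HA[of i] by (simp add: A_def)
    ultimately show ?thesis using LIMSEQ_unique[OF _ tendsto_const] by simp
  qed
  have supp: "emeasure lborel {x. 0 < g x} \<le> emeasure lborel {x. 0 < f x}"
    by (rule emeasure_support_limit[OF _ _ lim]) (use HA GrL[THEN lip_class_continuous(2)] in \<open>auto simp: A_def\<close>)
  have en: "energy f \<le> energy g"
    by (rule LIMSEQ_le_const[OF energy_limit[OF GrL lim]]) (use HA GrL[THEN lip_class_continuous(2)] in \<open>auto simp: A_def\<close>)
  have gA: "g \<in> A" using gL sq supp en by (simp add: A_def)
  have "(\<lambda>i. J (H i)) \<longlonglongrightarrow> J g"
    unfolding J_def
  proof (rule lip_class_integral_limit[OF GrL lim, where \<phi> = "\<lambda>s x. ennreal (s * (norm x)\<^sup>2)" and c = "B * R'\<^sup>2"])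
    show "ennreal (s * (norm x)\<^sup>2) \<le> ennreal (B * R'\<^sup>2)" if "0 \<le> s" "s \<le> B" "norm x \<le> R" for s and x :: 'a
      using that B by (intro ennreal_leI mult_mono power_mono) (auto simp: R'_def)
  qed (auto intro!: tendsto_ennrealI tendsto_mult)
  moreover have "(\<lambda>i. J (H i)) \<longlonglongrightarrow> Inf (J ` A)"
    using LIMSEQ_subseq_LIMSEQ[OF u(2) r] by (simp add: o_def G(2) H_def)
  ultimately have Jmin: "J g = Inf (J ` A)" by (rule LIMSEQ_unique)
  then have Jle: "J g \<le> J p" if "p \<in> A" for p using that by (auto intro: Inf_lower)
  \<comment> \<open>Needed to cancel \<open>2 * J g\<close> in \<open>ennreal\<close> at the end of
    the comparison with a polarized function.\<close>
  have Jfin: "J g < \<infinity>"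
  proof -
    have "J g \<le> (\<integral>\<^sup>+x. ennreal (B * R'\<^sup>2) * indicator (cball (0::'a) R) x \<partial>lborel)"
      unfolding J_def
    proof (rule nn_integral_mono)
      fix x :: 'a
      show "ennreal (g x * (norm x)\<^sup>2) \<le> ennreal (B * R'\<^sup>2) * indicator (cball 0 R) x"
      proof (cases "norm x \<le> R")
        case True
        then have "g x * (norm x)\<^sup>2 \<le> B * R'\<^sup>2"
          using lip_classD(2,3)[OF gL, of x] B by (intro mult_mono power_mono) (auto simp: R'_def)
        then show ?thesis using True by (simp add: ennreal_leI)
      qed (use lip_classD(4)[OF gL] in simp)
    qed
    also have "\<dots> < \<infinity>" using emeasure_cball_finite[of "0::'a" R]
      by (subst nn_integral_cmult_indicator) (auto simp: ennreal_mult_less_top)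
    finally show ?thesis .
  qed
  have radial: "g b \<le> g a" if ab: "norm a < norm b" for a b :: 'a
  proof -
    define n where "n = b - a"
    \<comment> \<open>The hyperplane is the perpendicular bisector of \<open>a\<close> and
      \<open>b\<close>, with the unnormalized normal b - a. As norm a < norm b, the origin lies
      strictly on the side of \<open>a\<close>, which means t > 0.\<close>
    define t where "t = ((norm b)\<^sup>2 - (norm a)\<^sup>2) / 2"
    have n0: "n \<noteq> 0" using ab by (auto simp: n_def)
    have sq_less: "(norm a)\<^sup>2 < (norm b)\<^sup>2" using ab by (intro power_strict_mono) auto
    have t0: "0 < t" using sq_less by (simp add: t_def)
    interpret polarized_kernel k h n t by unfold_locales (rule n0)
    have nn: "0 < n \<bullet> n" using n0 by simp
    have side: "a \<bullet> n - t = - (n \<bullet> n) / 2"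
      unfolding t_def n_def power2_norm_eq_inner
      by (simp add: inner_diff_left inner_diff_right inner_commute field_simps)
    have ra: "refl a = b"
      unfolding refl_def side using nn by (simp add: n_def)
    define p where "p = polarize g"
    have norm_le: "norm x \<le> norm (refl x)" if "x \<bullet> n - t \<le> 0" for x
    proof (rule power2_le_imp_le)
      have "4 * t * (x \<bullet> n - t) / (n \<bullet> n) \<le> 0"
        using that t0 nn by (intro divide_nonpos_nonneg mult_nonneg_nonpos) auto
      then show "(norm x)\<^sup>2 \<le> (norm (refl x))\<^sup>2" unfolding norm_refl_sq by linarith
    qed simp
    have norm_ge: "norm (refl x) \<le> norm x" if "\<not> x \<bullet> n - t \<le> 0" for x
    proof (rule power2_le_imp_le)
      have "0 \<le> 4 * t * (x \<bullet> n - t) / (n \<bullet> n)"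
        using that t0 nn by (intro divide_nonneg_nonneg mult_nonneg_nonneg) auto
      then show "(norm (refl x))\<^sup>2 \<le> (norm x)\<^sup>2" unfolding norm_refl_sq by linarith
    qed simp
    have pL: "lip_class L B R p"
      unfolding lip_class_def
    proof (intro conjI allI impI)
      show "\<bar>p x - p y\<bar> \<le> L * norm (x - y)" for x y
        unfolding p_def by (rule polarize_lipschitz[OF lip_classD(1)[OF gL] L])
      show "0 \<le> p x" "p x \<le> B" for x
        using lip_classD(2,3)[OF gL] by (auto simp: p_def polarize_def max_def min_def)
      show "p x = 0" if "R < norm x" for x
      proof (cases "x \<bullet> n - t \<le> 0")
        case True
        then have "R < norm (refl x)" using norm_le[OF True] that by linarith
        then show ?thesis using lip_classD(4)[OF gL] that True by (simp add: p_def polarize_values(1))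
      next
        case False
        then show ?thesis using lip_classD(4)[OF gL that] lip_classD(2)[OF gL, of "refl x"]
          by (simp add: p_def polarize_values(1))
      qed
    qed
    have pB [measurable]: "p \<in> borel_measurable borel" by (rule lip_class_continuous(2)[OF pL])
    have "(\<integral>\<^sup>+x. ennreal ((p x)\<^sup>2) \<partial>lborel) = (\<integral>\<^sup>+x. ennreal ((g x)\<^sup>2) \<partial>lborel)"
      unfolding p_def by (rule nn_integral_polarize) measurable
    moreover have "emeasure lborel {x. 0 < p x} = emeasure lborel {x. 0 < g x}"
    proof -
      have ind: "emeasure lborel {x. 0 < q x} = (\<integral>\<^sup>+x. indicator {0<..} (q x) \<partial>lborel)"
        if [measurable]: "q \<in> borel_measurable borel" for q :: "'a \<Rightarrow> real"
      proof -
        have "(\<integral>\<^sup>+x. indicator {0<..} (q x) \<partial>lborel) = (\<integral>\<^sup>+x. indicator {x. 0 < q x} x \<partial>lborel)"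
          by (intro nn_integral_cong) (simp add: indicator_def)
        then show ?thesis by simp
      qed
      show ?thesis unfolding ind[OF pB] ind[OF gB] unfolding p_def
        by (rule nn_integral_polarize) measurable
    qed
    moreover have "energy g \<le> energy p"
      unfolding p_def by (rule energy_polarize) (use lip_classD(2)[OF gL] in auto)
    ultimately have pA: "p \<in> A" using gA pL by (auto simp: A_def)
    \<comment> \<open>The decrease of the second moment contributed by \<open>x\<close> and its
      mirror image. It is nonnegative, since \<open>p\<close> puts the larger value at the point of
      smaller norm. Minimality makes its integral zero, continuity makes \<open>D a\<close> zero,
      and norm a < norm b then forces p a = g a.\<close>
    define D where "D x = (p x - g x) * ((norm (refl x))\<^sup>2 - (norm x)\<^sup>2)" for x
    have D0: "0 \<le> D x" for x
    proof (cases "x \<bullet> n - t \<le> 0")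
      case True
      then show ?thesis using norm_le[OF True] unfolding D_def p_def polarize_values(1)
        by (intro mult_nonneg_nonneg) (auto intro: power_mono)
    next
      case False
      then show ?thesis using norm_ge[OF False] unfolding D_def p_def polarize_values(1)
        by (intro mult_nonpos_nonpos) (auto intro: power_mono)
    qed
    have Dc: "continuous_on UNIV D"
      unfolding D_def by (intro continuous_intros lip_class_continuous(1)[OF pL] lip_class_continuous(1)[OF gL] continuous_on_refl)
    then have [measurable]: "D \<in> borel_measurable borel" by (rule borel_measurable_continuous_onI)
    have pointwise: "g x * (norm x)\<^sup>2 + g (refl x) * (norm (refl x))\<^sup>2
        = (p x * (norm x)\<^sup>2 + p (refl x) * (norm (refl x))\<^sup>2) + D x" for x
    proof -
      have "p (refl x) = g x + g (refl x) - p x" using polarize_sum[of "\<lambda>s. s" g x] by (simp add: p_def)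
      then show ?thesis unfolding D_def by (simp only:) (simp add: algebra_simps)
    qed
    have two: "2 * J q = (\<integral>\<^sup>+x. ennreal (q x * (norm x)\<^sup>2 + q (refl x) * (norm (refl x))\<^sup>2) \<partial>lborel)"
      if [measurable]: "q \<in> borel_measurable borel" and "\<And>x. 0 \<le> q x" for q
    proof -
      have "2 * J q = (\<integral>\<^sup>+x. ennreal (q x * (norm x)\<^sup>2) + ennreal (q (refl x) * (norm (refl x))\<^sup>2) \<partial>lborel)"
        unfolding J_def by (rule nn_integral_refl_sum) measurable
      then show ?thesis using that(2) by simp
    qed
    have "2 * J p + (\<integral>\<^sup>+x. ennreal (D x) \<partial>lborel)
        = (\<integral>\<^sup>+x. ennreal (p x * (norm x)\<^sup>2 + p (refl x) * (norm (refl x))\<^sup>2) + ennreal (D x) \<partial>lborel)"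
      using lip_classD(2)[OF pL] by (subst two) (auto intro!: nn_integral_add[symmetric])
    also have "\<dots> = 2 * J g"
      using lip_classD(2)[OF pL] lip_classD(2)[OF gL] D0
      by (subst two[OF gB]) (auto simp: pointwise intro!: nn_integral_cong)
    finally have eq: "2 * J p + (\<integral>\<^sup>+x. ennreal (D x) \<partial>lborel) = 2 * J g" .
    have "2 * J g + (\<integral>\<^sup>+x. ennreal (D x) \<partial>lborel) \<le> 2 * J p + (\<integral>\<^sup>+x. ennreal (D x) \<partial>lborel)"
      by (intro add_right_mono mult_left_mono Jle pA) simp
    also note eq
    finally have "2 * J g + (\<integral>\<^sup>+x. ennreal (D x) \<partial>lborel) \<le> 2 * J g" .
    moreover have "2 * J g < \<infinity>" using Jfin by (simp add: ennreal_mult_less_top)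
    ultimately have "(\<integral>\<^sup>+x. ennreal (D x) \<partial>lborel) = 0" by (rule ennreal_add_le_self)
    then have "D a = 0" by (rule continuous_nonneg_integral_zero[OF Dc D0])
    then have "p a = g a" using sq_less unfolding D_def ra by auto
    moreover have "p a = max (g a) (g b)"
      using side nn unfolding p_def polarize_values(1) ra by simp
    ultimately show ?thesis by simp
  qed
  show thesis
  proof (cases "\<exists>x. 0 < g x")
    case False
    then have "g x = 0" for x using lip_classD(2)[OF gL, of x] by (metis less_eq_real_def)
    \<comment> \<open>A ball of radius -1 is empty, so the condition on its measure is
      trivial.\<close>
    then show ?thesis using sq en by (intro that[of g "-1"]) auto
  next
    case True
    define S where "S = norm ` {x. 0 < g x}"
    have S: "S \<noteq> {}" "bdd_above S"
      using True lip_classD(4)[OF gL] by (auto simp: S_def bdd_above_def not_less[symmetric]) (metis not_less less_irrefl)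
    \<comment> \<open>By monotonicity \<open>g\<close> is positive on the whole open ball of this
      radius, so the ball has at most the measure of the support of \<open>g\<close>.\<close>
    define \<rho> where "\<rho> = Sup S"
    have \<rho>: "0 \<le> \<rho>" using S cSup_upper2[of _ S] by (fastforce simp: \<rho>_def S_def)
    have "emeasure lborel (cball (0::'a) \<rho>) = emeasure lborel (ball (0::'a) \<rho>)"
      using \<rho> by (simp add: emeasure_ball emeasure_cball)
    also have "\<dots> \<le> emeasure lborel {x. 0 < g x}"
    proof (rule emeasure_mono)
      show "ball 0 \<rho> \<subseteq> {x. 0 < g x}"
      proof
        fix y :: 'a assume "y \<in> ball 0 \<rho>"
        then have "norm y < Sup S" by (simp add: \<rho>_def)
        then obtain x where "0 < g x" "norm y < norm x"
          using less_cSup_iff[OF S] by (auto simp: S_def)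
        then show "y \<in> {x. 0 < g x}" using radial[of y x] by simp
      qed
    qed measurable
    finally have "emeasure lborel (cball (0::'a) \<rho>) \<le> emeasure lborel {x. 0 < f x}" using supp by (rule order_trans)
    moreover have "g x = 0" if "\<rho> < norm x" for x
    proof (rule ccontr)
      assume "g x \<noteq> 0"
      then have "0 < g x" using lip_classD(2)[OF gL, of x] by simp
      then have "norm x \<le> \<rho>" unfolding \<rho>_def by (intro cSup_upper S(2)) (simp add: S_def)
      then show False using that by simp
    qed
    ultimately show ?thesis using sq en lip_classD(2)[OF gL] by (intro that[of g \<rho>]) auto
  qed
qed

end

section \<open>Energy of functions with small support\<close>

lemma emeasure_cball_mono_iff:
  assumes "0 \<le> \<rho>" "emeasure lborel (cball (0::'a::euclidean_space) r) \<le> emeasure lborel (cball (0::'a) \<rho>)"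
  shows "r \<le> \<rho>"
proof (rule ccontr)
  assume "\<not> r \<le> \<rho>"
  then have "\<rho> ^ DIM('a) < r ^ DIM('a)" using assms(1) by (intro power_strict_mono) auto
  then have "unit_ball_vol (real DIM('a)) * \<rho> ^ DIM('a) < unit_ball_vol (real DIM('a)) * r ^ DIM('a)"
    using unit_ball_vol_pos[of "real DIM('a)"] by simp
  moreover have "0 \<le> unit_ball_vol (real DIM('a)) * \<rho> ^ DIM('a)" using assms(1) by simp
  ultimately have "emeasure lborel (cball (0::'a) \<rho>) < emeasure lborel (cball (0::'a) r)"
    using assms(1) \<open>\<not> r \<le> \<rho>\<close> by (simp add: emeasure_cball ennreal_lessI)
  then show False using assms(2) by simp
qed

lemma infdist_lipschitz: "\<bar>infdist x A - infdist y A\<bar> \<le> dist x y"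
  using infdist_triangle[of x A y] infdist_triangle[of y A x] by (simp add: dist_commute abs_le_iff)

text \<open>A finite set \<open>V\<close> of values with nonempty compact sets \<open>C v\<close>; \<open>cone_sum\<close> decreases to the step
  function \<open>\<Sum>v. v * indicator (C v)\<close>.\<close>

definition cone_sum :: "real set \<Rightarrow> (real \<Rightarrow> 'a::euclidean_space set) \<Rightarrow> nat \<Rightarrow> 'a \<Rightarrow> real" where
  "cone_sum V C n x = (\<Sum>v\<in>V. v * max 0 (1 - real (Suc n) * infdist x (C v)))"

text \<open>The cone over \<open>C v\<close> has width 1 / Suc n \<le> 1, whence the support radius
  R + 1.\<close>

lemma cone_sum_lip_class:
  assumes V: "finite V" "\<And>v. v \<in> V \<Longrightarrow> 0 < v" and C: "\<And>v. v \<in> V \<Longrightarrow> C v \<noteq> {} \<and> C v \<subseteq> cball 0 R"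
  shows "lip_class (\<Sum>v\<in>V. v * real (Suc n)) (\<Sum>v\<in>V. v) (R + 1) (cone_sum V C n)"
  unfolding lip_class_def
proof (intro conjI allI impI)
  let ?m = "\<lambda>x v. max 0 (1 - real (Suc n) * infdist x (C v))"
  fix x y :: 'a
  have m1: "\<bar>?m x v - ?m y v\<bar> \<le> real (Suc n) * norm (x - y)" for v
  proof -
    have "\<bar>?m x v - ?m y v\<bar> \<le> real (Suc n) * \<bar>infdist x (C v) - infdist y (C v)\<bar>"
    proof -
      have "\<bar>?m x v - ?m y v\<bar> \<le> \<bar>real (Suc n) * infdist x (C v) - real (Suc n) * infdist y (C v)\<bar>" by linarith
      then show ?thesis by (simp add: right_diff_distrib[symmetric] abs_mult)
    qed
    also have "\<dots> \<le> real (Suc n) * dist x y" by (intro mult_left_mono infdist_lipschitz) simp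
    finally show ?thesis by (simp add: dist_norm)
  qed
  have "\<bar>cone_sum V C n x - cone_sum V C n y\<bar> = \<bar>\<Sum>v\<in>V. v * (?m x v - ?m y v)\<bar>"
    by (simp add: cone_sum_def sum_subtractf[symmetric] right_diff_distrib)
  also have "\<dots> \<le> (\<Sum>v\<in>V. \<bar>v * (?m x v - ?m y v)\<bar>)" by (rule sum_abs)
  also have "\<dots> \<le> (\<Sum>v\<in>V. v * (real (Suc n) * norm (x - y)))"
  proof (rule sum_mono)
    fix v assume "v \<in> V"
    then show "\<bar>v * (?m x v - ?m y v)\<bar> \<le> v * (real (Suc n) * norm (x - y))"
      unfolding abs_mult using V(2)[of v] m1[of v] by (intro mult_mono) auto
  qed
  also have "\<dots> = (\<Sum>v\<in>V. v * real (Suc n)) * norm (x - y)" by (simp add: sum_distrib_right mult.assoc)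
  finally show "\<bar>cone_sum V C n x - cone_sum V C n y\<bar> \<le> (\<Sum>v\<in>V. v * real (Suc n)) * norm (x - y)" .
  show "0 \<le> cone_sum V C n x"
    unfolding cone_sum_def using V(2) by (intro sum_nonneg mult_nonneg_nonneg) (auto intro: less_imp_le)
  have "cone_sum V C n x \<le> (\<Sum>v\<in>V. v * 1)"
    unfolding cone_sum_def
    using V(2) by (intro sum_mono mult_left_mono) (auto intro: less_imp_le mult_nonneg_nonneg infdist_nonneg)
  then show "cone_sum V C n x \<le> (\<Sum>v\<in>V. v)" by simp
  assume x: "R + 1 < norm x"
  have "?m x v = 0" if v: "v \<in> V" for v
  proof -
    have "1 \<le> infdist x (C v)"
      unfolding infdist_notempty[OF conjunct1[OF C[OF v]]]
    proof (rule cINF_greatest)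
      show "C v \<noteq> {}" using C[OF v] by simp
      fix c assume "c \<in> C v"
      then have "norm c \<le> R" using C[OF v] by auto
      then show "1 \<le> dist x c" using x norm_triangle_ineq2[of x c] by (simp add: dist_norm)
    qed
    then have "1 * 1 \<le> real (Suc n) * infdist x (C v)" by (intro mult_mono) auto
    then show ?thesis by simp
  qed
  then show "cone_sum V C n x = 0" unfolding cone_sum_def by (intro sum.neutral) auto
qed

text \<open>At each point the sequence becomes stationary, not merely convergent, because the
  distance from a closed set is positive off the set. So even discontinuous functions of the values
  converge, such as the indicator of positivity.\<close>

lemma cone_sum_limit:
  assumes V: "finite V" and C: "\<And>v. v \<in> V \<Longrightarrow> C v \<noteq> {} \<and> closed (C v)"
  shows "\<forall>\<^sub>F n in sequentially. cone_sum V C n x = (\<Sum>v\<in>V. v * indicator (C v) x)"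
proof -
  have "\<forall>\<^sub>F n in sequentially. max 0 (1 - real (Suc n) * infdist x (C v)) = indicator (C v) x" if v: "v \<in> V" for v
  proof (cases "x \<in> C v")
    case True
    then show ?thesis by simp
  next
    case False
    then have pos: "0 < infdist x (C v)"
      using C[OF v] in_closed_iff_infdist_zero[of "C v" x] infdist_nonneg[of x "C v"] by auto
    obtain N :: nat where N: "1 / infdist x (C v) < real N" using reals_Archimedean2 by blast
    show ?thesis
    proof (rule eventually_sequentiallyI[of N])
      fix n assume "N \<le> n"
      then have "1 / infdist x (C v) \<le> real (Suc n)" using N by simp
      then have "1 \<le> real (Suc n) * infdist x (C v)" using pos by (simp add: pos_divide_le_eq)
      then show "max 0 (1 - real (Suc n) * infdist x (C v)) = indicator (C v) x" using False by simp
    qed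
  qed
  then have "\<forall>\<^sub>F n in sequentially. \<forall>v\<in>V. max 0 (1 - real (Suc n) * infdist x (C v)) = indicator (C v) x"
    using V by (simp add: eventually_ball_finite)
  then show ?thesis
    by eventually_elim (simp add: cone_sum_def)
qed

lemma lip_class_sq_finite:
  fixes f :: "'a::euclidean_space \<Rightarrow> real"
  assumes f: "lip_class L B R f"
  shows "(\<integral>\<^sup>+x. ennreal ((f x)\<^sup>2) \<partial>lborel) < \<infinity>"
proof -
  have "(\<integral>\<^sup>+x. ennreal ((f x)\<^sup>2) \<partial>lborel) \<le> (\<integral>\<^sup>+x. ennreal (B\<^sup>2) * indicator (cball (0::'a) R) x \<partial>lborel)"
  proof (rule nn_integral_mono)
    fix x :: 'a
    show "ennreal ((f x)\<^sup>2) \<le> ennreal (B\<^sup>2) * indicator (cball 0 R) x"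
    proof (cases "norm x \<le> R")
      case True
      have "(f x)\<^sup>2 \<le> B\<^sup>2" using lip_classD(2,3)[OF f] by (intro power_mono) auto
      then show ?thesis using True by (simp add: ennreal_leI)
    qed (use lip_classD(4)[OF f] in simp)
  qed
  also have "\<dots> < \<infinity>" using emeasure_cball_finite[of "0::'a" R]
    by (subst nn_integral_cmult_indicator) (auto simp: ennreal_mult_less_top)
  finally show ?thesis .
qed

section \<open>From Lipschitz functions to measurable functions\<close>

context potential_kernel
begin

text \<open>An upper bound for Rayleigh quotients, stated without division so that functions of norm
  zero need no exception. The \<Lambda> of the overview is the least such bound.\<close>

definition ball_bound :: "real \<Rightarrow> real \<Rightarrow> bool" where
  "ball_bound \<rho> \<Lambda> \<longleftrightarrow> 0 \<le> \<Lambda> \<and> (\<forall>g. g \<in> borel_measurable borel \<longrightarrow> (\<forall>x. 0 \<le> g x) \<longrightarrow> (\<forall>x. \<rho> < norm x \<longrightarrow> g x = 0) \<longrightarrow>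
     (\<integral>\<^sup>+x. ennreal ((g x)\<^sup>2) \<partial>lborel) < \<infinity> \<longrightarrow> energy g \<le> ennreal \<Lambda> * (\<integral>\<^sup>+x. ennreal ((g x)\<^sup>2) \<partial>lborel))"

lemma ball_boundD:
  assumes "ball_bound \<rho> \<Lambda>"
  shows "0 \<le> \<Lambda>"
    "g \<in> borel_measurable borel \<Longrightarrow> (\<And>x. 0 \<le> g x) \<Longrightarrow> (\<And>x. \<rho> < norm x \<Longrightarrow> g x = 0) \<Longrightarrow>
     (\<integral>\<^sup>+x. ennreal ((g x)\<^sup>2) \<partial>lborel) < \<infinity> \<Longrightarrow> energy g \<le> ennreal \<Lambda> * (\<integral>\<^sup>+x. ennreal ((g x)\<^sup>2) \<partial>lborel)"
  using assms unfolding ball_bound_def by blast+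

text \<open>The ball carrying the rearranged function has at most the measure of the ball of radius
  \<rho>, hence at most its radius, and \<open>ball_bound\<close> applies.\<close>

lemma lipschitz_energy_bound:
  assumes bb: "ball_bound \<rho> \<Lambda>" and "0 \<le> \<rho>" and f: "lip_class L B R f" "0 \<le> L"
    and m: "emeasure lborel {x. 0 < f x} \<le> emeasure lborel (cball (0::'a) \<rho>)"
  shows "energy f \<le> ennreal \<Lambda> * (\<integral>\<^sup>+x. ennreal ((f x)\<^sup>2) \<partial>lborel)"
proof (rule lipschitz_rearrangement[OF f])
  fix g r
  assume g: "g \<in> borel_measurable borel" "\<And>x. 0 \<le> g x" "\<And>x. r < norm x \<Longrightarrow> g x = 0"
    "emeasure lborel (cball (0::'a) r) \<le> emeasure lborel {x. 0 < f x}"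
    "(\<integral>\<^sup>+x. ennreal ((g x)\<^sup>2) \<partial>lborel) = (\<integral>\<^sup>+x. ennreal ((f x)\<^sup>2) \<partial>lborel)" "energy f \<le> energy g"
  have "r \<le> \<rho>" using order_trans[OF g(4) m] by (rule emeasure_cball_mono_iff[OF \<open>0 \<le> \<rho>\<close>])
  then have "energy g \<le> ennreal \<Lambda> * (\<integral>\<^sup>+x. ennreal ((g x)\<^sup>2) \<partial>lborel)"
    using g lip_class_sq_finite[OF f(1)] by (intro ball_boundD(2)[OF bb]) auto
  then show ?thesis using g(5,6) by simp
qed

lemma energy_mono:
  assumes "\<And>x. 0 \<le> f x" "\<And>x. f x \<le> g x"
  shows "energy f \<le> energy g"
  unfolding energy_def
proof (intro nn_integral_mono ennreal_leI)
  fix x y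
  have "0 \<le> g x" "0 \<le> g y" using assms order_trans by blast+
  then show "f x * f y * k (x - y) \<le> g x * g y * k (x - y)"
    using assms k_nonneg by (intro mult_right_mono mult_mono) auto
qed

text \<open>The cones lie above \<open>f\<close>, so their energy is at least that of
  \<open>f\<close>, while the measures of their supports tend to that of the support of
  \<open>f\<close>. The latter being strictly smaller than the ball, the cones eventually have small
  enough support for \<open>lipschitz_energy_bound\<close>.\<close>

lemma step_energy_bound:
  assumes bb: "ball_bound \<rho> \<Lambda>" and "0 \<le> \<rho>"
    and V: "finite V" "\<And>v. v \<in> V \<Longrightarrow> 0 < v" and C: "\<And>v. v \<in> V \<Longrightarrow> C v \<noteq> {} \<and> closed (C v) \<and> C v \<subseteq> cball 0 R"
    and m: "emeasure lborel (\<Union>v\<in>V. C v) < emeasure lborel (cball (0::'a) \<rho>)"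
  defines "f \<equiv> \<lambda>x. \<Sum>v\<in>V. v * indicator (C v) x"
  shows "energy f \<le> ennreal \<Lambda> * (\<integral>\<^sup>+x. ennreal ((f x)\<^sup>2) \<partial>lborel)"
proof -
  define g where "g n = cone_sum V C n" for n
  define B where "B = (\<Sum>v\<in>V. v)"
  have gl: "lip_class (\<Sum>v\<in>V. v * real (Suc n)) B (R + 1) (g n)" for n
    unfolding g_def B_def by (rule cone_sum_lip_class) (use V C in auto)
  have L0: "0 \<le> (\<Sum>v\<in>V. v * real (Suc n))" for n
    using V(2) by (intro sum_nonneg mult_nonneg_nonneg) (auto intro: less_imp_le)
  have B0: "0 \<le> B" unfolding B_def using V(2) by (intro sum_nonneg) (auto intro: less_imp_le)
  have ev: "\<forall>\<^sub>F n in sequentially. g n x = f x" for x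
    unfolding g_def f_def by (rule cone_sum_limit) (use V C in auto)
  have [measurable]: "g n \<in> borel_measurable borel" for n by (rule lip_class_continuous(2)[OF gl])
  have [measurable]: "C v \<in> sets borel" if "v \<in> V" for v using C[OF that] by simp
  have [measurable]: "f \<in> borel_measurable borel"
    unfolding f_def by (intro borel_measurable_sum borel_measurable_times borel_measurable_const borel_measurable_indicator) auto
  have f0: "0 \<le> f x" for x
    unfolding f_def using V(2) by (intro sum_nonneg mult_nonneg_nonneg) (auto intro: less_imp_le)
  have fg: "f x \<le> g n x" for n x
    unfolding f_def g_def cone_sum_def
    by (intro sum_mono mult_left_mono) (use V(2) in \<open>auto intro: less_imp_le split: split_indicator\<close>)
  have dct: "(\<lambda>n. \<integral>\<^sup>+x. \<phi> (g n x) \<partial>lborel) \<longlonglongrightarrow> (\<integral>\<^sup>+x. \<phi> (f x) \<partial>lborel)"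
    if [measurable]: "\<phi> \<in> borel_measurable borel" and \<phi>: "\<phi> 0 = 0" "\<And>s. 0 \<le> s \<Longrightarrow> s \<le> B \<Longrightarrow> \<phi> s \<le> ennreal c" for \<phi> :: "real \<Rightarrow> ennreal" and c
  proof (rule nn_integral_dominated_convergence[where w = "\<lambda>x. ennreal c * indicator (cball 0 (R + 1)) x"])
    show "(\<lambda>x. ennreal c * indicator (cball (0::'a) (R + 1)) x) \<in> borel_measurable lborel"
      by (intro borel_measurable_times_ennreal borel_measurable_indicator) simp_all
    show "AE x in lborel. \<phi> (g j x) \<le> ennreal c * indicator (cball 0 (R + 1)) x" for j
    proof (rule AE_I2)
      fix x
      show "\<phi> (g j x) \<le> ennreal c * indicator (cball 0 (R + 1)) x"
        using \<phi> lip_classD(2,3)[OF gl, of j x] lip_classD(4)[OF gl, of x j] by (cases "norm x \<le> R + 1") auto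
    qed
    show "(\<integral>\<^sup>+x. ennreal c * indicator (cball (0::'a) (R + 1)) x \<partial>lborel) < \<infinity>"
      using emeasure_cball_finite[of "0::'a" "R + 1"]
      by (subst nn_integral_cmult_indicator) (auto simp: ennreal_mult_less_top)
    show "AE x in lborel. (\<lambda>i. \<phi> (g i x)) \<longlonglongrightarrow> \<phi> (f x)"
    proof (rule AE_I2)
      fix x
      have "\<forall>\<^sub>F n in sequentially. \<phi> (g n x) = \<phi> (f x)" using ev[of x] by eventually_elim simp
      then show "(\<lambda>i. \<phi> (g i x)) \<longlonglongrightarrow> \<phi> (f x)" by (rule tendsto_eventually)
    qed
  qed measurable
  have ind: "emeasure lborel {x. 0 < q x} = (\<integral>\<^sup>+x. indicator {0<..} (q x) \<partial>lborel)"
    if [measurable]: "q \<in> borel_measurable borel" for q :: "'a \<Rightarrow> real"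
  proof -
    have "(\<integral>\<^sup>+x. indicator {0<..} (q x) \<partial>lborel) = (\<integral>\<^sup>+x. indicator {x. 0 < q x} x \<partial>lborel)"
      by (intro nn_integral_cong) (simp add: indicator_def)
    then show ?thesis by simp
  qed
  have "(\<lambda>n. emeasure lborel {x. 0 < g n x}) \<longlonglongrightarrow> emeasure lborel {x. 0 < f x}"
    unfolding ind[OF \<open>f \<in> borel_measurable borel\<close>] ind[OF lip_class_continuous(2)[OF gl]]
    by (rule dct[where c = 1]) (auto split: split_indicator)
  moreover have "emeasure lborel {x. 0 < f x} < emeasure lborel (cball (0::'a) \<rho>)"
  proof -
    have "emeasure lborel {x. 0 < f x} \<le> emeasure lborel (\<Union>v\<in>V. C v)"
    proof (rule emeasure_mono)
      show "{x. 0 < f x} \<subseteq> (\<Union>v\<in>V. C v)"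
      proof
        fix x assume "x \<in> {x. 0 < f x}"
        then have "f x \<noteq> 0" by simp
        then obtain v where "v \<in> V" "v * indicator (C v) x \<noteq> 0" unfolding f_def by (meson sum.neutral)
        then show "x \<in> (\<Union>v\<in>V. C v)" by (auto split: split_indicator_asm)
      qed
      show "(\<Union>v\<in>V. C v) \<in> sets lborel" using V(1) C by (intro sets.finite_UN) auto
    qed
    then show ?thesis using m by (rule le_less_trans)
  qed
  ultimately have "\<forall>\<^sub>F n in sequentially. emeasure lborel {x. 0 < g n x} < emeasure lborel (cball (0::'a) \<rho>)"
    by (rule order_tendstoD(2))
  then have ev_le: "\<forall>\<^sub>F n in sequentially. energy f \<le> ennreal \<Lambda> * (\<integral>\<^sup>+x. ennreal ((g n x)\<^sup>2) \<partial>lborel)"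
  proof eventually_elim
    case (elim n)
    have "energy f \<le> energy (g n)" by (rule energy_mono[OF f0 fg])
    also have "\<dots> \<le> ennreal \<Lambda> * (\<integral>\<^sup>+x. ennreal ((g n x)\<^sup>2) \<partial>lborel)"
      by (rule lipschitz_energy_bound[OF bb \<open>0 \<le> \<rho>\<close> gl L0]) (use elim in simp)
    finally show ?case .
  qed
  have "(\<lambda>n. ennreal \<Lambda> * (\<integral>\<^sup>+x. ennreal ((g n x)\<^sup>2) \<partial>lborel)) \<longlonglongrightarrow> ennreal \<Lambda> * (\<integral>\<^sup>+x. ennreal ((f x)\<^sup>2) \<partial>lborel)"
    by (intro ennreal_tendsto_cmult dct[where c = "B\<^sup>2"]) (auto intro!: ennreal_leI power_mono)
  then show ?thesis by (rule tendsto_lowerbound[OF _ ev_le]) simp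
qed

text \<open>Fatou's lemma in both integrations treats the energy, and f j \<le> g treats the
  right-hand side.\<close>

lemma energy_bound_limit:
  assumes [measurable]: "\<And>j. f j \<in> borel_measurable borel" "g \<in> borel_measurable borel"
    and lim: "AE x in lborel. (\<lambda>j. f j x) \<longlonglongrightarrow> g x" and le: "\<And>j x. 0 \<le> f j x \<and> f j x \<le> g x"
    and bnd: "\<And>j. energy (f j) \<le> ennreal \<Lambda> * (\<integral>\<^sup>+x. ennreal ((f j x)\<^sup>2) \<partial>lborel)"
  shows "energy g \<le> ennreal \<Lambda> * (\<integral>\<^sup>+x. ennreal ((g x)\<^sup>2) \<partial>lborel)"
proof -
  have "energy g \<le> (\<integral>\<^sup>+x. liminf (\<lambda>j. \<integral>\<^sup>+y. ennreal (f j x * f j y * k (x - y)) \<partial>lborel) \<partial>lborel)"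
    unfolding energy_def
  proof (rule nn_integral_mono_AE)
    show "AE x in lborel. (\<integral>\<^sup>+y. ennreal (g x * g y * k (x - y)) \<partial>lborel) \<le> liminf (\<lambda>j. \<integral>\<^sup>+y. ennreal (f j x * f j y * k (x - y)) \<partial>lborel)"
      using lim
    proof eventually_elim
      case (elim x)
      have "(\<integral>\<^sup>+y. ennreal (g x * g y * k (x - y)) \<partial>lborel) = (\<integral>\<^sup>+y. liminf (\<lambda>j. ennreal (f j x * f j y * k (x - y))) \<partial>lborel)"
      proof (rule nn_integral_cong_AE)
        show "AE y in lborel. ennreal (g x * g y * k (x - y)) = liminf (\<lambda>j. ennreal (f j x * f j y * k (x - y)))"
          using lim
        proof eventually_elim
          case y: (elim y)
          have "(\<lambda>j. ennreal (f j x * f j y * k (x - y))) \<longlonglongrightarrow> ennreal (g x * g y * k (x - y))"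
            by (intro tendsto_ennrealI tendsto_mult elim y tendsto_const)
          then show ?case by (rule lim_imp_Liminf[symmetric, rotated]) simp
        qed
      qed
      also have "\<dots> \<le> liminf (\<lambda>j. \<integral>\<^sup>+y. ennreal (f j x * f j y * k (x - y)) \<partial>lborel)"
        by (rule nn_integral_liminf) measurable
      finally show ?case .
    qed
  qed
  also have "\<dots> \<le> liminf (\<lambda>j. energy (f j))"
    unfolding energy_def by (rule nn_integral_liminf) measurable
  also have "\<dots> \<le> limsup (\<lambda>j. energy (f j))" by (rule Liminf_le_Limsup) simp
  also have "\<dots> \<le> ennreal \<Lambda> * (\<integral>\<^sup>+x. ennreal ((g x)\<^sup>2) \<partial>lborel)"
  proof (rule Limsup_bounded, rule always_eventually, rule allI)
    fix j
    have "(\<integral>\<^sup>+x. ennreal ((f j x)\<^sup>2) \<partial>lborel) \<le> (\<integral>\<^sup>+x. ennreal ((g x)\<^sup>2) \<partial>lborel)"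
      using le by (intro nn_integral_mono ennreal_leI power_mono) auto
    then show "energy (f j) \<le> ennreal \<Lambda> * (\<integral>\<^sup>+x. ennreal ((g x)\<^sup>2) \<partial>lborel)"
      by (intro order_trans[OF bnd] mult_left_mono) simp_all
  qed
  finally show ?thesis .
qed

text \<open>Only sets of measure strictly less than the ball are accessible to \<open>step_energy_bound\<close>, so a
  small ball around a point of the support of \<open>f\<close> is removed as well.\<close>

theorem energy_bound:
  assumes bb: "ball_bound \<rho> \<Lambda>" and "0 \<le> \<rho>" and [measurable]: "f \<in> borel_measurable borel"
    and f: "\<And>x. 0 \<le> f x" and m: "emeasure lborel {x. 0 < f x} \<le> emeasure lborel (cball (0::'a) \<rho>)"
  shows "energy f \<le> ennreal \<Lambda> * (\<integral>\<^sup>+x. ennreal ((f x)\<^sup>2) \<partial>lborel)"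
proof (cases "emeasure lborel {x. 0 < f x} = 0")
  case True
  have "AE x in lborel. f x = 0"
  proof (rule AE_I)
    show "{x \<in> space lborel. f x \<noteq> 0} \<subseteq> {x. 0 < f x}" using f by (auto simp: less_le)
    show "{x. 0 < f x} \<in> sets lborel" by measurable
  qed (rule True)
  then have "AE x in lborel. (\<lambda>j::nat. 0) \<longlonglongrightarrow> f x" by eventually_elim simp
  then show ?thesis
    by (rule energy_bound_limit[rotated 2]) (auto simp: f energy_def)
next
  case False
  define A where "A = {x. 0 < f x}"
  have [measurable]: "A \<in> sets borel" unfolding A_def by measurable
  have finA: "emeasure lborel A < \<infinity>"
    using m emeasure_cball_finite[of "0::'a" \<rho>] unfolding A_def by (rule le_less_trans)
  have null: "negligible U \<longleftrightarrow> emeasure lborel U = 0" if "U \<in> sets borel" for U :: "'a set"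
    using that by (simp add: negligible_iff_emeasure0)
  have "\<not> negligible A" using False null[of A] by (simp add: A_def)
  \<comment> \<open>A set that is negligible near each of its points is negligible. So there is a
    point of \<open>A\<close> near which \<open>A\<close> has positive measure, and removing any
    ball around it strictly lowers the measure.\<close>
  then obtain x0 where x0: "x0 \<in> A" "\<And>U. openin (top_of_set A) U \<Longrightarrow> x0 \<in> U \<Longrightarrow> \<not> negligible U"
    unfolding locally_negligible_alt[of A] by blast
  have less: "emeasure lborel (A - ball x0 e) < emeasure lborel A" if "0 < e" for e
  proof -
    have [measurable]: "ball x0 e \<in> sets borel" by simp
    have "openin (top_of_set A) (A \<inter> ball x0 e)" by (simp add: openin_open_Int)
    then have "\<not> negligible (A \<inter> ball x0 e)" using x0 that by auto
    then have pos: "0 < emeasure lborel (A \<inter> ball x0 e)" using null[of "A \<inter> ball x0 e"] by (simp add: zero_less_iff_neq_zero)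
    have "emeasure lborel (A - ball x0 e) \<le> emeasure lborel A" by (intro emeasure_mono) auto
    then have fin: "emeasure lborel (A - ball x0 e) \<noteq> \<infinity>" using finA by (auto simp: top_unique)
    have "emeasure lborel A = emeasure lborel (A - ball x0 e) + emeasure lborel (A \<inter> ball x0 e)"
      by (subst plus_emeasure) (auto intro!: arg_cong[where f = "emeasure lborel"])
    then show ?thesis using pos fin
      by (metis add.right_neutral ennreal_add_left_cancel_less infinity_ennreal_def)
  qed
  obtain s :: "nat \<Rightarrow> 'a \<Rightarrow> real" where s: "\<And>i. simple_function lborel (s i)" "\<And>i x. 0 \<le> s i x" "\<And>i x. s i x \<le> f x"
    "\<And>x. (\<lambda>i. s i x) \<longlonglongrightarrow> f x"
  proof -
    obtain s where s: "\<And>i. simple_function (lborel :: 'a measure) (s i)" "incseq s" "\<And>i x. 0 \<le> s i x"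
        "\<And>x. bdd_above (range (\<lambda>i. s i x))" "\<And>x. (SUP i. s i x) = f x"
      using borel_measurable_implies_simple_function_sequence_real[of f lborel] f
      by (force simp: image_image)
    have le: "s i x \<le> f x" for i x unfolding s(5)[of x, symmetric] by (rule cSUP_upper[OF _ s(4)]) simp
    have "(\<lambda>i. s i x) \<longlonglongrightarrow> f x" for x
      unfolding s(5)[of x, symmetric]
      by (rule LIMSEQ_incseq_SUP[OF s(4)]) (use s(2) in \<open>auto simp: incseq_def le_fun_def\<close>)
    with s le show thesis by (intro that[of s]) auto
  qed
  have [measurable]: "s i \<in> borel_measurable borel" for i
    using borel_measurable_simple_function[OF s(1)] by simp
  define V where "V j = s j ` UNIV - {0}" for j
  have finV: "finite (V j)" for j using simple_functionD(1)[OF s(1)] by (simp add: V_def)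
  have posV: "0 < v" if "v \<in> V j" for v j using that s(2) by (auto simp: V_def less_le)
  \<comment> \<open>The error allowed for each level set, such that all level sets of
    \<open>s j\<close> together lose at most (1/2)^j. These losses are summable, and by
    Borel-Cantelli almost every point is lost only finitely often.\<close>
  define \<epsilon> where "\<epsilon> j = (1/2) ^ j / real (Suc (card (V j)))" for j
  have \<epsilon>: "0 < \<epsilon> j" for j by (simp add: \<epsilon>_def)
  have "\<exists>T. closed T \<and> T \<subseteq> s j -` {v} \<and> emeasure lborel (s j -` {v} - T) \<le> ennreal (\<epsilon> j)" for j v
  proof -
    have S: "s j -` {v} \<in> sets borel"
      using measurable_sets[OF \<open>s j \<in> borel_measurable borel\<close>, of "{v}"] by simp
    then have "s j -` {v} \<in> sets lebesgue" by simp
    then obtain T where T: "closed T" "T \<subseteq> s j -` {v}" "emeasure lebesgue (s j -` {v} - T) < ennreal (\<epsilon> j)"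
      by (rule sets_lebesgue_inner_closed[OF _ \<epsilon>])
    have "emeasure lborel (s j -` {v} - T) = emeasure lebesgue (s j -` {v} - T)"
      using S T(1) by simp
    then show ?thesis using T by (intro exI[of _ T]) simp
  qed
  then obtain T where T: "\<And>j v. closed (T j v)" "\<And>j v. T j v \<subseteq> s j -` {v}"
      "\<And>j v. emeasure lborel (s j -` {v} - T j v) \<le> ennreal (\<epsilon> j)" by metis
  define bad where "bad j = (\<Union>v\<in>V j. s j -` {v} - T j v)" for j
  have sv: "s j -` {v} \<in> sets borel" for j v
    using measurable_sets[OF \<open>s j \<in> borel_measurable borel\<close>, of "{v}"] by simp
  have Tb: "T j v \<in> sets borel" for j v using T(1) by simp
  have bad_sets: "bad j \<in> sets lborel" for j
    unfolding bad_def using finV sv Tb by (intro sets.finite_UN) auto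
  have bad_le: "emeasure lborel (bad j) \<le> ennreal ((1/2) ^ j)" for j
  proof -
    have "emeasure lborel (bad j) \<le> (\<Sum>v\<in>V j. emeasure lborel (s j -` {v} - T j v))"
      unfolding bad_def using finV sv Tb by (intro emeasure_subadditive_finite) auto
    also have "\<dots> \<le> (\<Sum>v\<in>V j. ennreal (\<epsilon> j))" by (intro sum_mono T(3))
    also have "\<dots> = ennreal (real (card (V j)) * \<epsilon> j)"
      using \<epsilon>[of j] by (simp add: ennreal_mult'' ennreal_of_nat_eq_real_of_nat less_imp_le)
    also have "\<dots> \<le> ennreal ((1/2) ^ j)"
    proof (rule ennreal_leI)
      have "real (card (V j)) * \<epsilon> j \<le> real (Suc (card (V j))) * \<epsilon> j" using \<epsilon>[of j] by (intro mult_right_mono) auto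
      also have "\<dots> = (1/2) ^ j" by (simp add: \<epsilon>_def)
      finally show "real (card (V j)) * \<epsilon> j \<le> (1/2) ^ j" .
    qed
    finally show ?thesis .
  qed
  have good: "AE x in lborel. \<forall>\<^sub>F j in sequentially. x \<in> space lborel - bad j"
  proof (rule borel_cantelli_AE1[OF bad_sets])
    show fin: "emeasure lborel (bad j) < \<infinity>" for j using bad_le[of j] by (rule le_less_trans) simp
    have le: "measure lborel (bad j) \<le> (1/2) ^ j" for j
      using bad_le[of j] fin[of j] by (simp add: emeasure_eq_ennreal_measure)
    have "summable (\<lambda>j. (1/2::real) ^ j)" by (rule summable_geometric) simp
    then show "summable (\<lambda>j. measure lborel (bad j))"
      by (rule summable_comparison_test'[where N = 0]) (simp only: real_norm_def abs_of_nonneg measure_nonneg le)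
  qed
  \<comment> \<open>Compact pieces of the level sets that avoid a ball around \<open>x0\<close>.
    Both the cutoff at radius \<open>j\<close> and the hole of radius 1 / Suc j affect a given point
    other than \<open>x0\<close> for finitely many \<open>j\<close> only.\<close>
  define K where "K j v = T j v \<inter> cball 0 (real j) - ball x0 (1 / real (Suc j))" for j v
  \<comment> \<open>Empty pieces are discarded because the distance from the empty set is 0 by
    convention, so a cone over it would not vanish anywhere.\<close>
  define V' where "V' j = {v \<in> V j. K j v \<noteq> {}}" for j
  define h where "h j x = (\<Sum>v\<in>V' j. v * indicator (K j v) x)" for j x
  have finV': "finite (V' j)" for j using finV by (simp add: V'_def)
  have Ks: "x \<in> K j v \<Longrightarrow> s j x = v" for x j v unfolding K_def using T(2)[of j v] by blast
  have h_eq: "h j x = (if s j x \<in> V' j \<and> x \<in> K j (s j x) then s j x else 0)" for j x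
  proof -
    have "h j x = (\<Sum>v\<in>V' j. if v = s j x then (if x \<in> K j (s j x) then s j x else 0) else 0)"
      unfolding h_def
    proof (rule sum.cong)
      fix v assume "v \<in> V' j"
      show "v * indicator (K j v) x = (if v = s j x then (if x \<in> K j (s j x) then s j x else 0) else 0)"
        using Ks[of x j v] by (cases "v = s j x") (auto simp: indicator_def)
    qed simp
    also have "\<dots> = (if s j x \<in> V' j then (if x \<in> K j (s j x) then s j x else 0) else 0)"
      by (rule sum.delta[OF finV'])
    finally show ?thesis by (cases "s j x \<in> V' j"; cases "x \<in> K j (s j x)") simp_all
  qed
  have h_borel: "h j \<in> borel_measurable borel" for j
    unfolding h_def K_def using Tb
    by (intro borel_measurable_sum borel_measurable_times borel_measurable_const borel_measurable_indicator sets.Diff sets.Int) auto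
  show ?thesis
  proof (rule energy_bound_limit[where f = h, OF h_borel assms(3)])
    show "0 \<le> h j x \<and> h j x \<le> f x" for j x using s(2,3) f by (simp add: h_eq)
    have "AE x in lborel. x \<noteq> x0" by (rule AE_lborel_singleton)
    with good show "AE x in lborel. (\<lambda>j. h j x) \<longlonglongrightarrow> f x"
    proof eventually_elim
      case (elim x)
      obtain N1 :: nat where N1: "norm x \<le> real N1" using real_arch_simple by blast
      obtain N2 :: nat where N2: "1 / dist x0 x < real N2" using reals_Archimedean2 by blast
      have d: "0 < dist x0 x" using elim(2) by simp
      have "\<forall>\<^sub>F j in sequentially. s j x = h j x"
        using elim(1) eventually_ge_at_top[of N1] eventually_ge_at_top[of N2]
      proof eventually_elim
        case j: (elim j)
        show ?case
        proof (cases "s j x = 0")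
          case True
          then show ?thesis by (simp add: h_eq)
        next
          case False
          then have V: "s j x \<in> V j" by (simp add: V_def)
          then have "x \<in> T j (s j x)" using j(1) unfolding bad_def by auto
          moreover have "x \<in> cball 0 (real j)" using N1 j(2) by simp
          moreover have "x \<notin> ball x0 (1 / real (Suc j))"
          proof -
            have "1 / dist x0 x \<le> real (Suc j)" using N2 j(3) by simp
            then have "1 / real (Suc j) \<le> dist x0 x" using d by (simp add: field_simps)
            then show ?thesis by simp
          qed
          ultimately have "x \<in> K j (s j x)" by (simp add: K_def)
          then show ?thesis using V by (auto simp: h_eq V'_def)
        qed
      qed
      then show "(\<lambda>j. h j x) \<longlonglongrightarrow> f x" using s(4)[of x] by (rule Lim_transform_eventually[rotated])
    qed
    show "energy (h j) \<le> ennreal \<Lambda> * (\<integral>\<^sup>+x. ennreal ((h j x)\<^sup>2) \<partial>lborel)" for j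
      unfolding h_def
    proof (rule step_energy_bound[OF bb \<open>0 \<le> \<rho>\<close> finV'])
      show "0 < v" if "v \<in> V' j" for v using that posV by (auto simp: V'_def)
      show "K j v \<noteq> {} \<and> closed (K j v) \<and> K j v \<subseteq> cball 0 (real j)" if "v \<in> V' j" for v
        using that T(1) by (auto simp: V'_def K_def intro!: closed_Diff closed_Int)
      have "(\<Union>v\<in>V' j. K j v) \<subseteq> A - ball x0 (1 / real (Suc j))"
      proof
        fix x assume "x \<in> (\<Union>v\<in>V' j. K j v)"
        then obtain v where v: "v \<in> V' j" "x \<in> K j v" by blast
        then have "0 < s j x" using Ks posV by (auto simp: V'_def)
        then have "x \<in> A" using s(3)[of j x] by (simp add: A_def)
        then show "x \<in> A - ball x0 (1 / real (Suc j))" using v(2) by (simp add: K_def)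
      qed
      then have "emeasure lborel (\<Union>v\<in>V' j. K j v) \<le> emeasure lborel (A - ball x0 (1 / real (Suc j)))"
        by (intro emeasure_mono) auto
      also have "\<dots> < emeasure lborel A" by (rule less) simp
      also have "\<dots> \<le> emeasure lborel (cball (0::'a) \<rho>)" using m by (simp add: A_def)
      finally show "emeasure lborel (\<Union>v\<in>V' j. K j v) < emeasure lborel (cball (0::'a) \<rho>)" .
    qed
  qed
qed

end

section \<open>Eigenvalues of the Riesz potential\<close>

lemma AE_lebesgue_iff: "(AE x in lebesgue. P x) \<longleftrightarrow> (AE x in lborel. P x)"
proof
  assume "AE x in lebesgue. P x"
  then obtain N where N: "{x. \<not> P x} \<subseteq> N" "N \<in> null_sets lebesgue"
    unfolding eventually_ae_filter by auto
  then obtain N' where "N' \<in> null_sets lborel" "N \<subseteq> N'"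
    unfolding null_sets_completion_iff2 by blast
  then show "AE x in lborel. P x" using N(1) by (intro AE_I'[of N']) auto
qed (rule AE_completion)

lemma AE_lebesgue_on_iff:
  assumes "\<Omega> \<in> sets lebesgue"
  shows "(AE x in lebesgue_on \<Omega>. P x) \<longleftrightarrow> (AE x in lborel. x \<in> \<Omega> \<longrightarrow> P x)"
  using assms by (simp add: AE_restrict_space_iff AE_lebesgue_iff)

lemma lmeasurable_borel_representative:
  fixes \<Omega> :: "'a::euclidean_space set"
  assumes "\<Omega> \<in> lmeasurable"
  obtains W where "W \<in> sets borel" "emeasure lborel W = ennreal (measure lebesgue \<Omega>)" "AE x in lborel. x \<in> \<Omega> \<longleftrightarrow> x \<in> W"
proof -
  have "\<Omega> \<in> sets lebesgue" using assms by (rule fmeasurableD)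
  then obtain S N N' where S: "\<Omega> = S \<union> N" "N \<subseteq> N'" "N' \<in> null_sets lborel" "S \<in> sets lborel"
    by (rule sets_completionE)
  have ae: "AE x in lborel. x \<in> \<Omega> \<longleftrightarrow> x \<in> S"
    using AE_not_in[OF S(3)] by eventually_elim (use S in auto)
  have "emeasure lborel S = emeasure lebesgue S" using S(4) by simp
  also have "\<dots> = emeasure lebesgue \<Omega>"
    using ae \<open>\<Omega> \<in> sets lebesgue\<close> S(4) by (intro emeasure_eq_AE) (auto simp: AE_lebesgue_iff)
  also have "\<dots> = ennreal (measure lebesgue \<Omega>)" using assms by (simp add: emeasure_eq_measure2)
  finally show thesis using S(4) ae by (intro that[of S]) auto
qed

text \<open>\<open>W\<close> is left free among the Borel sets almost equal to \<Omega>; for open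
  balls the closed balls will be taken.\<close>

locale riesz_setting =
  fixes \<alpha> :: real and \<Omega> W :: "'a::euclidean_space set"
  assumes \<alpha>: "0 < \<alpha>" "\<alpha> < real DIM('a)"
    and \<Omega>: "\<Omega> \<in> lmeasurable"
    and W_borel: "W \<in> sets borel"
    and W_finite: "emeasure lborel W < \<infinity>"
    and W_AE: "AE x in lborel. x \<in> \<Omega> \<longleftrightarrow> x \<in> W"
begin

definition k :: "'a \<Rightarrow> real" where
  "k z = riesz_const DIM('a) \<alpha> * norm z powr (\<alpha> - real DIM('a))"

definition h :: "real \<Rightarrow> real" where
  "h r = riesz_const DIM('a) \<alpha> * r powr (\<alpha> - real DIM('a))"

sublocale potential_kernel k h
proof -
  have "k = (\<lambda>z. riesz_const DIM('a) \<alpha> * norm z powr (\<alpha> - real DIM('a)))" "h = (\<lambda>r. riesz_const DIM('a) \<alpha> * r powr (\<alpha> - real DIM('a)))"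
    by (auto simp: k_def h_def)
  then show "potential_kernel k h" using riesz_potential_kernel[OF \<alpha>] by simp
qed

abbreviation T :: "'a Lsq \<Rightarrow> 'a Lsq" where
  "T \<equiv> pot_op k W"

sublocale op: compact_symmetric T
  by (rule pot_op_compact_symmetric[OF W_borel W_finite])

lemma \<Omega>_lebesgue: "\<Omega> \<in> sets lebesgue"
  using \<Omega> by (rule fmeasurableD)

lemma schur_W: obtains C where "schur_bound k W C"
  using schur_bound_exists[OF W_borel W_finite] by blast

text \<open>\<open>corr f X\<close>: the function \<open>f\<close> on \<open>\<Omega>\<close>, extended by zero, represents \<open>X\<close>.\<close>

definition corr :: "('a \<Rightarrow> real) \<Rightarrow> 'a Lsq \<Rightarrow> bool" where
  "corr f X \<longleftrightarrow> (AE x in lborel. rep_Lsq X x = indicator \<Omega> x * f x)"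

text \<open>A function measurable for the completed measure agrees almost everywhere with a Borel
  function, which represents the class.\<close>

lemma corr_exists:
  assumes "f \<in> L2_fun \<Omega>"
  obtains X where "corr f X"
proof -
  have f: "f \<in> borel_measurable (lebesgue_on \<Omega>)" "integrable (lebesgue_on \<Omega>) (\<lambda>x. (f x)\<^sup>2)"
    using assms by (auto simp: L2_fun_def)
  have m: "(\<lambda>x. indicator \<Omega> x * f x) \<in> borel_measurable lebesgue"
    using f(1) \<Omega>_lebesgue by (simp add: borel_measurable_restrict_space_iff)
  obtain g where g: "g \<in> borel_measurable lborel" "AE x in lborel. indicator \<Omega> x * f x = g x"
    using completion_ex_borel_measurable_real[OF m] by blast
  have "integrable lebesgue (\<lambda>x. indicator \<Omega> x * (f x)\<^sup>2)"
    using f(2) \<Omega>_lebesgue by (simp add: integrable_restrict_space)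
  then have "integrable lebesgue (\<lambda>x. (g x)\<^sup>2)"
  proof (rule integrable_cong_AE_imp)
    show "(\<lambda>x. (g x)\<^sup>2) \<in> borel_measurable lebesgue"
      using g(1) by (intro borel_measurable_power measurable_completion)
    show "AE x in lebesgue. indicator \<Omega> x * (f x)\<^sup>2 = (g x)\<^sup>2"
      unfolding AE_lebesgue_iff using g(2) by eventually_elim (auto split: split_indicator)
  qed
  then have "sq_int g" using g(1) by (simp add: sq_int_def integrable_completion)
  then have "AE x in lborel. rep_Lsq (abs_Lsq g) x = indicator \<Omega> x * f x"
    using rep_abs_AE[OF \<open>sq_int g\<close>] g(2) by (auto elim: eventually_elim2)
  then show thesis by (intro that[of "abs_Lsq g"]) (simp add: corr_def)
qed

lemma sq_int_L2_fun:
  assumes "sq_int g"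
  shows "g \<in> L2_fun \<Omega>"
proof -
  have "g \<in> borel_measurable lebesgue" "integrable lebesgue (\<lambda>x. (g x)\<^sup>2)"
    using assms by (auto simp: sq_int_def integrable_completion intro: measurable_completion)
  then show ?thesis
    using \<Omega>_lebesgue integrable_mult_indicator[of \<Omega> lebesgue "\<lambda>x. (g x)\<^sup>2"]
    by (auto simp: L2_fun_def integrable_restrict_space intro: measurable_restrict_space1)
qed

lemma corr_zero: "corr (\<lambda>x. 0) 0"
  using rep_abs_AE[OF sq_int_zero] by (simp add: corr_def zero_Lsq.abs_eq)

lemma corr_add_scale:
  assumes "corr f X" "corr g Y"
  shows "corr (\<lambda>x. f x + c * g x) (X + c *\<^sub>R Y)"
proof -
  have "X + c *\<^sub>R Y = abs_Lsq (\<lambda>x. rep_Lsq X x + c * rep_Lsq Y x)"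
    using abs_add[OF rep_sq_int sq_int_scale[OF rep_sq_int], of X c Y] abs_scale[OF rep_sq_int, of c Y] by simp
  then have "AE x in lborel. rep_Lsq (X + c *\<^sub>R Y) x = rep_Lsq X x + c * rep_Lsq Y x"
    using rep_abs_AE[OF sq_int_add[OF rep_sq_int[of X] sq_int_scale[OF rep_sq_int[of Y], of c]]] by simp
  then show ?thesis
    using assms unfolding corr_def by eventually_elim (simp add: algebra_simps)
qed

lemma corr_sum:
  assumes "\<And>i. i < (n::nat) \<Longrightarrow> corr (f i) (X i)"
  shows "corr (\<lambda>x. \<Sum>i<n. c i * f i x) (\<Sum>i<n. c i *\<^sub>R X i)"
  using assms
proof (induction n)
  case 0
  show ?case using corr_zero by simp
next
  case (Suc n)
  then show ?case using corr_add_scale[of "\<lambda>x. \<Sum>i<n. c i * f i x" "\<Sum>i<n. c i *\<^sub>R X i" "f n" "X n" "c n"] by simp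
qed

lemma corr_eq_iff:
  assumes "corr f X" "corr g Y"
  shows "X = Y \<longleftrightarrow> (AE x in lebesgue_on \<Omega>. f x = g x)"
proof -
  have "X = Y \<longleftrightarrow> abs_Lsq (rep_Lsq X) = abs_Lsq (rep_Lsq Y)" by simp
  also have "\<dots> \<longleftrightarrow> (AE x in lborel. rep_Lsq X x = rep_Lsq Y x)" by (rule abs_eq_iff[OF rep_sq_int rep_sq_int])
  also have "\<dots> \<longleftrightarrow> (AE x in lborel. x \<in> \<Omega> \<longrightarrow> f x = g x)"
    using assms unfolding corr_def by (intro eventually_subst) (auto elim!: eventually_elim2 split: split_indicator)
  finally show ?thesis using \<Omega>_lebesgue by (simp add: AE_lebesgue_on_iff)
qed

text \<open>True at every \<open>x\<close>: the two integrands differ in \<open>y\<close> on a null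
  set only, and the integral does not notice this, whether or not it converges.\<close>

lemma riesz_potential_eq:
  assumes "f \<in> L2_fun \<Omega>" "corr f X"
  shows "riesz_potential \<alpha> \<Omega> f x = (LINT y|lborel. k (x - y) * (indicator W y * rep_Lsq X y))"
proof -
  have [measurable]: "rep_Lsq X \<in> borel_measurable borel" using rep_sq_int[of X] by measurable
  note [measurable] = W_borel
  have b: "(\<lambda>y. k (x - y) * (indicator W y * rep_Lsq X y)) \<in> borel_measurable lborel" by measurable
  have m: "(\<lambda>y. indicator \<Omega> y * f y) \<in> borel_measurable lebesgue"
    using assms(1) \<Omega>_lebesgue by (simp add: L2_fun_def borel_measurable_restrict_space_iff)
  have kb: "(\<lambda>y. k (x - y)) \<in> borel_measurable lebesgue" by (intro measurable_completion) measurable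
  have "riesz_potential \<alpha> \<Omega> f x = (LINT y|lebesgue. indicator \<Omega> y *\<^sub>R (k (x - y) * f y))"
    unfolding riesz_potential_def k_def using \<Omega>_lebesgue by (subst integral_restrict_space) simp_all
  also have "\<dots> = (LINT y|lebesgue. k (x - y) * (indicator W y * rep_Lsq X y))"
  proof (rule integral_cong_AE)
    have "(\<lambda>y. k (x - y) * (indicator \<Omega> y * f y)) \<in> borel_measurable lebesgue"
      by (rule borel_measurable_times[OF kb m])
    then show "(\<lambda>y. indicator \<Omega> y *\<^sub>R (k (x - y) * f y)) \<in> borel_measurable lebesgue"
      by (simp add: mult.left_commute)
    show "(\<lambda>y. k (x - y) * (indicator W y * rep_Lsq X y)) \<in> borel_measurable lebesgue"
      using b by (rule measurable_completion)
    show "AE y in lebesgue. indicator \<Omega> y *\<^sub>R (k (x - y) * f y) = k (x - y) * (indicator W y * rep_Lsq X y)"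
      unfolding AE_lebesgue_iff using W_AE assms(2)[unfolded corr_def]
      by eventually_elim (auto split: split_indicator)
  qed
  also have "\<dots> = (LINT y|lborel. k (x - y) * (indicator W y * rep_Lsq X y))"
    by (rule integral_completion[OF b])
  finally show ?thesis .
qed

text \<open>On \<Omega> the two eigenvalue equations are the same; off \<Omega> both sides vanish
  almost everywhere, since \<open>corr\<close> extends by zero.\<close>

lemma eigenspace_iff:
  assumes "f \<in> L2_fun \<Omega>" "corr f X"
  shows "f \<in> riesz_eigenspace \<alpha> \<Omega> \<mu> \<longleftrightarrow> op.eigen \<mu> X"
proof -
  obtain C where S: "schur_bound k W C" by (rule schur_W)
  have "op.eigen \<mu> X \<longleftrightarrow> abs_Lsq (pot k W (rep_Lsq X)) = abs_Lsq (\<lambda>x. \<mu> * rep_Lsq X x)"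
    using abs_scale[OF rep_sq_int, of \<mu> X] by (simp add: op.eigen_def pot_op_def)
  also have "\<dots> \<longleftrightarrow> (AE x in lborel. pot k W (rep_Lsq X) x = \<mu> * rep_Lsq X x)"
    by (rule abs_eq_iff[OF pot_sq_int(1)[OF S rep_sq_int] sq_int_scale[OF rep_sq_int]])
  also have "\<dots> \<longleftrightarrow> (AE x in lborel. x \<in> \<Omega> \<longrightarrow> riesz_potential \<alpha> \<Omega> f x = \<mu> * f x)"
  proof (rule eventually_subst)
    show "AE x in lborel. (pot k W (rep_Lsq X) x = \<mu> * rep_Lsq X x) = (x \<in> \<Omega> \<longrightarrow> riesz_potential \<alpha> \<Omega> f x = \<mu> * f x)"
      using W_AE assms(2)[unfolded corr_def]
    proof eventually_elim
      case (elim x)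
      then show ?case unfolding pot_def riesz_potential_eq[OF assms] by (cases "x \<in> W") auto
    qed
  qed
  finally show ?thesis using assms(1) \<Omega>_lebesgue by (simp add: riesz_eigenspace_def AE_lebesgue_on_iff)
qed

lemma eigen_AE:
  assumes "op.eigen \<mu> X"
  shows "AE x in lborel. pot k W (rep_Lsq X) x = \<mu> * rep_Lsq X x"
proof -
  obtain C where S: "schur_bound k W C" by (rule schur_W)
  have "abs_Lsq (pot k W (rep_Lsq X)) = abs_Lsq (\<lambda>x. \<mu> * rep_Lsq X x)"
    using assms(1) abs_scale[OF rep_sq_int, of \<mu> X] by (simp add: op.eigen_def pot_op_def)
  then show ?thesis
    by (subst (asm) abs_eq_iff[OF pot_sq_int(1)[OF S rep_sq_int] sq_int_scale[OF rep_sq_int]])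
qed

text \<open>An eigenvector for \<mu> \<noteq> 0 is a multiple of a potential cut off to
  \<open>W\<close>, hence vanishes off \<open>W\<close>. For \<mu> = 0 this may fail: functions
  supported off \<open>W\<close> lie in the kernel.\<close>

lemma eigen_corr_rep:
  assumes "op.eigen \<mu> X" "\<mu> \<noteq> 0"
  shows "corr (rep_Lsq X) X"
  unfolding corr_def using W_AE eigen_AE[OF assms(1)]
  by eventually_elim (use assms(2) in \<open>auto simp: pot_def split: split_indicator_asm\<close>)

lemma has_dim_basis:
  assumes "0 < \<mu>" and B: "finite B" "\<And>e. e \<in> B \<Longrightarrow> norm e = 1 \<and> op.eigen \<mu> e"
    "\<And>e f. e \<in> B \<Longrightarrow> f \<in> B \<Longrightarrow> e \<noteq> f \<Longrightarrow> e \<bullet> f = 0"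
    "\<And>x. op.eigen \<mu> x \<Longrightarrow> x = (\<Sum>e\<in>B. (x \<bullet> e) *\<^sub>R e)"
  shows "has_dim_ae \<Omega> (riesz_eigenspace \<alpha> \<Omega> \<mu>) (card B)"
proof -
  obtain b where b: "bij_betw b {..<card B} B"
    using ex_bij_betw_nat_finite[OF B(1)] by (auto simp: lessThan_atLeast0)
  then have bB: "b i \<in> B" if "i < card B" for i using that by (auto dest: bij_betwE)
  have corr_b: "corr (rep_Lsq (b i)) (b i)" if "i < card B" for i
    using B(2)[OF bB[OF that]] \<open>0 < \<mu>\<close> by (intro eigen_corr_rep) auto
  have in_E: "rep_Lsq (b i) \<in> riesz_eigenspace \<alpha> \<Omega> \<mu>" if "i < card B" for i
    using eigenspace_iff[OF sq_int_L2_fun[OF rep_sq_int] corr_b[OF that], of \<mu>] B(2)[OF bB[OF that]] by simp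
  show ?thesis
    unfolding has_dim_ae_def
  proof (intro exI[of _ "\<lambda>i. rep_Lsq (b i)"] conjI allI impI ballI)
    show "rep_Lsq (b i) \<in> riesz_eigenspace \<alpha> \<Omega> \<mu>" if "i < card B" for i by (rule in_E[OF that])
    show "c j = 0" if c: "AE x in lebesgue_on \<Omega>. (\<Sum>i<card B. c i * rep_Lsq (b i) x) = 0" and j: "j < card B" for c :: "nat \<Rightarrow> real" and j
    proof -
      have "(\<Sum>i<card B. c i *\<^sub>R b i) = 0"
        using corr_eq_iff[OF corr_sum[of "card B" "\<lambda>i. rep_Lsq (b i)" b c, OF corr_b] corr_zero] c by simp
      then have "0 = (\<Sum>i<card B. c i *\<^sub>R b i) \<bullet> b j" by simp
      also have "\<dots> = (\<Sum>i<card B. if i = j then c j else 0)"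
        unfolding inner_sum_left
      proof (rule sum.cong)
        fix i assume "i \<in> {..<card B}"
        then have i: "i < card B" by simp
        show "c i *\<^sub>R b i \<bullet> b j = (if i = j then c j else 0)"
        proof (cases "i = j")
          case True
          then show ?thesis using B(2)[OF bB[OF j]] by (simp add: norm_eq_1)
        next
          case False
          then have "b i \<noteq> b j" using bij_betw_imp_inj_on[OF b] i j by (auto dest: inj_onD)
          then show ?thesis using B(3)[OF bB[OF i] bB[OF j]] False by simp
        qed
      qed simp
      also have "\<dots> = c j" using j by simp
      finally show ?thesis by simp
    qed
    show "\<exists>c. AE x in lebesgue_on \<Omega>. f x = (\<Sum>i<card B. c i * rep_Lsq (b i) x)" if f: "f \<in> riesz_eigenspace \<alpha> \<Omega> \<mu>" for f
    proof -
      have fL: "f \<in> L2_fun \<Omega>" using f by (simp add: riesz_eigenspace_def)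
      obtain X where X: "corr f X" by (rule corr_exists[OF fL])
      have "op.eigen \<mu> X" using eigenspace_iff[OF fL X, of \<mu>] f by simp
      then have "X = (\<Sum>e\<in>B. (X \<bullet> e) *\<^sub>R e)" by (rule B(4))
      also have "\<dots> = (\<Sum>i<card B. (X \<bullet> b i) *\<^sub>R b i)"
        by (rule sum.reindex_bij_betw[OF b, symmetric])
      finally have "X = (\<Sum>i<card B. (X \<bullet> b i) *\<^sub>R b i)" .
      then show ?thesis
        using corr_eq_iff[OF X corr_sum[of "card B" "\<lambda>i. rep_Lsq (b i)" b "\<lambda>i. X \<bullet> b i", OF corr_b]]
        by (intro exI[of _ "\<lambda>i. X \<bullet> b i"]) simp
    qed
  qed
qed

text \<open>Ensures that the choice in \<open>riesz_eigenvalue\<close> picks a genuine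
  enumeration.\<close>

lemma enumeration_exists: "\<exists>lam. riesz_eigenvalue_enumeration \<alpha> \<Omega> lam"
proof -
  \<comment> \<open>The second conjunct ties a nonzero multiplicity to a nonzero eigenvector, so
    that \<open>finite_spectrum_above\<close> bounds the number of values with nonzero
    multiplicity.\<close>
  have "\<exists>n. has_dim_ae \<Omega> (riesz_eigenspace \<alpha> \<Omega> \<mu>) n \<and> (n \<noteq> 0 \<longrightarrow> (\<exists>x. x \<noteq> 0 \<and> op.eigen \<mu> x))" if \<mu>: "0 < \<mu>" for \<mu>
  proof -
    obtain B where B: "finite B" "\<And>e. e \<in> B \<Longrightarrow> norm e = 1 \<and> op.eigen \<mu> e"
      "\<And>e f. e \<in> B \<Longrightarrow> f \<in> B \<Longrightarrow> e \<noteq> f \<Longrightarrow> e \<bullet> f = 0"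
      "\<And>x. op.eigen \<mu> x \<Longrightarrow> x = (\<Sum>e\<in>B. (x \<bullet> e) *\<^sub>R e)"
      by (rule op.eigenspace_basis[OF \<mu>]) blast
    have "\<exists>x. x \<noteq> 0 \<and> op.eigen \<mu> x" if "card B \<noteq> 0"
    proof -
      have "B \<noteq> {}" using that by auto
      then obtain e where "e \<in> B" by blast
      then show ?thesis using B(2)[of e] by (intro exI[of _ e]) auto
    qed
    then show ?thesis using has_dim_basis[OF \<mu> B] by blast
  qed
  then obtain m where m: "\<And>\<mu>. 0 < \<mu> \<Longrightarrow> has_dim_ae \<Omega> (riesz_eigenspace \<alpha> \<Omega> \<mu>) (m \<mu>)"
      "\<And>\<mu>. 0 < \<mu> \<Longrightarrow> m \<mu> \<noteq> 0 \<Longrightarrow> \<exists>x. x \<noteq> 0 \<and> op.eigen \<mu> x" by metis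
  have "\<exists>lam :: nat \<Rightarrow> real. decseq lam \<and> (\<forall>k. 0 \<le> lam k) \<and>
    (\<forall>\<mu>>0. finite {k. lam k = \<mu>} \<and> card {k. lam k = \<mu>} = m \<mu>)"
  proof (rule descending_enumeration_exists)
    fix t :: real assume t: "0 < t"
    have "{\<mu>. t \<le> \<mu> \<and> m \<mu> \<noteq> 0} \<subseteq> op.spectrum_above t"
      using m(2) t by (auto simp: op.spectrum_above_def)
    then show "finite {\<mu>. t \<le> \<mu> \<and> m \<mu> \<noteq> 0}" using op.finite_spectrum_above[OF t] finite_subset by blast
  qed
  then show ?thesis unfolding riesz_eigenvalue_enumeration_def using m(1) by metis
qed

text \<open>Moves an arbitrary basis witnessing the dimension to the Hilbert space. Nothing but the
  dimension of the eigenspaces is known about a given enumeration.\<close>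

lemma has_dim_span:
  assumes d: "has_dim_ae \<Omega> (riesz_eigenspace \<alpha> \<Omega> \<mu>) n"
  obtains X where "\<And>i. i < n \<Longrightarrow> op.eigen \<mu> (X i)"
    "\<And>c. (\<Sum>i<n. c i *\<^sub>R X i) = 0 \<Longrightarrow> \<forall>i<n. c i = 0"
    "\<And>Y. op.eigen \<mu> Y \<Longrightarrow> \<mu> \<noteq> 0 \<Longrightarrow> \<exists>c. Y = (\<Sum>i<n. c i *\<^sub>R X i)"
proof -
  obtain b where b: "\<And>i. i < n \<Longrightarrow> b i \<in> riesz_eigenspace \<alpha> \<Omega> \<mu>"
    "\<And>c :: nat \<Rightarrow> real. (AE x in lebesgue_on \<Omega>. (\<Sum>i<n. c i * b i x) = 0) \<Longrightarrow> \<forall>i<n. c i = 0"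
    "\<And>f. f \<in> riesz_eigenspace \<alpha> \<Omega> \<mu> \<Longrightarrow> \<exists>c :: nat \<Rightarrow> real. AE x in lebesgue_on \<Omega>. f x = (\<Sum>i<n. c i * b i x)"
    using d unfolding has_dim_ae_def by blast
  have bL: "b i \<in> L2_fun \<Omega>" if "i < n" for i using b(1)[OF that] by (simp add: riesz_eigenspace_def)
  have "\<exists>X. corr (b i) X" if "i < n" for i using corr_exists[OF bL[OF that]] by blast
  then obtain X where X: "\<And>i. i < n \<Longrightarrow> corr (b i) (X i)" by metis
  show thesis
  proof (rule that[of X])
    show "op.eigen \<mu> (X i)" if "i < n" for i
      using eigenspace_iff[OF bL[OF that] X[OF that], of \<mu>] b(1)[OF that] by simp
    show "\<forall>i<n. c i = 0" if "(\<Sum>i<n. c i *\<^sub>R X i) = 0" for c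
      using corr_eq_iff[OF corr_sum[of n b X c, OF X] corr_zero] that b(2)[of c] by simp
    show "\<exists>c. Y = (\<Sum>i<n. c i *\<^sub>R X i)" if Y: "op.eigen \<mu> Y" "\<mu> \<noteq> 0" for Y
    proof -
      note cY = eigen_corr_rep[OF Y]
      have "rep_Lsq Y \<in> riesz_eigenspace \<alpha> \<Omega> \<mu>"
        using eigenspace_iff[OF sq_int_L2_fun[OF rep_sq_int] cY, of \<mu>] Y(1) by simp
      then obtain c :: "nat \<Rightarrow> real" where c: "AE x in lebesgue_on \<Omega>. rep_Lsq Y x = (\<Sum>i<n. c i * b i x)" using b(3) by blast
      then have "Y = (\<Sum>i<n. c i *\<^sub>R X i)"
        using corr_eq_iff[OF cY corr_sum[of n b X c, OF X]] by simp
      then show ?thesis by blast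
    qed
  qed
qed

lemma has_dim_one:
  assumes "has_dim_ae \<Omega> (riesz_eigenspace \<alpha> \<Omega> \<mu>) n" "1 \<le> n"
  obtains X where "op.eigen \<mu> X" "X \<noteq> 0"
proof (rule has_dim_span[OF assms(1)])
  fix X assume X: "\<And>i. i < n \<Longrightarrow> op.eigen \<mu> (X i)" "\<And>c. (\<Sum>i<n. c i *\<^sub>R X i) = 0 \<Longrightarrow> \<forall>i<n. c i = 0"
  have "X 0 \<noteq> 0"
  proof
    assume "X 0 = 0"
    then have "(\<Sum>i<n. (if i = 0 then 1 else 0) *\<^sub>R X i) = 0" by (intro sum.neutral) auto
    from X(2)[OF this] show False using assms(2) by auto
  qed
  then show thesis using X(1)[of 0] assms(2) by (intro that[of "X 0"]) auto
qed

lemma has_dim_two: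
  assumes "has_dim_ae \<Omega> (riesz_eigenspace \<alpha> \<Omega> \<mu>) n" "2 \<le> n"
  obtains X Y where "op.eigen \<mu> X" "op.eigen \<mu> Y" "X \<noteq> 0" "Y \<noteq> 0" "X \<bullet> Y = 0"
proof (rule has_dim_span[OF assms(1)])
  fix X assume X: "\<And>i. i < n \<Longrightarrow> op.eigen \<mu> (X i)" "\<And>c. (\<Sum>i<n. c i *\<^sub>R X i) = 0 \<Longrightarrow> \<forall>i<n. c i = 0"
  have comb: "a *\<^sub>R X 0 + b *\<^sub>R X 1 \<noteq> 0" if "a \<noteq> 0 \<or> b \<noteq> 0" for a b
  proof
    assume eq: "a *\<^sub>R X 0 + b *\<^sub>R X 1 = 0"
    define c where "c i = (if i = 0 then a else if i = 1 then b else 0)" for i :: nat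
    have "(\<Sum>i<n. c i *\<^sub>R X i) = (\<Sum>i\<in>{0,1}. c i *\<^sub>R X i)"
      using assms(2) by (intro sum.mono_neutral_right) (auto simp: c_def)
    also have "\<dots> = 0" using eq by (simp add: c_def)
    finally have "\<forall>i<n. c i = 0" by (rule X(2))
    then have "c 0 = 0" "c 1 = 0" using assms(2) by auto
    then show False using that by (simp add: c_def)
  qed
  define s where "s = (X 1 \<bullet> X 0) / (X 0 \<bullet> X 0)"
  define Y where "Y = X 1 - s *\<^sub>R X 0"
  have X0: "X 0 \<noteq> 0" using comb[of 1 0] by simp
  have "Y \<noteq> 0" using comb[of "- s" 1] by (simp add: Y_def)
  moreover have "X 0 \<bullet> Y = 0" using X0 by (simp add: Y_def s_def inner_diff_right inner_commute)
  moreover have "op.eigen \<mu> Y"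
    using X(1)[of 0] X(1)[of 1] assms(2)
    by (simp add: Y_def op.eigen_def op.diff op.scale algebra_simps)
  ultimately show thesis using X(1)[of 0] X0 assms(2) by (intro that[of "X 0" Y]) auto
qed

text \<open>If the first two values coincide, their eigenspace has dimension at least two and
  contains an orthogonal pair; otherwise eigenvectors for the two distinct values are
  orthogonal.\<close>

lemma second_eigenvalue_eigenvectors:
  assumes lam: "riesz_eigenvalue_enumeration \<alpha> \<Omega> lam" and "0 < lam 1"
  obtains X Y \<mu> \<nu> where "op.eigen \<mu> X" "op.eigen \<nu> Y" "X \<noteq> 0" "Y \<noteq> 0" "X \<bullet> Y = 0" "lam 1 \<le> \<mu>" "lam 1 \<le> \<nu>"
proof -
  have "lam 1 \<le> lam 0" using lam unfolding riesz_eigenvalue_enumeration_def by (auto dest: decseqD)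
  have dim: "finite {k. lam k = \<mu>}" "has_dim_ae \<Omega> (riesz_eigenspace \<alpha> \<Omega> \<mu>) (card {k. lam k = \<mu>})" if "0 < \<mu>" for \<mu>
    using lam that unfolding riesz_eigenvalue_enumeration_def by auto
  show thesis
  proof (cases "lam 0 = lam 1")
    case True
    have "card {0, 1::nat} \<le> card {k. lam k = lam 1}"
      using True by (intro card_mono dim assms(2)) auto
    then obtain X Y where "op.eigen (lam 1) X" "op.eigen (lam 1) Y" "X \<noteq> 0" "Y \<noteq> 0" "X \<bullet> Y = 0"
      using has_dim_two[OF dim(2)[OF assms(2)]] by auto
    then show thesis by (intro that[of "lam 1" X "lam 1" Y]) auto
  next
    case False
    have pos0: "0 < lam 0" using \<open>lam 1 \<le> lam 0\<close> assms(2) by linarith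
    have "card {i} \<le> card {k. lam k = lam i}" if "0 < lam i" for i :: nat
      by (intro card_mono dim that) auto
    then have one: "1 \<le> card {k. lam k = lam i}" if "0 < lam i" for i using that by simp
    obtain X where X: "op.eigen (lam 0) X" "X \<noteq> 0" by (rule has_dim_one[OF dim(2)[OF pos0] one[OF pos0]])
    obtain Y where Y: "op.eigen (lam 1) Y" "Y \<noteq> 0" by (rule has_dim_one[OF dim(2)[OF assms(2)] one[OF assms(2)]])
    have "X \<bullet> Y = 0" by (rule op.eigen_orthogonal[OF X(1) Y(1) False])
    then show thesis using X Y \<open>lam 1 \<le> lam 0\<close> by (intro that[of "lam 0" X "lam 1" Y]) auto
  qed
qed

text \<open>The converse: distinct eigenvalues occur at distinct indices, one of which is at least
  1. A common eigenvalue with two orthogonal eigenvectors has multiplicity at least two and cannot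
  occur at index 0 only.\<close>

lemma second_eigenvalue_ge:
  assumes lam: "riesz_eigenvalue_enumeration \<alpha> \<Omega> lam" and "0 < c"
    and e: "op.eigen \<mu> X" "op.eigen \<nu> Y" "X \<noteq> 0" "Y \<noteq> 0" "X \<bullet> Y = 0" "c \<le> \<mu>" "c \<le> \<nu>"
  shows "c \<le> lam 1"
proof -
  have dec: "lam j \<le> lam i" if "i \<le> j" for i j
    using lam that unfolding riesz_eigenvalue_enumeration_def by (auto dest: decseqD)
  have dim: "has_dim_ae \<Omega> (riesz_eigenspace \<alpha> \<Omega> \<mu>) (card {k. lam k = \<mu>})" if "0 < \<mu>" for \<mu>
    using lam that unfolding riesz_eigenvalue_enumeration_def by auto
  have occurs: "\<exists>k. lam k = \<kappa>" if "op.eigen \<kappa> Z" "Z \<noteq> 0" "c \<le> \<kappa>" for \<kappa> Z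
  proof (rule ccontr)
    assume "\<nexists>k. lam k = \<kappa>"
    then have "card {k. lam k = \<kappa>} = 0" by simp
    moreover have "0 < \<kappa>" using that \<open>0 < c\<close> by simp
    ultimately have "has_dim_ae \<Omega> (riesz_eigenspace \<alpha> \<Omega> \<kappa>) 0" using dim[of \<kappa>] by simp
    then obtain Xs where "\<And>Y. op.eigen \<kappa> Y \<Longrightarrow> \<kappa> \<noteq> 0 \<Longrightarrow> \<exists>c. Y = (\<Sum>i<0. c i *\<^sub>R (Xs :: nat \<Rightarrow> 'a Lsq) i)"
      by (rule has_dim_span) blast
    then show False using that \<open>0 < \<kappa>\<close> by fastforce
  qed
  show ?thesis
  proof (cases "\<mu> = \<nu>")
    case False
    obtain i where i: "lam i = \<mu>" using occurs[OF e(1,3,6)] by blast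
    obtain j where j: "lam j = \<nu>" using occurs[OF e(2,4,7)] by blast
    have "i \<noteq> j" using False i j by auto
    then have "1 \<le> i \<or> 1 \<le> j" by linarith
    then show ?thesis using dec[of 1 i] dec[of 1 j] i j e(6,7) by auto
  next
    case True
    have "\<not> {k. lam k = \<mu>} \<subseteq> {0}"
    proof
      assume sub: "{k. lam k = \<mu>} \<subseteq> {0}"
      then have card: "card {k. lam k = \<mu>} \<le> 1" using card_mono[OF _ sub] by simp
      have \<mu>0: "0 < \<mu>" using e(6) \<open>0 < c\<close> by simp
      obtain Xs where Xs: "\<And>Y. op.eigen \<mu> Y \<Longrightarrow> \<mu> \<noteq> 0 \<Longrightarrow> \<exists>c. Y = (\<Sum>i<card {k. lam k = \<mu>}. c i *\<^sub>R (Xs :: nat \<Rightarrow> 'a Lsq) i)"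
        by (rule has_dim_span[OF dim[OF \<mu>0]]) blast
      have "\<exists>t. Z = t *\<^sub>R Xs 0" if Z: "op.eigen \<mu> Z" for Z
      proof -
        obtain c where c: "Z = (\<Sum>i<card {k. lam k = \<mu>}. c i *\<^sub>R Xs i)" using Xs[OF Z] \<mu>0 by auto
        show ?thesis
        proof (cases "card {k. lam k = \<mu>} = 0")
          case True
          then show ?thesis using c by (intro exI[of _ 0]) simp
        next
          case False
          then have "card {k. lam k = \<mu>} = 1" using card by simp
          then show ?thesis using c by (intro exI[of _ "c 0"]) simp
        qed
      qed
      then obtain s t where "X = s *\<^sub>R Xs 0" "Y = t *\<^sub>R Xs 0" using e(1,2) True by metis
      then show False using e(3,4,5) by auto
    qed
    then obtain i where "lam i = \<mu>" "i \<noteq> 0" by auto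
    then show ?thesis using dec[of 1 i] e(6) by simp
  qed
qed

end

section \<open>Bounds for the second eigenvalue\<close>

lemma ennreal_integral_le_nn_integral:
  fixes g :: "'a \<Rightarrow> real"
  shows "ennreal (LINT y|M. g y) \<le> (\<integral>\<^sup>+y. ennreal (g y) \<partial>M)"
proof (cases "integrable M g")
  case True
  have "(LINT y|M. g y) \<le> enn2real (\<integral>\<^sup>+y. ennreal (g y) \<partial>M)"
    unfolding real_lebesgue_integral_def[OF True] by simp
  then have "ennreal (LINT y|M. g y) \<le> ennreal (enn2real (\<integral>\<^sup>+y. ennreal (g y) \<partial>M))" by (rule ennreal_leI)
  also have "\<dots> \<le> (\<integral>\<^sup>+y. ennreal (g y) \<partial>M)" by (cases "\<integral>\<^sup>+y. ennreal (g y) \<partial>M") auto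
  finally show ?thesis .
qed (simp add: not_integrable_integral_eq)

context potential_kernel
begin

lemma energy_translate:
  assumes [measurable]: "g \<in> borel_measurable borel"
  shows "energy (\<lambda>x. g (x - p)) = energy g"
proof -
  have "(\<integral>\<^sup>+y. ennreal (g (x - p) * g (y - p) * k (x - y)) \<partial>lborel) = (\<integral>\<^sup>+z. ennreal (g (x - p) * g z * k ((x - p) - z)) \<partial>lborel)" for x
    using nn_integral_lborel_translate[of "\<lambda>z. ennreal (g (x - p) * g z * k ((x - p) - z))" p] by simp
  then have "energy (\<lambda>x. g (x - p)) = (\<integral>\<^sup>+x. (\<integral>\<^sup>+z. ennreal (g (x - p) * g z * k ((x - p) - z)) \<partial>lborel) \<partial>lborel)"
    unfolding energy_def by simp
  also have "\<dots> = energy g"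
    unfolding energy_def
    by (rule nn_integral_lborel_translate[of "\<lambda>x. \<integral>\<^sup>+z. ennreal (g x * g z * k (x - z)) \<partial>lborel"]) measurable
  finally show ?thesis .
qed

text \<open>Some bound exists by \<open>energy_le\<close>, and the infimum of all bounds is again
  one, because for each \<open>g\<close> the inequality is closed in the constant. A function
  violating a smaller constant is nearly optimal.\<close>

lemma least_ball_bound:
  obtains \<Lambda> where "ball_bound \<rho> \<Lambda>"
    "\<And>c. 0 \<le> c \<Longrightarrow> c < \<Lambda> \<Longrightarrow> \<exists>g. g \<in> borel_measurable borel \<and> (\<forall>x. 0 \<le> g x) \<and> (\<forall>x. \<rho> < norm x \<longrightarrow> g x = 0) \<and>
      (\<integral>\<^sup>+x. ennreal ((g x)\<^sup>2) \<partial>lborel) < \<infinity> \<and> ennreal c * (\<integral>\<^sup>+x. ennreal ((g x)\<^sup>2) \<partial>lborel) < energy g"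
proof -
  define A where "A = {\<Lambda>. ball_bound \<rho> \<Lambda>}"
  obtain C where C: "schur_bound k (cball 0 \<rho>) C"
    using schur_bound_exists[of "cball 0 \<rho>"] emeasure_cball_finite by auto
  have "ball_bound \<rho> C"
    unfolding ball_bound_def
  proof (intro conjI allI impI)
    show "0 \<le> C" by (rule schur_boundD(3)[OF C])
  qed (rule energy_le[OF C], auto)
  then have CA: "C \<in> A" by (simp add: A_def)
  have bdd: "bdd_below A" by (rule bdd_belowI[of _ 0]) (auto simp: A_def dest: ball_boundD(1))
  define \<Lambda> where "\<Lambda> = Inf A"
  have bb: "ball_bound \<rho> \<Lambda>"
    unfolding ball_bound_def
  proof (intro conjI allI impI)
    show \<Lambda>0: "0 \<le> \<Lambda>" unfolding \<Lambda>_def using CA by (intro cInf_greatest) (auto simp: A_def dest: ball_boundD(1))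
    fix g :: "'a \<Rightarrow> real"
    assume g: "g \<in> borel_measurable borel" "\<forall>x. 0 \<le> g x" "\<forall>x. \<rho> < norm x \<longrightarrow> g x = 0"
      "(\<integral>\<^sup>+x. ennreal ((g x)\<^sup>2) \<partial>lborel) < \<infinity>"
    define s where "s = enn2real (\<integral>\<^sup>+x. ennreal ((g x)\<^sup>2) \<partial>lborel)"
    have s: "(\<integral>\<^sup>+x. ennreal ((g x)\<^sup>2) \<partial>lborel) = ennreal s" "0 \<le> s" using g(4) by (simp_all add: s_def)
    have le: "energy g \<le> ennreal (\<Lambda>' * s)" if "\<Lambda>' \<in> A" for \<Lambda>'
    proof -
      have bb': "ball_bound \<rho> \<Lambda>'" using that by (simp add: A_def)
      have "energy g \<le> ennreal \<Lambda>' * ennreal s"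
        using ball_boundD(2)[OF bb', of g] g s(1) by simp
      then show ?thesis using ball_boundD(1)[OF bb'] s(2) by (simp add: ennreal_mult)
    qed
    define e where "e = enn2real (energy g)"
    have "energy g < \<infinity>" using le[OF CA] by (rule le_less_trans) simp
    then have e: "energy g = ennreal e" "0 \<le> e" by (simp_all add: e_def)
    have le': "e \<le> \<Lambda>' * s" if "\<Lambda>' \<in> A" for \<Lambda>'
    proof -
      have "0 \<le> \<Lambda>' * s" using that s(2) by (intro mult_nonneg_nonneg) (auto simp: A_def dest: ball_boundD(1))
      then show ?thesis using le[OF that] by (simp add: e(1))
    qed
    have "e \<le> \<Lambda> * s"
    proof (cases "s = 0")
      case True
      then show ?thesis using le'[OF CA] by simp
    next
      case False
      then have "0 < s" using s(2) by simp
      then have "e / s \<le> \<Lambda>" unfolding \<Lambda>_def using CA le' by (intro cInf_greatest) (auto simp: pos_divide_le_eq)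
      then show ?thesis using \<open>0 < s\<close> by (simp add: pos_divide_le_eq)
    qed
    then show "energy g \<le> ennreal \<Lambda> * (\<integral>\<^sup>+x. ennreal ((g x)\<^sup>2) \<partial>lborel)"
      unfolding e(1) s(1) using \<Lambda>0 s(2) by (simp add: ennreal_mult[symmetric] ennreal_leI)
  qed
  show thesis
  proof (rule that[OF bb])
    fix c assume c: "0 \<le> c" "c < \<Lambda>"
    have "\<not> ball_bound \<rho> c"
    proof
      assume "ball_bound \<rho> c"
      then have "\<Lambda> \<le> c" unfolding \<Lambda>_def using bdd by (intro cInf_lower) (simp_all add: A_def)
      then show False using c by simp
    qed
    then show "\<exists>g. g \<in> borel_measurable borel \<and> (\<forall>x. 0 \<le> g x) \<and> (\<forall>x. \<rho> < norm x \<longrightarrow> g x = 0) \<and>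
      (\<integral>\<^sup>+x. ennreal ((g x)\<^sup>2) \<partial>lborel) < \<infinity> \<and> ennreal c * (\<integral>\<^sup>+x. ennreal ((g x)\<^sup>2) \<partial>lborel) < energy g"
      unfolding ball_bound_def using c(1) by (simp add: not_le)
  qed
qed

end

context riesz_setting
begin

text \<open>Where \<open>u > 0\<close>, dropping the negative part of \<open>u\<close> from the potential only increases it; so
  the positive part of an eigenfunction is a test function for the Rayleigh quotient.\<close>

lemma eigenvalue_le_ball_bound:
  assumes eig: "op.eigen \<mu> X" "0 < \<mu>" and bb: "ball_bound \<rho> \<Lambda>" "0 \<le> \<rho>"
    and ne: "emeasure lborel {x. 0 < rep_Lsq X x} \<noteq> 0"
    and le: "emeasure lborel {x. 0 < rep_Lsq X x} \<le> emeasure lborel (cball (0::'a) \<rho>)"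
  shows "\<mu> \<le> \<Lambda>"
proof -
  define u where "u = rep_Lsq X"
  define F where "F x = max 0 (u x)" for x
  have su: "sq_int u" by (simp add: u_def rep_sq_int)
  have [measurable]: "u \<in> borel_measurable borel" using su by measurable
  have [measurable]: "F \<in> borel_measurable borel" unfolding F_def by measurable
  have F0: "0 \<le> F x" for x by (simp add: F_def)
  have Fpos: "{x. 0 < F x} = {x. 0 < u x}" by (auto simp: F_def)
  define s where "s = enn2real (\<integral>\<^sup>+x. ennreal ((F x)\<^sup>2) \<partial>lborel)"
  have "(\<integral>\<^sup>+x. ennreal ((F x)\<^sup>2) \<partial>lborel) \<le> (\<integral>\<^sup>+x. ennreal ((u x)\<^sup>2) \<partial>lborel)"
    by (intro nn_integral_mono ennreal_leI) (auto simp: F_def max_def)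
  also have "\<dots> < \<infinity>" using su by (simp add: sq_int_iff_nn)
  finally have s: "(\<integral>\<^sup>+x. ennreal ((F x)\<^sup>2) \<partial>lborel) = ennreal s" "0 \<le> s" by (simp_all add: s_def)
  have s0: "s \<noteq> 0"
  proof
    assume "s = 0"
    then have "(\<integral>\<^sup>+x. ennreal ((F x)\<^sup>2) \<partial>lborel) = 0" using s(1) by simp
    then have "AE x in lborel. ennreal ((F x)\<^sup>2) = 0" by (subst (asm) nn_integral_0_iff_AE) auto
    then have "AE x in lborel. x \<notin> {x. 0 < u x}"
      by eventually_elim (auto simp: F_def ennreal_eq_0_iff)
    then have "emeasure lborel {x. 0 < u x} = 0" by (subst (asm) AE_iff_measurable[OF _ refl]) auto
    then show False using ne by (simp add: u_def)
  qed
  have "(\<integral>\<^sup>+x. ennreal \<mu> * ennreal ((F x)\<^sup>2) \<partial>lborel) \<le> energy F"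
    unfolding energy_def
  proof (rule nn_integral_mono_AE)
    show "AE x in lborel. ennreal \<mu> * ennreal ((F x)\<^sup>2) \<le> (\<integral>\<^sup>+y. ennreal (F x * F y * k (x - y)) \<partial>lborel)"
      using eigen_AE[OF eig(1)]
    proof eventually_elim
      case (elim x)
      show ?case
      proof (cases "0 < u x")
        case True
        then have Fx: "F x = u x" by (simp add: F_def)
        have "\<mu> * u x = pot k W u x" using elim by (simp add: u_def)
        \<comment> \<open>Off \<open>W\<close> the potential is zero by definition, whereas \<mu> *
          u x is positive here.\<close>
        moreover have "pot k W u x \<noteq> 0" using calculation True eig(2) by (metis mult_pos_pos less_irrefl)
        then have "x \<in> W" by (auto simp: pot_def split: split_indicator_asm)
        ultimately have "\<mu> * u x = (LINT y|lborel. k (x - y) * (indicator W y * u y))" by (simp add: pot_def)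
        then have "ennreal (\<mu> * u x) \<le> (\<integral>\<^sup>+y. ennreal (k (x - y) * (indicator W y * u y)) \<partial>lborel)"
          using ennreal_integral_le_nn_integral by simp
        also have "\<dots> \<le> (\<integral>\<^sup>+y. ennreal (k (x - y) * F y) \<partial>lborel)"
          by (intro nn_integral_mono ennreal_leI mult_left_mono k_nonneg) (auto simp: F_def split: split_indicator)
        finally have "ennreal (u x) * ennreal (\<mu> * u x) \<le> ennreal (u x) * (\<integral>\<^sup>+y. ennreal (k (x - y) * F y) \<partial>lborel)"
          by (intro mult_left_mono) simp_all
        also have "\<dots> = (\<integral>\<^sup>+y. ennreal (u x) * ennreal (k (x - y) * F y) \<partial>lborel)"
          by (rule nn_integral_cmult[symmetric]) measurable
        also have "\<dots> = (\<integral>\<^sup>+y. ennreal (F x * F y * k (x - y)) \<partial>lborel)"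
          unfolding Fx using True by (intro nn_integral_cong) (simp add: ennreal_mult'[symmetric] mult_ac)
        finally show ?thesis
          using True eig(2) by (simp add: Fx ennreal_mult[symmetric] power2_eq_square mult_ac)
      qed (simp add: F_def)
    qed
  qed
  also have "energy F \<le> ennreal \<Lambda> * (\<integral>\<^sup>+x. ennreal ((F x)\<^sup>2) \<partial>lborel)"
    by (rule energy_bound[OF bb _ F0]) (use le in \<open>simp_all add: Fpos u_def[symmetric]\<close>)
  finally have "ennreal \<mu> * ennreal s \<le> ennreal \<Lambda> * ennreal s"
    unfolding s(1)[symmetric] by (subst nn_integral_cmult[symmetric]) auto
  then have "\<mu> * s \<le> \<Lambda> * s"
    using eig(2) ball_boundD(1)[OF bb(1)] s(2) by (simp add: ennreal_mult[symmetric])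
  then show ?thesis using s(2) s0 by simp
qed

lemma rep_uminus_AE: "AE x in lborel. rep_Lsq (- X) x = - rep_Lsq X x"
proof -
  have "- X = abs_Lsq (\<lambda>x. - rep_Lsq X x)"
    using abs_scale[OF rep_sq_int, of "-1" X] by simp
  then show ?thesis using rep_abs_AE[OF sq_int_minus[OF rep_sq_int[of X]]] by simp
qed

text \<open>Orthogonality gives X \<bullet> T Y = 0, so the product of \<open>u\<close> with the
  potential of \<open>v\<close> vanishes almost everywhere. As the kernel is positive off the
  diagonal and \<open>v\<close> is not zero, this potential is nonzero almost everywhere on
  \<open>W\<close>; hence \<open>u\<close> vanishes on \<open>W\<close>, and off \<open>W\<close> it
  vanishes as an eigenvector.\<close>

lemma positive_eigenvectors_not_orthogonal:
  assumes eig': "op.eigen \<mu> X" "0 < \<mu>" and eig: "op.eigen \<nu> Y" "0 < \<nu>" and orth: "X \<bullet> Y = 0" and X: "AE x in lborel. 0 \<le> rep_Lsq X x" "X \<noteq> 0"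
    and Y: "AE x in lborel. 0 \<le> rep_Lsq Y x" "Y \<noteq> 0"
  shows False
proof -
  obtain C where S: "schur_bound k W C" by (rule schur_W)
  note [measurable] = W_borel
  define u v where "u = rep_Lsq X" and "v = rep_Lsq Y"
  have su: "sq_int u" and sv: "sq_int v" by (simp_all add: u_def v_def rep_sq_int)
  have sp: "sq_int (pot k W v)" by (rule pot_sq_int(1)[OF S sv])
  have [measurable]: "u \<in> borel_measurable borel" using su by measurable
  have [measurable]: "v \<in> borel_measurable borel" using sv by measurable
  have v0: "AE y in lborel. 0 \<le> v y" using Y(1) by (simp add: v_def)
  have p0: "AE x in lborel. 0 \<le> pot k W v x"
    using eigen_AE[OF eig(1)] Y(1) by eventually_elim (use eig(2) in \<open>simp add: v_def\<close>)
  have "X \<bullet> T Y = 0" using eig(1) orth by (simp add: op.eigen_def)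
  then have "abs_Lsq u \<bullet> abs_Lsq (pot k W v) = 0" by (simp add: u_def v_def pot_op_def)
  then have "(LINT x|lborel. u x * pot k W v x) = 0" by (simp add: abs_inner[OF su sp])
  moreover have "AE x in lborel. 0 \<le> u x * pot k W v x"
    using X(1) p0 by eventually_elim (simp add: u_def)
  ultimately have z: "AE x in lborel. u x * pot k W v x = 0"
    using integral_nonneg_eq_0_iff_AE[OF sq_int_mult_integrable[OF su sp]] by simp
  have vW: "AE y in lborel. y \<notin> W \<longrightarrow> v y = 0"
    using eigen_AE[OF eig(1)] by eventually_elim (use eig(2) in \<open>auto simp: v_def pot_def split: split_indicator_asm\<close>)
  have uW: "AE x in lborel. x \<notin> W \<or> u x = 0 \<or> (LINT y|lborel. k (x - y) * (indicator W y * v y)) = 0"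
    using z by eventually_elim (auto simp: pot_def)
  have pos: "(LINT y|lborel. k (x - y) * (indicator W y * v y)) \<noteq> 0"
    if int: "integrable lborel (\<lambda>y. k (x - y) * (indicator W y * v y))" for x
  proof
    assume "(LINT y|lborel. k (x - y) * (indicator W y * v y)) = 0"
    moreover have "AE y in lborel. 0 \<le> k (x - y) * (indicator W y * v y)"
      using v0 by eventually_elim (intro mult_nonneg_nonneg k_nonneg, auto)
    ultimately have "AE y in lborel. k (x - y) * (indicator W y * v y) = 0"
      using integral_nonneg_eq_0_iff_AE[OF int] by simp
    moreover have "AE y in lborel. y \<noteq> x" by (rule AE_lborel_singleton)
    ultimately have "AE y in lborel. v y = 0"
      using vW
    proof eventually_elim
      case (elim y)
      have "0 < k (x - y)" unfolding k_eq using elim(2) by (intro h_pos) simp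
      then show ?case using elim(1,3) by (auto split: split_indicator_asm)
    qed
    then have "abs_Lsq v = 0" using abs_eq_iff[OF sv sq_int_zero] by (simp add: zero_Lsq.abs_eq)
    then show False using Y(2) by (simp add: v_def)
  qed
  have "AE x in lborel. x \<in> W \<longrightarrow> u x = 0"
    using uW pot_integrable[OF S sv] by eventually_elim (use pos in blast)
  moreover have "AE x in lborel. x \<notin> W \<longrightarrow> u x = 0"
    using eigen_AE[OF eig'(1)] by eventually_elim (use eig'(2) in \<open>auto simp: u_def pot_def split: split_indicator_asm\<close>)
  ultimately have "AE x in lborel. u x = 0" by eventually_elim blast
  then have "abs_Lsq u = 0" using abs_eq_iff[OF su sq_int_zero] by (simp add: zero_Lsq.abs_eq)
  then show False using X(2) by (simp add: u_def)
qed

text \<open>The sets of positive and of negative values are disjoint parts of \<open>W\<close>, so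
  one of them has at most the measure of the ball. If it is the negative one, -X replaces X.\<close>

lemma sign_changing_eigenvalue_le:
  assumes eig: "op.eigen \<mu> X" "0 < \<mu>" and bb: "ball_bound \<rho> \<Lambda>" "0 \<le> \<rho>"
    and pos: "emeasure lborel {x. 0 < rep_Lsq X x} \<noteq> 0" and neg: "emeasure lborel {x. rep_Lsq X x < 0} \<noteq> 0"
    and W: "emeasure lborel W \<le> 2 * emeasure lborel (cball (0::'a) \<rho>)"
  shows "\<mu> \<le> \<Lambda>"
proof -
  define u where "u = rep_Lsq X"
  define m where "m = emeasure lborel (cball (0::'a) \<rho>)"
  have [measurable]: "u \<in> borel_measurable borel" unfolding u_def using rep_sq_int[of X] by measurable
  note [measurable] = W_borel
  have uW: "AE x in lborel. x \<notin> W \<longrightarrow> u x = 0"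
    using eigen_AE[OF eig(1)] by eventually_elim (use eig(2) in \<open>auto simp: u_def pot_def split: split_indicator_asm\<close>)
  have "emeasure lborel {x. 0 < u x} + emeasure lborel {x. u x < 0} = emeasure lborel ({x. 0 < u x} \<union> {x. u x < 0})"
    by (rule plus_emeasure) auto
  also have "\<dots> \<le> emeasure lborel W"
    by (rule emeasure_mono_AE) (use uW in \<open>auto elim!: eventually_mono\<close>)
  finally have sum: "emeasure lborel {x. 0 < u x} + emeasure lborel {x. u x < 0} \<le> m + m"
    using W by (simp add: m_def mult_2)
  have "m < \<infinity>" unfolding m_def by (rule emeasure_cball_finite)
  then have "emeasure lborel {x. 0 < u x} \<le> m \<or> emeasure lborel {x. u x < 0} \<le> m"
    using sum
    by (cases m; cases "emeasure lborel {x. 0 < u x}"; cases "emeasure lborel {x. u x < 0}")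
       (auto simp flip: ennreal_plus simp: top_unique)
  then show ?thesis
  proof
    assume "emeasure lborel {x. 0 < u x} \<le> m"
    then show ?thesis using eigenvalue_le_ball_bound[OF eig bb pos] by (simp add: u_def m_def)
  next
    assume le: "emeasure lborel {x. u x < 0} \<le> m"
    have "op.eigen \<mu> (- X)" using eig(1) op.scale[of "-1" X] by (simp add: op.eigen_def)
    have [measurable]: "rep_Lsq (- X) \<in> borel_measurable borel" using rep_sq_int[of "- X"] by measurable
    have "emeasure lborel {x. 0 < rep_Lsq (- X) x} = emeasure lborel {x. u x < 0}"
    proof (rule emeasure_eq_AE)
      show "AE x in lborel. x \<in> {x. 0 < rep_Lsq (- X) x} \<longleftrightarrow> x \<in> {x. u x < 0}"
        using rep_uminus_AE[of X] by eventually_elim (simp add: u_def)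
    qed measurable
    then show ?thesis
      using eigenvalue_le_ball_bound[OF \<open>op.eigen \<mu> (- X)\<close> eig(2) bb] neg le by (simp add: u_def m_def)
  qed
qed

text \<open>Were the value larger than \<Lambda>, neither vector of the orthogonal pair could change
  sign; up to their signs both would be nonnegative, which contradicts orthogonality.\<close>

lemma second_eigenvalue_le:
  assumes lam: "riesz_eigenvalue_enumeration \<alpha> \<Omega> lam" and bb: "ball_bound \<rho> \<Lambda>" "0 \<le> \<rho>"
    and W: "emeasure lborel W \<le> 2 * emeasure lborel (cball (0::'a) \<rho>)"
  shows "lam 1 \<le> \<Lambda>"
proof (cases "0 < lam 1")
  case False
  then show ?thesis using ball_boundD(1)[OF bb(1)] by simp
next
  case True
  then obtain X Y \<mu> \<nu> where e: "op.eigen \<mu> X" "op.eigen \<nu> Y" "X \<noteq> 0" "Y \<noteq> 0" "X \<bullet> Y = 0" "lam 1 \<le> \<mu>" "lam 1 \<le> \<nu>"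
    by (rule second_eigenvalue_eigenvectors[OF lam])
  show ?thesis
  proof (rule ccontr)
    assume contra: "\<not> lam 1 \<le> \<Lambda>"
    have signed: "\<exists>Z. op.eigen \<kappa> Z \<and> Z \<noteq> 0 \<and> (AE x in lborel. 0 \<le> rep_Lsq Z x) \<and> (Z = X \<or> Z = - X)"
      if X: "op.eigen \<kappa> X" "X \<noteq> 0" "lam 1 \<le> \<kappa>" for \<kappa> X
    proof -
      have [measurable]: "rep_Lsq X \<in> borel_measurable borel" using rep_sq_int[of X] by measurable
      have "\<not> \<kappa> \<le> \<Lambda>" "0 < \<kappa>" using contra X(3) True by auto
      then consider "emeasure lborel {x. 0 < rep_Lsq X x} = 0" | "emeasure lborel {x. rep_Lsq X x < 0} = 0"
        using sign_changing_eigenvalue_le[OF X(1) _ bb _ _ W] by blast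
      then show ?thesis
      proof cases
        case 1
        have "AE x in lborel. \<not> 0 < rep_Lsq X x" by (subst AE_iff_measurable[OF _ refl]) (use 1 in auto)
        then have "AE x in lborel. 0 \<le> rep_Lsq (- X) x" using rep_uminus_AE[of X] by eventually_elim simp
        moreover have "op.eigen \<kappa> (- X)" using X(1) op.scale[of "-1" X] by (simp add: op.eigen_def)
        ultimately show ?thesis using X(2) by (intro exI[of _ "- X"]) simp
      next
        case 2
        have "AE x in lborel. \<not> rep_Lsq X x < 0" by (subst AE_iff_measurable[OF _ refl]) (use 2 in auto)
        then have "AE x in lborel. 0 \<le> rep_Lsq X x" by eventually_elim simp
        then show ?thesis using X by blast
      qed
    qed
    obtain X' where X': "op.eigen \<mu> X'" "X' \<noteq> 0" "AE x in lborel. 0 \<le> rep_Lsq X' x" "X' = X \<or> X' = - X"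
      using signed[OF e(1,3,6)] by blast
    obtain Y' where Y': "op.eigen \<nu> Y'" "Y' \<noteq> 0" "AE x in lborel. 0 \<le> rep_Lsq Y' x" "Y' = Y \<or> Y' = - Y"
      using signed[OF e(2,4,7)] by blast
    have "X' \<bullet> Y' = 0" using X'(4) Y'(4) e(5) by auto
    moreover have "0 < \<mu>" "0 < \<nu>" using True e(6,7) by auto
    ultimately show False
      using positive_eigenvectors_not_orthogonal[OF X'(1) _ Y'(1) _ _ X'(3,2) Y'(3,2)] by blast
  qed
qed

section \<open>Lower bound for two distant balls\<close>

lemma pot_energy:
  assumes f: "sq_int f" "\<And>x. 0 \<le> f x" "\<And>x. x \<notin> W \<Longrightarrow> f x = 0"
  shows "ennreal (LINT x|lborel. pot k W f x * f x) = energy f"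
proof -
  obtain C where S: "schur_bound k W C" by (rule schur_W)
  note [measurable] = W_borel
  have [measurable]: "f \<in> borel_measurable borel" using f(1) by measurable
  have p0: "0 \<le> pot k W f x" for x
    unfolding pot_def by (intro mult_nonneg_nonneg integral_nonneg_AE AE_I2) (auto simp: k_nonneg f(2))
  have "(\<integral>\<^sup>+x. ennreal (pot k W f x * f x) \<partial>lborel) = ennreal (LINT x|lborel. pot k W f x * f x)"
    using f(2) p0 by (intro nn_integral_eq_integral sq_int_mult_integrable[OF pot_sq_int(1)[OF S f(1)] f(1)]) simp
  moreover have "(\<integral>\<^sup>+x. ennreal (pot k W f x * f x) \<partial>lborel) = energy f"
    unfolding energy_def
  proof (rule nn_integral_cong_AE)
    show "AE x in lborel. ennreal (pot k W f x * f x) = (\<integral>\<^sup>+y. ennreal (f x * f y * k (x - y)) \<partial>lborel)"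
      using pot_integrable[OF S f(1)]
    proof eventually_elim
      case (elim x)
      show ?case
      proof (cases "x \<in> W")
        case True
        have "ennreal (pot k W f x) = (\<integral>\<^sup>+y. ennreal (k (x - y) * (indicator W y * f y)) \<partial>lborel)"
          using True elim f(2) k_nonneg by (simp add: pot_def nn_integral_eq_integral)
        then have "ennreal (f x) * ennreal (pot k W f x) = (\<integral>\<^sup>+y. ennreal (f x) * ennreal (k (x - y) * (indicator W y * f y)) \<partial>lborel)"
          by (subst nn_integral_cmult) auto
        also have "\<dots> = (\<integral>\<^sup>+y. ennreal (f x * f y * k (x - y)) \<partial>lborel)"
          using f(2,3) by (intro nn_integral_cong) (auto simp: ennreal_mult'[symmetric] mult_ac split: split_indicator)
        finally show ?thesis using f(2) p0 by (simp add: ennreal_mult[symmetric] mult.commute)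
      qed (simp add: f(3))
    qed
  qed
  ultimately show ?thesis by simp
qed

lemma sq_int_translate:
  fixes g :: "'a \<Rightarrow> real"
  assumes "g \<in> borel_measurable borel" "(\<integral>\<^sup>+x. ennreal ((g x)\<^sup>2) \<partial>lborel) = ennreal s"
  shows "sq_int (\<lambda>x. g (x - p))" "0 \<le> s \<Longrightarrow> abs_Lsq (\<lambda>x. g (x - p)) \<bullet> abs_Lsq (\<lambda>x. g (x - p)) = s"
proof -
  note [measurable] = assms(1)
  have eq: "(\<integral>\<^sup>+x. ennreal ((g (x - p))\<^sup>2) \<partial>lborel) = ennreal s"
    using nn_integral_lborel_translate[of "\<lambda>x. ennreal ((g x)\<^sup>2)" p] assms(2) by simp
  show sq: "sq_int (\<lambda>x. g (x - p))" unfolding sq_int_iff_nn eq by simp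
  show "abs_Lsq (\<lambda>x. g (x - p)) \<bullet> abs_Lsq (\<lambda>x. g (x - p)) = s" if "0 \<le> s"
    using nn_norm_abs[OF sq] that unfolding eq power2_norm_eq_inner by simp
qed

lemma integral_translate:
  fixes g :: "'a \<Rightarrow> real"
  assumes [measurable]: "g \<in> borel_measurable borel" and "\<And>x. 0 \<le> g x"
  shows "(LINT x|lborel. g (x - p)) = (LINT x|lborel. g x)"
  using nn_integral_lborel_translate[of "\<lambda>x. ennreal (g x)" p] assms(2)
  by (simp add: integral_eq_nn_integral)

text \<open>The Rayleigh quotient on the span of the two translates of \<open>g\<close>: the interaction of the balls
  is at most \<open>h l * (\<integral> g)\<^sup>2\<close>.\<close>

lemma second_eigenvalue_ge_balls:
  assumes lam: "riesz_eigenvalue_enumeration \<alpha> \<Omega> lam" and W: "W = cball p \<rho> \<union> cball q \<rho>"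
    and l: "0 < l" "\<And>x y. x \<in> cball p \<rho> \<Longrightarrow> y \<in> cball q \<rho> \<Longrightarrow> l \<le> norm (x - y)"
    and g: "g \<in> borel_measurable borel" "\<And>x. 0 \<le> g x" "\<And>x. \<rho> < norm x \<Longrightarrow> g x = 0"
    and s: "(\<integral>\<^sup>+x. ennreal ((g x)\<^sup>2) \<partial>lborel) = ennreal s" "0 < s" and e: "energy g = ennreal e" "0 \<le> e"
    and c: "0 < c" "c * s \<le> e - h l * (LINT x|lborel. g x)\<^sup>2"
  shows "c \<le> lam 1"
proof -
  obtain C where S: "schur_bound k W C" by (rule schur_W)
  note [measurable] = W_borel g(1)
  define G where "G = (LINT x|lborel. g x)"
  define f where "f p x = g (x - p)" for p x
  have [measurable]: "f p \<in> borel_measurable borel" for p unfolding f_def by measurable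
  have f0: "0 \<le> f p x" for p x by (simp add: f_def g(2))
  have sf: "sq_int (f p)" for p unfolding f_def by (rule sq_int_translate(1)[OF g(1) s(1)])
  have supp: "x \<in> cball p \<rho>" if "f p x \<noteq> 0" for p x
    using that g(3)[of "x - p"] by (force simp: f_def dist_norm norm_minus_commute not_less)
  have disj: "False" if "x \<in> cball p \<rho>" "x \<in> cball q \<rho>" for x using l(2)[OF that] l(1) by simp
  have supp_W: "f p x = 0" "f q x = 0" if "x \<notin> W" for x using supp[of p x] supp[of q x] that W by auto
  have G_f: "(LINT x|lborel. f p x) = G" for p
    unfolding f_def G_def by (rule integral_translate[OF g(1,2)])
  \<comment> \<open>A square integrable function supported in a set of finite measure is
    integrable.\<close>
  have int_f: "integrable lborel (f p)" for p
  proof -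
    have "integrable lborel (\<lambda>x. indicator (cball p \<rho>) x * f p x)"
      by (rule L1_bound(1)[OF _ emeasure_cball_finite sf]) simp
    moreover have "(\<lambda>x. indicator (cball p \<rho>) x * f p x) = f p"
      using supp[of p] by (auto simp: fun_eq_iff split: split_indicator)
    ultimately show ?thesis by simp
  qed
  have G0: "0 \<le> G" unfolding G_def by (simp add: g(2))
  define X Y where "X = abs_Lsq (f p)" and "Y = abs_Lsq (f q)"
  have XX: "X \<bullet> X = s" and YY: "Y \<bullet> Y = s"
    using sq_int_translate(2)[OF g(1) s(1)] s(2) unfolding X_def Y_def f_def by auto
  have pq0: "f p x * f q x = 0" for x using supp[of p x] supp[of q x] disj[of x] by auto
  have XY: "X \<bullet> Y = 0" unfolding X_def Y_def abs_inner[OF sf sf] pq0 by simp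
  have TZ: "T (abs_Lsq (f z)) \<bullet> abs_Lsq (f w) = (LINT x|lborel. pot k W (f z) x * f w x)" for z w
    unfolding pot_op_abs[OF S sf] by (rule abs_inner[OF pot_sq_int(1)[OF S sf] sf])
  have p0: "0 \<le> pot k W (f z) x" for z x
    unfolding pot_def by (intro mult_nonneg_nonneg integral_nonneg_AE AE_I2) (auto simp: k_nonneg f0)
  have TE: "T (abs_Lsq (f z)) \<bullet> abs_Lsq (f z) = e" if "\<And>x. x \<notin> W \<Longrightarrow> f z x = 0" for z
  proof -
    have "ennreal (LINT x|lborel. pot k W (f z) x * f z x) = ennreal e"
      using pot_energy[OF sf f0 that] energy_translate[OF g(1), of z] e(1) unfolding f_def by simp
    moreover have "0 \<le> (LINT x|lborel. pot k W (f z) x * f z x)"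
      by (intro integral_nonneg_AE AE_I2 mult_nonneg_nonneg p0 f0)
    ultimately show ?thesis unfolding TZ using e(2) by simp
  qed
  have TX: "T X \<bullet> X = e" unfolding X_def by (rule TE) (rule supp_W)
  have TY: "T Y \<bullet> Y = e" unfolding Y_def by (rule TE) (rule supp_W)
  define M where "M = T X \<bullet> Y"
  have M0: "0 \<le> M" unfolding M_def X_def Y_def TZ by (intro integral_nonneg_AE AE_I2 mult_nonneg_nonneg p0 f0)
  have pot_le: "pot k W (f p) x \<le> h l * G" if x: "x \<in> cball q \<rho>" for x
  proof -
    have "pot k W (f p) x = (LINT y|lborel. k (x - y) * (indicator W y * f p y))" using x W by (simp add: pot_def)
    also have "\<dots> \<le> (LINT y|lborel. h l * f p y)"
    proof (rule integral_mono')
      fix y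
      show "k (x - y) * (indicator W y * f p y) \<le> h l * f p y"
      proof (cases "f p y = 0")
        case False
        then have y: "y \<in> cball p \<rho>" by (rule supp)
        have "l \<le> norm (x - y)" using l(2)[OF y x] by (simp add: norm_minus_commute)
        then have "k (x - y) \<le> h l" unfolding k_eq by (rule h_antimono[OF l(1)])
        then show ?thesis using y W f0[of p y] by (simp add: mult_right_mono)
      qed simp
      show "0 \<le> h l * f p y" using h_nonneg f0 by simp
    qed (use int_f in simp)
    finally show ?thesis by (simp add: G_f)
  qed
  have M_le: "M \<le> h l * G\<^sup>2"
  proof -
    have "M \<le> (LINT x|lborel. h l * G * f q x)"
      unfolding M_def X_def Y_def TZ
    proof (rule integral_mono')
      fix x
      show "pot k W (f p) x * f q x \<le> h l * G * f q x"
        using pot_le[of x] supp[of q x] f0[of q x] by (cases "f q x = 0") (auto intro: mult_right_mono)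
      show "0 \<le> h l * G * f q x" using h_nonneg G0 f0 by simp
    qed (use int_f in simp)
    also have "\<dots> = h l * G\<^sup>2" by (simp add: G_f power2_eq_square)
    finally show ?thesis .
  qed
  have TYX: "T Y \<bullet> X = M" unfolding M_def using op.symmetric[of Y X] by (simp add: inner_commute)
  have norm_eq: "(a *\<^sub>R X + b *\<^sub>R Y) \<bullet> (a *\<^sub>R X + b *\<^sub>R Y) = (a\<^sup>2 + b\<^sup>2) * s" for a b
    using XX YY XY by (simp add: inner_add_left inner_add_right inner_commute[of Y X] power2_eq_square algebra_simps)
  have Q_eq: "T (a *\<^sub>R X + b *\<^sub>R Y) \<bullet> (a *\<^sub>R X + b *\<^sub>R Y) = (a\<^sup>2 + b\<^sup>2) * e + 2 * a * b * M" for a b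
    using TX TY TYX M_def
    by (simp add: op.add op.scale inner_add_left inner_add_right power2_eq_square algebra_simps)
  obtain e1 e2 \<mu> \<nu> where ev: "norm e1 = 1" "norm e2 = 1" "e1 \<bullet> e2 = 0" "op.eigen \<mu> e1" "op.eigen \<nu> e2" "\<mu> \<ge> c" "\<nu> \<ge> c"
  proof (rule op.two_eigenvectors[of X Y c])
    show "a *\<^sub>R X + b *\<^sub>R Y \<noteq> 0" if "a \<noteq> 0 \<or> b \<noteq> 0" for a b
    proof
      assume "a *\<^sub>R X + b *\<^sub>R Y = 0"
      then have "(a\<^sup>2 + b\<^sup>2) * s = 0" using norm_eq[of a b] by simp
      then show False using s(2) that by (simp add: sum_power2_eq_zero_iff)
    qed
    show "T (a *\<^sub>R X + b *\<^sub>R Y) \<bullet> (a *\<^sub>R X + b *\<^sub>R Y) \<ge> c * ((a *\<^sub>R X + b *\<^sub>R Y) \<bullet> (a *\<^sub>R X + b *\<^sub>R Y))" for a b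
    proof -
      \<comment> \<open>Only the interaction term 2 * a * b * M can be negative; it is at least -
        (a^2 + b^2) * M, and \<open>M\<close> is at most h l * G^2.\<close>
      have "0 \<le> (a + b)\<^sup>2" by simp
      then have "- (2 * a * b) \<le> a\<^sup>2 + b\<^sup>2" by (simp add: power2_sum)
      then have "- (2 * a * b) * M \<le> (a\<^sup>2 + b\<^sup>2) * M" using M0 by (rule mult_right_mono)
      also have "\<dots> \<le> (a\<^sup>2 + b\<^sup>2) * (h l * G\<^sup>2)" using M_le by (intro mult_left_mono) auto
      finally have 1: "- (2 * a * b * M) \<le> (a\<^sup>2 + b\<^sup>2) * (h l * G\<^sup>2)" by simp
      have "(a\<^sup>2 + b\<^sup>2) * (c * s) \<le> (a\<^sup>2 + b\<^sup>2) * (e - h l * G\<^sup>2)"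
        using c(2) unfolding G_def by (intro mult_left_mono) auto
      then have "(a\<^sup>2 + b\<^sup>2) * (c * s) \<le> (a\<^sup>2 + b\<^sup>2) * e - (a\<^sup>2 + b\<^sup>2) * (h l * G\<^sup>2)"
        by (simp only: right_diff_distrib)
      with 1 have "(a\<^sup>2 + b\<^sup>2) * (c * s) \<le> (a\<^sup>2 + b\<^sup>2) * e + 2 * a * b * M" by linarith
      then show ?thesis unfolding norm_eq Q_eq by (simp add: mult.left_commute)
    qed
  qed (use c(1) in auto)
  show ?thesis
    by (rule second_eigenvalue_ge[OF lam c(1) ev(4,5) _ _ ev(3,6,7)]) (use ev(1,2) in auto)
qed

end

section \<open>The supremum and the limit\<close>

lemma ball_radius:
  assumes "0 < m"
  obtains \<rho> where "0 < \<rho>" "emeasure lborel (cball (0::'a::euclidean_space) \<rho>) = ennreal m"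
    "\<And>(x::'a) r. 0 < r \<Longrightarrow> measure lebesgue (ball x r) = m \<Longrightarrow> r = \<rho>"
proof -
  define \<omega> where "\<omega> = unit_ball_vol (real DIM('a))"
  have \<omega>: "0 < \<omega>" by (simp add: \<omega>_def unit_ball_vol_pos)
  define \<rho> where "\<rho> = root DIM('a) (m / \<omega>)"
  have \<rho>: "0 < \<rho>" using assms \<omega> by (simp add: \<rho>_def real_root_gt_zero)
  have pow: "\<rho> ^ DIM('a) = m / \<omega>" using assms \<omega> by (simp add: \<rho>_def real_root_pow_pos)
  have "emeasure lborel (cball (0::'a) \<rho>) = ennreal m"
    using \<rho> \<omega> by (simp add: emeasure_cball pow \<omega>_def[symmetric])
  moreover have "r = \<rho>" if "0 < r" "measure lebesgue (ball x r) = m" for x :: 'a and r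
  proof -
    have "measure lebesgue (ball x r) = measure lborel (ball x r)" by simp
    also have "\<dots> = \<omega> * r ^ DIM('a)"
      using that(1) \<omega> by (simp add: measure_def emeasure_ball \<omega>_def[symmetric])
    finally have "r ^ DIM('a) = m / \<omega>" using that(2) \<omega> by (simp add: field_simps)
    then have "r ^ DIM('a) = \<rho> ^ DIM('a)" by (simp add: pow)
    then show ?thesis using that(1) \<rho> by (simp add: power_eq_iff_eq_base)
  qed
  ultimately show thesis using \<rho> that by blast
qed

lemma ball_cball_AE: "AE x in lborel. x \<in> ball (p::'a::euclidean_space) r \<longleftrightarrow> x \<in> cball p r"
proof -
  have "sphere p r \<in> null_sets lebesgue" using negligible_sphere by (simp add: negligible_iff_null_sets)
  then have "AE x in lborel. x \<notin> sphere p r"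
    using AE_not_in[of "sphere p r" lebesgue] by (simp add: AE_lebesgue_iff)
  then show ?thesis by eventually_elim auto
qed

theorem theorem2p7:
  fixes \<alpha> V :: real
    and Bp Bm :: "real \<Rightarrow> (real ^ 'd) set"
  assumes "0 < \<alpha>" and "\<alpha> < real CARD('d)" and "0 < V"
    and "\<And>l. 0 < l \<Longrightarrow> \<exists>x r. 0 < r \<and> Bp l = ball x r"
    and "\<And>l. 0 < l \<Longrightarrow> \<exists>x r. 0 < r \<and> Bm l = ball x r"
    and "\<And>l. 0 < l \<Longrightarrow> measure lebesgue (Bp l) = V / 2"
    and "\<And>l. 0 < l \<Longrightarrow> measure lebesgue (Bm l) = V / 2"
    and "\<And>l. 0 < l \<Longrightarrow> setdist (Bp l) (Bm l) = l"
  shows "bdd_above {riesz_eigenvalue \<alpha> \<Omega> 2 | \<Omega> :: (real ^ 'd) set.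
             \<Omega> \<in> lmeasurable \<and> measure lebesgue \<Omega> = V} \<and>
         ((\<lambda>l. riesz_eigenvalue \<alpha> (Bp l \<union> Bm l) 2) \<longlongrightarrow>
           Sup {riesz_eigenvalue \<alpha> \<Omega> 2 | \<Omega> :: (real ^ 'd) set.
             \<Omega> \<in> lmeasurable \<and> measure lebesgue \<Omega> = V}) at_top"
proof -
  have \<alpha>: "0 < \<alpha>" "\<alpha> < real DIM(real ^ 'd)" using assms(1,2) by simp_all
  obtain \<rho> where \<rho>: "0 < \<rho>" "emeasure lborel (cball (0 :: real ^ 'd) \<rho>) = ennreal (V / 2)"
    "\<And>(x :: real ^ 'd) r. 0 < r \<Longrightarrow> measure lebesgue (ball x r) = V / 2 \<Longrightarrow> r = \<rho>"
    by (rule ball_radius[OF half_gt_zero[OF \<open>0 < V\<close>], where 'a = "real ^ 'd"]) blast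
  \<comment> \<open>The kernel depends on \<alpha> only, so an instance with the empty set gives
    access to \<Lambda> before any \<Omega> is chosen; the later instances share this
    kernel.\<close>
  interpret K: riesz_setting \<alpha> "{}" "{} :: (real ^ 'd) set"
    by unfold_locales (use \<alpha> in auto)
  obtain \<Lambda> where \<Lambda>: "K.ball_bound \<rho> \<Lambda>"
    and near: "\<And>c. 0 \<le> c \<Longrightarrow> c < \<Lambda> \<Longrightarrow> \<exists>g. g \<in> borel_measurable borel \<and> (\<forall>x. 0 \<le> g x) \<and> (\<forall>x. \<rho> < norm x \<longrightarrow> g x = 0) \<and>
      (\<integral>\<^sup>+x. ennreal ((g x)\<^sup>2) \<partial>lborel) < \<infinity> \<and> ennreal c * (\<integral>\<^sup>+x. ennreal ((g x)\<^sup>2) \<partial>lborel) < K.energy g"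
    by (rule K.least_ball_bound[of \<rho>]) blast
  have eigenvalue: "\<exists>lam. riesz_eigenvalue_enumeration \<alpha> \<Omega> lam \<and> riesz_eigenvalue \<alpha> \<Omega> 2 = lam 1"
    if "riesz_setting \<alpha> \<Omega> W" for \<Omega> W :: "(real ^ 'd) set"
  proof -
    have "riesz_eigenvalue_enumeration \<alpha> \<Omega> (SOME lam. riesz_eigenvalue_enumeration \<alpha> \<Omega> lam)"
      by (rule someI_ex[OF riesz_setting.enumeration_exists[OF that]])
    then show ?thesis by (intro exI conjI) (simp_all add: riesz_eigenvalue_def)
  qed
  have upper: "riesz_eigenvalue \<alpha> \<Omega> 2 \<le> \<Lambda> \<and> 0 \<le> riesz_eigenvalue \<alpha> \<Omega> 2"
    if \<Omega>: "\<Omega> \<in> lmeasurable" "measure lebesgue \<Omega> = V" for \<Omega> :: "(real ^ 'd) set"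
  proof -
    obtain W where W: "W \<in> sets borel" "emeasure lborel W = ennreal (measure lebesgue \<Omega>)" "AE x in lborel. x \<in> \<Omega> \<longleftrightarrow> x \<in> W"
      by (rule lmeasurable_borel_representative[OF \<Omega>(1)])
    interpret O: riesz_setting \<alpha> \<Omega> W
      by unfold_locales (use \<alpha> \<Omega> W in auto)
    obtain lam where lam: "riesz_eigenvalue_enumeration \<alpha> \<Omega> lam" "riesz_eigenvalue \<alpha> \<Omega> 2 = lam 1"
      using eigenvalue[OF O.riesz_setting_axioms] by blast
    have "emeasure lborel W \<le> 2 * emeasure lborel (cball (0 :: real ^ 'd) \<rho>)"
      unfolding W(2) \<Omega>(2) \<rho>(2) mult_2 using \<open>0 < V\<close> by (simp flip: ennreal_plus)
    then have "lam 1 \<le> \<Lambda>"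
      by (intro O.second_eigenvalue_le[OF lam(1) \<Lambda>]) (use \<rho>(1) in auto)
    moreover have "0 \<le> lam 1" using lam(1) by (simp add: riesz_eigenvalue_enumeration_def)
    ultimately show ?thesis by (simp add: lam(2))
  qed
  define A where "A = {riesz_eigenvalue \<alpha> \<Omega> 2 | \<Omega> :: (real ^ 'd) set. \<Omega> \<in> lmeasurable \<and> measure lebesgue \<Omega> = V}"
  have A_le: "a \<le> \<Lambda>" if "a \<in> A" for a using that upper by (auto simp: A_def)
  then have bdd: "bdd_above A" by (rule bdd_aboveI)
  have balls: "\<exists>p q. Bp l = ball p \<rho> \<and> Bm l = ball q \<rho> \<and> (\<forall>x\<in>cball p \<rho>. \<forall>y\<in>cball q \<rho>. l \<le> norm (x - y))" if l: "0 < l" for l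
  proof -
    obtain p r where p: "0 < r" "Bp l = ball p r" using assms(4)[OF l] by blast
    obtain q r' where q: "0 < r'" "Bm l = ball q r'" using assms(5)[OF l] by blast
    have r: "r = \<rho>" "r' = \<rho>" using \<rho>(3)[OF p(1)] \<rho>(3)[OF q(1)] assms(6,7)[OF l] p q by auto
    \<comment> \<open>Closures have the same distance as the open balls, so the separation by
      \<open>l\<close> extends to the closed balls that serve as \<open>W\<close>.\<close>
    have "setdist (closure (ball p \<rho>)) (closure (ball q \<rho>)) = l"
      using assms(8)[OF l] by (simp add: p q r)
    then have "setdist (cball p \<rho>) (cball q \<rho>) = l" using \<rho>(1) by simp
    then have "l \<le> norm (x - y)" if "x \<in> cball p \<rho>" "y \<in> cball q \<rho>" for x y
      using setdist_le_dist[OF that] by (simp add: dist_norm)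
    then show ?thesis using p q r by blast
  qed
  have union: "Bp l \<union> Bm l \<in> lmeasurable \<and> measure lebesgue (Bp l \<union> Bm l) = V" if l: "0 < l" for l
  proof -
    obtain p q where pq: "Bp l = ball p \<rho>" "Bm l = ball q \<rho>" "\<forall>x\<in>cball p \<rho>. \<forall>y\<in>cball q \<rho>. l \<le> norm (x - y)"
      using balls[OF l] by blast
    have "x \<notin> ball q \<rho>" if "x \<in> ball p \<rho>" for x
    proof
      assume "x \<in> ball q \<rho>"
      then have "l \<le> norm (x - x)" using pq(3) that by (meson ball_subset_cball subsetD)
      then show False using l by simp
    qed
    then have "Bp l \<inter> Bm l = {}" using pq by auto
    then have "measure lebesgue (Bp l \<union> Bm l) = V"
      using assms(6,7)[OF l] pq measure_Un3[of "Bp l" lebesgue "Bm l"] by simp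
    moreover have "Bp l \<union> Bm l \<in> lmeasurable"
      unfolding pq(1,2) by (intro fmeasurable.Un lmeasurable_ball)
    ultimately show ?thesis by blast
  qed
  have in_A: "riesz_eigenvalue \<alpha> (Bp l \<union> Bm l) 2 \<in> A" if "0 < l" for l
    using union[OF that] by (auto simp: A_def)
  have lower: "\<forall>\<^sub>F l in at_top. a < riesz_eigenvalue \<alpha> (Bp l \<union> Bm l) 2" if a: "a < \<Lambda>" for a
  proof (cases "a < 0")
    case True
    show ?thesis using eventually_gt_at_top[of 0]
    proof eventually_elim
      case (elim l)
      then show ?case using upper[of "Bp l \<union> Bm l"] union[OF elim] True by auto
    qed
  next
    case False
    \<comment> \<open>The midpoint leaves room on both sides: c < \<Lambda> gives a test function, a
      < c the strict inequality. It is positive, as a bound by eigenvectors requires; negative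
      \<open>a\<close> were settled by the nonnegativity of eigenvalues.\<close>
    define c where "c = (a + \<Lambda>) / 2"
    have c: "a < c" "c < \<Lambda>" "0 < c" using a False by (auto simp: c_def)
    obtain g where g: "g \<in> borel_measurable borel" "\<And>x. 0 \<le> g x" "\<And>x. \<rho> < norm x \<Longrightarrow> g x = 0"
      "(\<integral>\<^sup>+x. ennreal ((g x)\<^sup>2) \<partial>lborel) < \<infinity>" "ennreal c * (\<integral>\<^sup>+x. ennreal ((g x)\<^sup>2) \<partial>lborel) < K.energy g"
      using near[of c] c by auto
    define s where "s = enn2real (\<integral>\<^sup>+x. ennreal ((g x)\<^sup>2) \<partial>lborel)"
    have s: "(\<integral>\<^sup>+x. ennreal ((g x)\<^sup>2) \<partial>lborel) = ennreal s" "0 \<le> s" using g(4) by (simp_all add: s_def)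
    have E_le: "K.energy g \<le> ennreal \<Lambda> * ennreal s"
      unfolding s(1)[symmetric] by (rule K.ball_boundD(2)[OF \<Lambda> g(1,2,3,4)])
    define e where "e = enn2real (K.energy g)"
    have "K.energy g < \<infinity>" using E_le by (rule le_less_trans) (simp add: ennreal_mult_less_top)
    then have e: "K.energy g = ennreal e" "0 \<le> e" by (simp_all add: e_def)
    \<comment> \<open>If the norm of \<open>g\<close> were zero, its energy would be zero by the
      bound \<Lambda>, against the strict inequality for \<open>c\<close>.\<close>
    have "s \<noteq> 0" using g(5) E_le s by auto
    then have s0: "0 < s" using s(2) by simp
    have "ennreal (c * s) < ennreal e" using g(5) c(3) s(2) by (simp add: s(1) e(1) ennreal_mult)
    then have cs: "c * s < e" using c(3) s(2) by (simp add: ennreal_less_iff)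
    define G where "G = (LINT x|lborel. g x)"
    have "((\<lambda>l. e - K.h l * G\<^sup>2) \<longlongrightarrow> e - 0 * G\<^sup>2) at_top"
      by (rule tendsto_diff[OF tendsto_const tendsto_mult[OF K.h_vanish tendsto_const]])
    then have "\<forall>\<^sub>F l in at_top. c * s < e - K.h l * G\<^sup>2" using cs by (intro order_tendstoD(1)) auto
    then show ?thesis using eventually_gt_at_top[of 0]
    proof eventually_elim
      case (elim l)
      obtain p q where pq: "Bp l = ball p \<rho>" "Bm l = ball q \<rho>" "\<forall>x\<in>cball p \<rho>. \<forall>y\<in>cball q \<rho>. l \<le> norm (x - y)"
        using balls[OF elim(2)] by blast
      interpret O: riesz_setting \<alpha> "Bp l \<union> Bm l" "cball p \<rho> \<union> cball q \<rho>"
      proof unfold_locales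
        show "Bp l \<union> Bm l \<in> lmeasurable" using union[OF elim(2)] by simp
        show "emeasure lborel (cball p \<rho> \<union> cball q \<rho>) < \<infinity>" by (rule emeasure_bounded_finite) simp
        show "AE x in lborel. (x \<in> Bp l \<union> Bm l) = (x \<in> cball p \<rho> \<union> cball q \<rho>)"
          using ball_cball_AE[of p \<rho>] ball_cball_AE[of q \<rho>] by eventually_elim (simp add: pq)
      qed (use \<alpha> in auto)
      obtain lam where lam: "riesz_eigenvalue_enumeration \<alpha> (Bp l \<union> Bm l) lam" "riesz_eigenvalue \<alpha> (Bp l \<union> Bm l) 2 = lam 1"
        using eigenvalue[OF O.riesz_setting_axioms] by blast
      have "c \<le> lam 1"
        by (rule O.second_eigenvalue_ge_balls[OF lam(1) refl elim(2) _ g(1,2,3) s(1) s0 e c(3)])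
           (use pq(3) elim(1) in \<open>auto simp: G_def\<close>)
      then show ?case using c(1) by (simp add: lam(2))
    qed
  qed
  have "Sup A = \<Lambda>"
  proof (rule antisym)
    have "A \<noteq> {}" using in_A[of 1] by auto
    then show "Sup A \<le> \<Lambda>" using A_le by (rule cSup_least)
    show "\<Lambda> \<le> Sup A"
    proof (rule dense_le)
      fix a assume "a < \<Lambda>"
      obtain l where l: "a < riesz_eigenvalue \<alpha> (Bp l \<union> Bm l) 2" "0 < l"
        using eventually_happens[OF eventually_conj[OF lower[OF \<open>a < \<Lambda>\<close>] eventually_gt_at_top[of 0]]] by auto
      have "riesz_eigenvalue \<alpha> (Bp l \<union> Bm l) 2 \<le> Sup A" by (rule cSup_upper[OF in_A[OF l(2)] bdd])
      then show "a \<le> Sup A" using l(1) by linarith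
    qed
  qed
  moreover have "((\<lambda>l. riesz_eigenvalue \<alpha> (Bp l \<union> Bm l) 2) \<longlongrightarrow> \<Lambda>) at_top"
  proof (rule order_tendstoI)
    show "\<forall>\<^sub>F l in at_top. riesz_eigenvalue \<alpha> (Bp l \<union> Bm l) 2 < a" if "\<Lambda> < a" for a
      using eventually_gt_at_top[of 0] by eventually_elim (use A_le in_A that le_less_trans in blast)
  qed (rule lower)
  ultimately show ?thesis using bdd unfolding A_def by simp
qed

end
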